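(* Let $\Omega$ be any open set in $\mathbb R^n$, $n\geq 2$. Assume that $\mu$ is a Borel measure in $\Omega$ such that $$\mu(B_r(x)\cap\Omega)\leq C_\mu r^\alpha \quad\text{for } x\in\Omega \text{ and } r>0,$$ for some exponent $\alpha\in(n-1,n]$ and some constant $C_\mu>0$. Then there exist constants $c=c(n)$ and $C=C(n,\alpha,C_\mu)$ such that $$|\mathbf u|_\mu^*(cs)\leq C\bigg[s^{-\frac{n-1}{\alpha}}\int_0^{s^{\frac n\alpha}}|\mathcal E\mathbf u|^*_{\mathcal L^n}(r)\,dr+\int_{s^{\frac n\alpha}}^\infty r^{-\frac{n-1}{n}}|\mathcal E\mathbf u|^*_{\mathcal L^n}(r)\,dr+s^{-\frac{n-1}{\alpha}}\int_0^{s^{\frac{n-1}{\alpha}}}|\mathbf u_{|\partial\Omega}|^*_{\mathcal H^{n-1}}(r)\,dr\bigg]\quad\text{for } s>0,$$ for every function $\mathbf u\in E^{1,1}(\Omega)\cap C_b(\overline\Omega)$.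
   Context: Functions $\mathbf u$ are $\mathbb R^n$-valued. $\mathcal E\mathbf u=\tfrac12(\nabla\mathbf u+(\nabla\mathbf u)^T)$ is the symmetric part of the distributional gradient. $E^{1,1}(\Omega)=\{\mathbf u\in L^1_{\rm loc}(\Omega): |\mathcal E\mathbf u|\in L^1(\Omega)\}$. $C_b(\overline\Omega)$ is the set of functions that are continuous in $\overline\Omega$ and have bounded support. $B_r(x)$ is the ball centered at $x$ with radius $r$; $\mathcal L^n$ is Lebesgue measure and $\mathcal H^{n-1}$ the $(n-1)$-dimensional Hausdorff measure. For a measure space $\mathcal R$ with measure $\nu$ and a $\nu$-measurable function $\phi$ on $\mathcal R$, the decreasing rearrangement $\phi_\nu^*:[0,\infty)\to[0,\infty]$ is $\phi^*_\nu(s)=\inf\{t\geq0:\nu(\{|\phi|>t\})\leq s\}$. Thus $|\mathbf u|^*_\mu$ is the rearrangement on $\Omega$ with respect to $\mu$, $|\mathcal E\mathbf u|^*_{\mathcal L^n}$ that on $\Omega$ with respect to $\mathcal L^n$, and $|\mathbf u_{|\partial\Omega}|^*_{\mathcal H^{n-1}}$ that of the restriction of $|\mathbf u|$ to $\partial\Omega$ with respect to $\mathcal H^{n-1}$. *)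

theory Defs
  imports "HOL-Analysis.Analysis"
begin

section \<open>Hausdorff measure\<close>

text \<open>The \<open>m\<close>-dimensional Hausdorff outer measure, normalised by the volume of the unit ball of
  \<open>\<real>\<^sup>m\<close> so that it agrees with \<open>m\<close>-dimensional area. Covering sets are required to be bounded
  because \<^const>\<open>diameter\<close> is unspecified on unbounded sets.\<close>

definition hausdorff_gauge :: "nat \<Rightarrow> 'a::metric_space set \<Rightarrow> ennreal" where
  "hausdorff_gauge m C =
     (if C = {} then 0 else ennreal (unit_ball_vol (real m) * (diameter C / 2) ^ m))"

definition hausdorff_pre :: "nat \<Rightarrow> real \<Rightarrow> 'a::metric_space set \<Rightarrow> ennreal" where
  "hausdorff_pre m \<delta> A =
     (INF C\<in>{C :: nat \<Rightarrow> 'a set. A \<subseteq> (\<Union>i. C i) \<and> (\<forall>i. bounded (C i) \<and> diameter (C i) \<le> \<delta>)}.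
        \<Sum>i. hausdorff_gauge m (C i))"

definition hausdorff_outer :: "nat \<Rightarrow> 'a::metric_space set \<Rightarrow> ennreal" where
  "hausdorff_outer m A = (SUP \<delta>\<in>{0<..}. hausdorff_pre m \<delta> A)"

definition hausdorff_measure :: "nat \<Rightarrow> 'a::metric_space measure" where
  "hausdorff_measure m = measure_of UNIV (sets borel) (hausdorff_outer m)"

lemma hausdorff_pre_empty:
  assumes "0 < \<delta>" shows "hausdorff_pre m \<delta> ({} :: 'a::metric_space set) = 0"
proof -
  have "hausdorff_pre m \<delta> ({}::'a set) \<le> (\<Sum>i::nat. hausdorff_gauge m ({}::'a set))"
    unfolding hausdorff_pre_def using assms
    by (intro INF_lower[of "\<lambda>_. {}"]) (auto simp: diameter_def)
  then show ?thesis by (simp add: hausdorff_gauge_def)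
qed

lemma hausdorff_pre_mono: "A \<subseteq> B \<Longrightarrow> hausdorff_pre m \<delta> A \<le> hausdorff_pre m \<delta> B"
  unfolding hausdorff_pre_def by (rule INF_superset_mono) auto

lemma hausdorff_pre_antimono: "\<delta> \<le> \<delta>' \<Longrightarrow> hausdorff_pre m \<delta>' A \<le> hausdorff_pre m \<delta> A"
  unfolding hausdorff_pre_def by (rule INF_superset_mono) (blast intro: order_trans, simp)

lemma hausdorff_pre_countably_subadditive:
  fixes A :: "nat \<Rightarrow> 'a::metric_space set"
  shows "hausdorff_pre m \<delta> (\<Union>i. A i) \<le> (\<Sum>i. hausdorff_pre m \<delta> (A i))"
proof (cases "\<exists>i. hausdorff_pre m \<delta> (A i) = top")
  case True
  then have "(\<Sum>i. hausdorff_pre m \<delta> (A i)) = top"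
    by (metis ennreal_suminf_lessD less_top)
  then show ?thesis by simp
next
  case False
  show ?thesis
  proof (rule ennreal_le_epsilon)
    fix e :: real assume e: "0 < e"
    have "\<exists>C. A i \<subseteq> (\<Union>j. C j) \<and> (\<forall>j. bounded (C j) \<and> diameter (C j) \<le> \<delta>) \<and>
       (\<Sum>j. hausdorff_gauge m (C j)) < hausdorff_pre m \<delta> (A i) + ennreal (e * (1/2)^Suc i)" for i
    proof -
      have "hausdorff_pre m \<delta> (A i) < hausdorff_pre m \<delta> (A i) + ennreal (e * (1/2)^Suc i)"
        using ennreal_add_left_cancel_less[of "hausdorff_pre m \<delta> (A i)" 0 "ennreal (e * (1/2)^Suc i)"]
          False e by simp
      then show ?thesis
        unfolding hausdorff_pre_def[of m \<delta> "A i"] by (subst (asm) INF_less_iff) auto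
    qed
    then obtain C where C: "\<And>i. A i \<subseteq> (\<Union>j. C i j)"
      "\<And>i j. bounded (C i j)" "\<And>i j. diameter (C i j) \<le> \<delta>"
      "\<And>i. (\<Sum>j. hausdorff_gauge m (C i j)) < hausdorff_pre m \<delta> (A i) + ennreal (e * (1/2)^Suc i)"
      by metis
    define D where "D = (\<lambda>n. case prod_decode n of (i, j) \<Rightarrow> C i j)"
    have "hausdorff_pre m \<delta> (\<Union>i. A i) \<le> (\<Sum>n. hausdorff_gauge m (D n))"
      unfolding hausdorff_pre_def
    proof (intro INF_lower, safe)
      fix x i assume "x \<in> A i"
      then obtain j where "x \<in> C i j" using C(1) by blast
      then have "x \<in> D (prod_encode (i, j))" by (simp add: D_def)
      then show "x \<in> (\<Union>n. D n)" by blast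
    qed (auto simp: D_def C split: prod.split)
    also have "\<dots> = (\<Sum>n. case prod_decode n of (i, j) \<Rightarrow> hausdorff_gauge m (C i j))"
      by (auto simp: D_def intro!: suminf_cong split: prod.split)
    also have "\<dots> = (\<Sum>i. \<Sum>j. hausdorff_gauge m (C i j))"
      using suminf_ennreal_2dimen[of "\<lambda>i. \<Sum>j. hausdorff_gauge m (C i j)"
          "\<lambda>(i, j). hausdorff_gauge m (C i j)"] by (simp add: comp_def)
    also have "\<dots> \<le> (\<Sum>i. hausdorff_pre m \<delta> (A i) + ennreal (e * (1/2)^Suc i))"
      by (intro suminf_le less_imp_le C) auto
    also have "\<dots> = (\<Sum>i. hausdorff_pre m \<delta> (A i)) + (\<Sum>i. ennreal (e * (1/2)^Suc i))"
      by (rule suminf_add[symmetric]) auto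
    also have "(\<Sum>i. ennreal (e * (1/2)^Suc i)) = ennreal e"
    proof (rule suminf_ennreal_eq)
      show "(\<lambda>i. e * (1/2)^Suc i) sums e"
        using sums_mult[OF power_half_series, of e] by simp
    qed (use e in auto)
    finally show "hausdorff_pre m \<delta> (\<Union>i. A i) \<le> (\<Sum>i. hausdorff_pre m \<delta> (A i)) + ennreal e" .
  qed
qed

lemma outer_measure_space_hausdorff_outer: "outer_measure_space UNIV (hausdorff_outer m :: 'a::metric_space set \<Rightarrow> ennreal)"
  unfolding outer_measure_space_def
proof (intro conjI)
  show "positive UNIV (hausdorff_outer m :: 'a set \<Rightarrow> ennreal)"
    by (auto simp: positive_def hausdorff_outer_def hausdorff_pre_empty)
  show "increasing UNIV (hausdorff_outer m :: 'a set \<Rightarrow> ennreal)"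
    by (auto simp: increasing_def hausdorff_outer_def intro!: SUP_mono hausdorff_pre_mono)
  show "countably_subadditive UNIV (hausdorff_outer m :: 'a set \<Rightarrow> ennreal)"
    unfolding countably_subadditive_def
  proof (intro allI impI)
    fix A :: "nat \<Rightarrow> 'a set"
    have "hausdorff_pre m \<delta> (\<Union>i. A i) \<le> (\<Sum>i. hausdorff_outer m (A i))" if "0 < \<delta>" for \<delta>
    proof -
      have "(\<Sum>i. hausdorff_pre m \<delta> (A i)) \<le> (\<Sum>i. hausdorff_outer m (A i))"
        using that by (intro suminf_le) (auto simp: hausdorff_outer_def intro!: SUP_upper)
      with hausdorff_pre_countably_subadditive show ?thesis by (rule order_trans)
    qed
    then show "hausdorff_outer m (\<Union>i. A i) \<le> (\<Sum>i. hausdorff_outer m (A i))"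
      unfolding hausdorff_outer_def[of m "\<Union>i. A i"] by (intro SUP_least) auto
  qed
qed

lemma hausdorff_pre_separated:
  assumes sep: "\<And>x y. x \<in> P \<Longrightarrow> y \<in> Q \<Longrightarrow> d \<le> dist x y" and "\<delta> < d"
  shows "hausdorff_pre m \<delta> P + hausdorff_pre m \<delta> Q \<le> hausdorff_pre m \<delta> (P \<union> Q)"
  unfolding hausdorff_pre_def[of m \<delta> "P \<union> Q"]
proof (intro INF_greatest, safe)
  fix C :: "nat \<Rightarrow> 'a set"
  assume cov: "P \<union> Q \<subseteq> (\<Union>i. C i)" and C: "\<forall>i. bounded (C i) \<and> diameter (C i) \<le> \<delta>"
  define D where "D = (\<lambda>S i. if C i \<inter> S = {} then {} else C i)"
  have le: "hausdorff_pre m \<delta> S \<le> (\<Sum>i. hausdorff_gauge m (D S i))" if S: "S \<subseteq> P \<union> Q" for S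
  proof -
    have "S \<subseteq> (\<Union>i. D S i)"
    proof
      fix x assume x: "x \<in> S"
      then obtain i where "x \<in> C i" using cov S by blast
      with x have "x \<in> D S i" by (auto simp: D_def)
      then show "x \<in> (\<Union>i. D S i)" by blast
    qed
    moreover have "0 \<le> \<delta>"
      using C diameter_ge_0 order_trans by blast
    ultimately show ?thesis
      unfolding hausdorff_pre_def using C by (intro INF_lower) (auto simp: D_def)
  qed
  have disj: "D P i = {} \<or> D Q i = {}" for i
  proof (rule ccontr)
    assume "\<not> ?thesis"
    then obtain x y where xy: "x \<in> P" "y \<in> Q" "x \<in> C i" "y \<in> C i"
      by (auto simp: D_def split: if_splits)
    then have "dist x y \<le> \<delta>"
      using C diameter_bounded_bound order_trans by metis
    with sep[OF xy(1,2)] \<open>\<delta> < d\<close> show False by simp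
  qed
  then have gauge: "hausdorff_gauge m (D P i) + hausdorff_gauge m (D Q i) \<le> hausdorff_gauge m (C i)" for i
  proof -
    have "hausdorff_gauge m (D S i) \<le> hausdorff_gauge m (C i)" for S
      by (simp add: D_def hausdorff_gauge_def)
    then show ?thesis
      using disj[of i] by (elim disjE) (simp_all add: hausdorff_gauge_def[of m "{}"])
  qed
  have "hausdorff_pre m \<delta> P + hausdorff_pre m \<delta> Q \<le>
      (\<Sum>i. hausdorff_gauge m (D P i)) + (\<Sum>i. hausdorff_gauge m (D Q i))"
    by (intro add_mono le) auto
  also have "\<dots> = (\<Sum>i. hausdorff_gauge m (D P i) + hausdorff_gauge m (D Q i))"
    by (rule suminf_add) auto
  also have "\<dots> \<le> (\<Sum>i. hausdorff_gauge m (C i))"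
    by (intro suminf_le gauge) auto
  finally show "hausdorff_pre m \<delta> P + hausdorff_pre m \<delta> Q \<le> (\<Sum>i. hausdorff_gauge m (C i))" .
qed

lemma hausdorff_outer_separated:
  assumes sep: "\<And>x y. x \<in> P \<Longrightarrow> y \<in> Q \<Longrightarrow> d \<le> dist x y" and "0 < d"
  shows "hausdorff_outer m P + hausdorff_outer m Q \<le> hausdorff_outer m (P \<union> Q)"
proof -
  have *: "hausdorff_pre m a P + hausdorff_pre m b Q \<le> hausdorff_outer m (P \<union> Q)"
    if "0 < a" "0 < b" for a b
  proof -
    define \<delta> where "\<delta> = min (min a b) (d / 2)"
    have \<delta>: "0 < \<delta>" "\<delta> \<le> a" "\<delta> \<le> b" "\<delta> < d" using that \<open>0 < d\<close> by (auto simp: \<delta>_def)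
    have "hausdorff_pre m a P + hausdorff_pre m b Q \<le> hausdorff_pre m \<delta> P + hausdorff_pre m \<delta> Q"
      by (intro add_mono hausdorff_pre_antimono \<delta>)
    also have "\<dots> \<le> hausdorff_pre m \<delta> (P \<union> Q)"
      by (rule hausdorff_pre_separated[OF sep \<delta>(4)])
    also have "\<dots> \<le> hausdorff_outer m (P \<union> Q)"
      unfolding hausdorff_outer_def using \<delta> by (intro SUP_upper) auto
    finally show ?thesis .
  qed
  have ne: "{0::real<..} \<noteq> {}" by auto
  have "hausdorff_pre m a P + hausdorff_outer m Q \<le> hausdorff_outer m (P \<union> Q)" if "0 < a" for a
    unfolding hausdorff_outer_def[of m Q] ennreal_SUP_add_right[OF ne]
    by (intro SUP_least * that) auto
  then show ?thesis
    unfolding hausdorff_outer_def[of m P] ennreal_SUP_add_left[OF ne, symmetric]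
    by (auto intro: SUP_least)
qed

text \<open>Caratheodory's criterion: a metric outer measure is additive across closed sets.\<close>

lemma metric_outer_measure_closed:
  fixes H :: "'a::metric_space set \<Rightarrow> ennreal"
  assumes oms: "outer_measure_space UNIV H"
    and sep: "\<And>P Q d. (\<And>x y. x \<in> P \<Longrightarrow> y \<in> Q \<Longrightarrow> d \<le> dist x y) \<Longrightarrow> 0 < d \<Longrightarrow> H P + H Q \<le> H (P \<union> Q)"
    and F: "closed F"
  shows "F \<in> lambda_system UNIV UNIV H"
proof -
  have pos: "H {} = 0" and mono: "\<And>A B. A \<subseteq> B \<Longrightarrow> H A \<le> H B"
    and csa: "countably_subadditive UNIV H"
    using oms by (auto simp: outer_measure_space_def positive_def increasing_def)
  interpret sigma_algebra "UNIV :: 'a set" UNIV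
    using sigma_algebra_Pow[of UNIV] by simp
  have sub: "H (A \<union> B) \<le> H A + H B" for A B
  proof -
    have "H (A \<union> (B - A)) \<le> H A + H (B - A)"
      using countably_subadditive_subadditive[OF _ csa] pos
      by (intro subadditiveD[where M = UNIV]) (auto simp: positive_def)
    also have "\<dots> \<le> H A + H B" by (intro add_left_mono mono) auto
    finally show ?thesis by simp
  qed
  have "H (T \<inter> F) + H (T - F) \<le> H T" for T
  proof (cases "F = {} \<or> H T = top")
    case True
    then show ?thesis using pos by auto
  next
    case False
    define S where "S = T - F"
    define A where "A = (\<lambda>k::nat. {x \<in> S. 1 / real (Suc k) \<le> infdist x F})"
    define R where "R = (\<lambda>k. A (Suc k) - A k)"
    have A_mono: "A j \<subseteq> A k" if "j \<le> k" for j k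
    proof -
      have "1 / real (Suc k) \<le> 1 / real (Suc j)" using that by (simp add: frac_le)
      then show ?thesis unfolding A_def by force
    qed
    have S_eq: "S = (\<Union>k. A k)"
    proof (safe)
      fix x assume x: "x \<in> S"
      then have "0 < infdist x F"
        using F False by (auto simp: S_def infdist_pos_not_in_closed)
      then obtain k where "1 / real (Suc k) < infdist x F"
        by (rule nat_approx_posE)
      with x have "x \<in> A k" by (auto simp: A_def)
      then show "x \<in> (\<Union>k. A k)" by blast
    qed (auto simp: A_def)
    have sepF: "H P + H Q \<le> H (P \<union> Q)" if "P \<subseteq> A k" "Q \<subseteq> F" for P Q k
    proof (rule sep[where d = "1 / real (Suc k)"])
      fix x y assume "x \<in> P" "y \<in> Q"
      then have "1 / real (Suc k) \<le> infdist x F" "y \<in> F" using that by (auto simp: A_def)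
      then show "1 / real (Suc k) \<le> dist x y" using infdist_le[of y F x] by linarith
    qed simp
    have sepA: "H P + H Q \<le> H (P \<union> Q)" if "P \<subseteq> A k" "Q \<subseteq> S - A (Suc k)" for P Q k
    proof (rule sep[where d = "1 / real (Suc k) - 1 / real (Suc (Suc k))"])
      fix x y assume "x \<in> P" "y \<in> Q"
      then have "1 / real (Suc k) \<le> infdist x F" "infdist y F < 1 / real (Suc (Suc k))"
        using that by (auto simp: A_def)
      then show "1 / real (Suc k) - 1 / real (Suc (Suc k)) \<le> dist x y"
        using infdist_triangle[of x F y] by linarith
    qed (simp add: frac_less2)
    have parity: "(\<Sum>i<n. H (R (2 * i + p))) \<le> H (\<Union>i<n. R (2 * i + p))" for n p
    proof (induction n)
      case (Suc n)
      have "H (\<Union>i<n. R (2 * i + p)) + H (R (2 * n + p)) \<le> H ((\<Union>i<n. R (2 * i + p)) \<union> R (2 * n + p))"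
      proof (cases n)
        case (Suc j)
        have "(\<Union>i<n. R (2 * i + p)) \<subseteq> A (2 * j + p + 1)"
        proof (intro UN_least)
          fix i assume "i \<in> {..<n}"
          then have "A (Suc (2 * i + p)) \<subseteq> A (2 * j + p + 1)" using Suc by (intro A_mono) auto
          then show "R (2 * i + p) \<subseteq> A (2 * j + p + 1)" unfolding R_def by blast
        qed
        moreover have "R (2 * n + p) \<subseteq> S - A (Suc (2 * j + p + 1))"
          unfolding R_def Suc by (auto simp: A_def)
        ultimately show ?thesis by (rule sepA)
      qed (auto simp: pos)
      moreover have "(\<Union>i<Suc n. R (2 * i + p)) = (\<Union>i<n. R (2 * i + p)) \<union> R (2 * n + p)"
        by (auto simp: less_Suc_eq)
      ultimately show ?case
        using order_trans[OF add_right_mono[OF Suc.IH]] by simp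
    qed (simp add: pos)
    have RT: "(\<Sum>i<n. H (R (2 * i + p))) \<le> H T" for n p
      by (rule order_trans[OF parity mono]) (auto simp: R_def A_def S_def)
    define Z where "Z = (\<Sum>k. H (R k))"
    have "(\<Sum>k<n. H (R k)) \<le> H T + H T" for n
    proof -
      have "(\<Sum>k<n. H (R k)) \<le> (\<Sum>k<2*n. H (R k))"
        by (rule sum_mono2) auto
      also have "\<dots> = (\<Sum>i<n. H (R (2 * i + 0))) + (\<Sum>i<n. H (R (2 * i + 1)))"
        by (induction n) (auto simp: algebra_simps)
      also have "\<dots> \<le> H T + H T" by (intro add_mono RT)
      finally show ?thesis .
    qed
    then have "Z \<le> H T + H T" unfolding Z_def by (intro suminf_le_const) auto
    then have Z: "Z \<noteq> top" using False by (auto simp: top_unique)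
    have tail: "H S + (\<Sum>j<k. H (R j)) \<le> H (A k) + Z" for k
    proof -
      have "S \<subseteq> A k \<union> (\<Union>j. R (j + k))"
      proof
        fix x assume "x \<in> S"
        then obtain l where l: "x \<in> A l" using S_eq by auto
        show "x \<in> A k \<union> (\<Union>j. R (j + k))"
        proof (cases "x \<in> A k")
          case False
          define q where "q = (LEAST l. x \<in> A l)"
          have q: "x \<in> A q" unfolding q_def by (rule LeastI[of _ l]) (rule l)
          have "k < q" using q False A_mono by (metis in_mono not_le)
          then obtain j where j: "q = Suc (j + k)" by (metis add.commute less_imp_Suc_add)
          then have "x \<notin> A (j + k)" unfolding q_def by (metis lessI not_less_Least)
          then have "x \<in> R (j + k)" using q j by (simp add: R_def)
          then show ?thesis by blast
        qed simp
      qed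
      then have "H S \<le> H (A k) + H (\<Union>j. R (j + k))" by (rule order_trans[OF mono sub])
      also have "H (\<Union>j. R (j + k)) \<le> (\<Sum>j. H (R (j + k)))"
      proof -
        have "disjoint_family (\<lambda>j. R (j + k))"
          unfolding disjoint_family_on_def
        proof (intro ballI impI)
          have *: "R (i + k) \<inter> R (j + k) = {}" if "i < j" for i j
            using A_mono[of "Suc (i + k)" "j + k"] that by (auto simp: R_def)
          fix i j :: nat assume "i \<noteq> j"
          then show "R (i + k) \<inter> R (j + k) = {}"
            using *[of i j] *[of j i] by (metis Int_commute linorder_neqE_nat)
        qed
        then show ?thesis using csa unfolding countably_subadditive_def by auto
      qed
      finally have "H S \<le> H (A k) + (\<Sum>j. H (R (j + k)))"
        by (simp add: add_left_mono)
      then have "H S + (\<Sum>j<k. H (R j)) \<le> H (A k) + ((\<Sum>j. H (R (j + k))) + (\<Sum>j<k. H (R j)))"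
        unfolding add.assoc[symmetric] by (rule add_right_mono)
      also have "(\<Sum>j. H (R (j + k))) + (\<Sum>j<k. H (R j)) = Z"
        unfolding Z_def by (rule suminf_offset[symmetric]) auto
      finally show ?thesis .
    qed
    have "(H (T \<inter> F) + H S) + (\<Sum>j<k. H (R j)) \<le> H T + Z" for k
    proof -
      have "H (A k) + H (T \<inter> F) \<le> H (A k \<union> (T \<inter> F))" by (rule sepF) auto
      also have "\<dots> \<le> H T" by (rule mono) (auto simp: A_def S_def)
      finally have "H (A k) + H (T \<inter> F) \<le> H T" .
      then have "H (T \<inter> F) + (H (A k) + Z) \<le> H T + Z"
        unfolding add.assoc[symmetric] add.commute[of "H (T \<inter> F)"] by (rule add_right_mono)
      with add_left_mono[OF tail[of k]] show ?thesis
        unfolding add.assoc by (rule order_trans)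
    qed
    then have "(SUP k. (H (T \<inter> F) + H S) + (\<Sum>j<k. H (R j))) \<le> H T + Z"
      by (intro SUP_least)
    then have "(H (T \<inter> F) + H S) + Z \<le> H T + Z"
      unfolding Z_def suminf_eq_SUP by (subst ennreal_SUP_add_right) simp_all
    then show ?thesis
      using Z ennreal_add_left_cancel_le[of Z "H (T \<inter> F) + H S" "H T"]
      unfolding S_def by (simp add: add.commute[of Z])
  qed
  moreover have "H T \<le> H (T \<inter> F) + H (T - F)" for T
    using sub[of "T \<inter> F" "T - F"] unfolding Int_Diff_Un .
  ultimately show ?thesis
    unfolding lambda_system_eq by (simp add: antisym)
qed

lemma sets_hausdorff_measure [simp, measurable_cong]: "sets (hausdorff_measure m) = sets borel"
  using sets.sigma_sets_eq[of borel] by (simp add: hausdorff_measure_def)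

lemma space_hausdorff_measure [simp]: "space (hausdorff_measure m) = UNIV"
  by (simp add: hausdorff_measure_def)

lemma emeasure_hausdorff_measure:
  fixes A :: "'a::metric_space set"
  assumes "A \<in> sets borel"
  shows "emeasure (hausdorff_measure m) A = hausdorff_outer m A"
proof -
  let ?H = "hausdorff_outer m :: 'a set \<Rightarrow> ennreal"
  interpret P: sigma_algebra "UNIV :: 'a set" UNIV
    using sigma_algebra_Pow[of UNIV] by simp
  have L: "measure_space UNIV (lambda_system UNIV UNIV ?H) ?H"
    by (rule P.caratheodory_lemma) (rule outer_measure_space_hausdorff_outer)
  interpret L: sigma_algebra "UNIV :: 'a set" "lambda_system UNIV UNIV ?H"
    using L by (simp add: measure_space_def)
  have "Collect closed \<subseteq> lambda_system UNIV UNIV ?H"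
  proof
    fix F :: "'a set" assume "F \<in> Collect closed"
    then show "F \<in> lambda_system UNIV UNIV ?H"
      by (intro metric_outer_measure_closed outer_measure_space_hausdorff_outer)
         (rule hausdorff_outer_separated, assumption+, simp)
  qed
  then have "sets borel \<subseteq> lambda_system UNIV UNIV ?H"
    using L.sigma_sets_subset unfolding borel_eq_closed by simp
  then have "measure_space UNIV (sets borel) ?H"
    using measure_down[OF L] sets.sigma_algebra_axioms[of "borel :: 'a measure"]
    unfolding space_borel by blast
  then show ?thesis
    using assms unfolding hausdorff_measure_def
    by (intro emeasure_measure_of_sigma) (auto simp: measure_space_def)
qed


section \<open>Decreasing rearrangement\<close>

text \<open>The underlying set of the measure space is \<open>space M\<close>; \<open>Inf {} = \<infinity>\<close> in \<^typ>\<open>ennreal\<close>.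
  Only arguments \<open>s \<ge> 0\<close> are meaningful.\<close>

definition decr_rearr :: "'a measure \<Rightarrow> ('a \<Rightarrow> 'b::real_normed_vector) \<Rightarrow> real \<Rightarrow> ennreal" where
  "decr_rearr M f s =
     (INF t\<in>{t. 0 \<le> t \<and> emeasure M {x \<in> space M. t < norm (f x)} \<le> ennreal s}. ennreal t)"


section \<open>Test functions and the distributional symmetric gradient\<close>

definition partial_deriv :: "'n \<Rightarrow> (real^'n \<Rightarrow> real) \<Rightarrow> real^'n \<Rightarrow> real" where
  "partial_deriv i f x = frechet_derivative f (at x) (axis i 1)"

text \<open>Differentiability of all iterated partial derivatives makes each of them continuous.\<close>

definition smooth_fun :: "(real^'n \<Rightarrow> real) \<Rightarrow> bool" where
  "smooth_fun f \<longleftrightarrow> (\<forall>is x. fold partial_deriv is f differentiable (at x))"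

definition test_funs :: "(real^'n) set \<Rightarrow> (real^'n \<Rightarrow> real) set" where
  "test_funs \<Omega> = {\<phi>. smooth_fun \<phi> \<and> compact (closure {x. \<phi> x \<noteq> 0}) \<and> closure {x. \<phi> x \<noteq> 0} \<subseteq> \<Omega>}"

definition L1_loc :: "(real^'n) set \<Rightarrow> (real^'n \<Rightarrow> 'b::euclidean_space) set" where
  "L1_loc \<Omega> = {f. \<forall>K. compact K \<and> K \<subseteq> \<Omega> \<longrightarrow> integrable (lebesgue_on K) f}"

text \<open>The entry \<open>\<partial>\<^sub>j u\<^sub>i\<close> of the distributional gradient, as a functional on test functions.\<close>

definition distr_grad ::
    "(real^'n) set \<Rightarrow> (real^'n \<Rightarrow> real^'n) \<Rightarrow> 'n \<Rightarrow> 'n \<Rightarrow> (real^'n \<Rightarrow> real) \<Rightarrow> real" where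
  "distr_grad \<Omega> u i j \<phi> = - (LINT x|lebesgue_on \<Omega>. u x $ i * partial_deriv j \<phi> x)"

definition distr_sym_grad ::
    "(real^'n) set \<Rightarrow> (real^'n \<Rightarrow> real^'n) \<Rightarrow> 'n \<Rightarrow> 'n \<Rightarrow> (real^'n \<Rightarrow> real) \<Rightarrow> real" where
  "distr_sym_grad \<Omega> u i j \<phi> = (distr_grad \<Omega> u i j \<phi> + distr_grad \<Omega> u j i \<phi>) / 2"

text \<open>The distribution \<open>\<E>u\<close> is the function \<open>G\<close>. Such a \<open>G\<close> is unique up to null sets.
  The norm on \<^typ>\<open>real^'n^'n\<close> is the Frobenius norm.\<close>

definition has_sym_grad ::
    "(real^'n) set \<Rightarrow> (real^'n \<Rightarrow> real^'n) \<Rightarrow> (real^'n \<Rightarrow> real^'n^'n) \<Rightarrow> bool" where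
  "has_sym_grad \<Omega> u G \<longleftrightarrow> G \<in> L1_loc \<Omega> \<and>
     (\<forall>\<phi>\<in>test_funs \<Omega>. \<forall>i j.
        distr_sym_grad \<Omega> u i j \<phi> = (LINT x|lebesgue_on \<Omega>. G x $ i $ j * \<phi> x))"

definition E11 :: "(real^'n) set \<Rightarrow> (real^'n \<Rightarrow> real^'n) set" where
  "E11 \<Omega> = {u \<in> L1_loc \<Omega>. \<exists>G. has_sym_grad \<Omega> u G \<and> integrable (lebesgue_on \<Omega>) (\<lambda>x. norm (G x))}"

definition Cb_closure :: "(real^'n) set \<Rightarrow> (real^'n \<Rightarrow> real^'n) set" where
  "Cb_closure \<Omega> = {u. continuous_on (closure \<Omega>) u \<and> bounded {x \<in> closure \<Omega>. u x \<noteq> 0}}"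

end

theory Submission
  imports Defs
begin

text \<open>
  Along a ray \<open>x + sv\<close> the symmetric gradient controls the component of \<open>u\<close> along \<open>v\<close>, since
  \<open>d/ds (u(x + sv) \<bullet> v) = v \<bullet> Eu(x + sv) v\<close>. Following the rays from \<open>x\<close> until they leave \<open>\<Omega>\<close> or the
  support of \<open>u\<close>, and averaging over \<open>v\<close>, bounds \<open>|u(x)|\<close> by a Riesz potential of \<open>|Eu|\<close> plus the average
  over \<open>v\<close> of \<open>|u|\<close> at the boundary points on the rays. Averaging over the annulus \<open>1 \<le> |v| \<le> 3\<close> with
  Lebesgue measure avoids surface measure on the sphere.

  With \<open>d = n - 1\<close>, the growth condition on \<open>\<mu>\<close> bounds the integral of \<open>|x - y|^(-d)\<close> over \<open>E\<close> by a
  multiple of \<open>\<mu>(E)^(1 - d/\<alpha>)\<close>, which is the weak type estimate for the potential. The same bound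
  handles the boundary term: a ball of radius \<open>r\<close> about \<open>y\<close> is seen from \<open>x\<close> in a set of directions of
  measure at most \<open>C (r / |x - y|)^d\<close>, so covering the superlevel sets of \<open>|u|\<close> on the boundary brings in
  their Hausdorff measure. One truncates \<open>|Eu|\<close> and the boundary values of \<open>|u|\<close> at their
  rearrangements at \<open>s^(n/\<alpha>)\<close> and \<open>s^(d/\<alpha>)\<close> and integrates over a superlevel set of \<open>|u|\<close> of \<open>\<mu>\<close>-measure
  greater than \<open>s\<close>; this gives the theorem with \<open>c = 1\<close>.
\<close>

section \<open>Riesz kernels and measures of controlled growth\<close>

text \<open>The obstacle is that the computation along rays has no pointwise meaning: the symmetric
  gradient is a locally integrable function known only through test functions, whereas \<mu> may be
  singular, so u has to be bounded at every point x and not just at almost every one. The identity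
  is therefore tested against a mollifier averaged along a segment inside \<Omega>. The admissible
  scales depend on the direction, and Fatou's lemma in the direction removes the scale, because
  mollification enlarges a Riesz potential by no more than a constant factor.

  On the boundary no integral against Hausdorff measure is formed. Only superlevel sets above the
  truncation level, which have finite measure, are covered by balls, at countably many levels whose
  mesh tends to zero at the end.

  The truncation points are forced by scaling: there the parts above and below contribute the same
  power of s. The condition \<alpha> > n - 1 enters as the convergence of a geometric series with
  ratio 2^(n - 1 - \<alpha>).\<close>

lemma nn_integral_affine:
  fixes t :: "'a::euclidean_space"
  assumes [measurable]: "f \<in> borel_measurable borel" and c: "c \<noteq> 0"
  shows "(\<integral>\<^sup>+x. f x \<partial>lborel) = ennreal (\<bar>c\<bar> ^ DIM('a)) * (\<integral>\<^sup>+x. f (t + c *\<^sub>R x) \<partial>lborel)"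
  by (subst lborel_affine[OF c, of t]) (simp add: nn_integral_density nn_integral_distr nn_integral_cmult)

lemma ennreal_le_suminf: "f i \<le> (\<Sum>i. f i)" for f :: "nat \<Rightarrow> ennreal"
  using sum_le_suminf[of f "{i}"] by simp

text \<open>The inverse is taken in \<open>ennreal\<close>, so that for d >= 1 the kernel is
  \<open>top\<close> at its pole and estimates by the kernel hold there without exception.\<close>

definition riesz :: "nat \<Rightarrow> 'a::real_normed_vector \<Rightarrow> ennreal" where
  "riesz d w = inverse (ennreal (norm w ^ d))"

lemma riesz_eq: "w \<noteq> 0 \<Longrightarrow> riesz d w = ennreal (1 / norm w ^ d)"
  by (simp add: riesz_def inverse_ennreal inverse_eq_divide)

lemma riesz_zero: "1 \<le> d \<Longrightarrow> riesz d 0 = top"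
  by (simp add: riesz_def power_0_left)

lemma riesz_minus_commute: "riesz d (x - y) = riesz d (y - x)"
  by (simp add: riesz_def norm_minus_commute)

lemma riesz_measurable [measurable]:
  "riesz d \<in> borel_measurable (borel :: 'a::real_normed_vector measure)"
  unfolding riesz_def[abs_def] by measurable

lemma riesz_le:
  assumes "0 < \<rho>" "\<rho> \<le> norm w"
  shows "riesz d w \<le> ennreal (1 / \<rho> ^ d)"
proof -
  have "riesz d w = ennreal (1 / norm w ^ d)"
    using assms by (intro riesz_eq) auto
  also have "\<dots> \<le> ennreal (1 / \<rho> ^ d)"
    using assms by (intro ennreal_leI divide_left_mono power_mono mult_pos_pos zero_less_power) auto
  finally show ?thesis .
qed

text \<open>Centres range over the whole space, so that the kernel may have its pole outside
  \<Omega> or on its boundary. Lebesgue measure is an instance with \<alpha> = n, and \<mu> becomes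
  one after extension by zero; one kernel estimate then serves both.\<close>

locale ball_growth =
  fixes \<nu> :: "'a::euclidean_space measure" and d :: nat and \<alpha> M :: real
  assumes sets_borel [measurable_cong]: "sets \<nu> = sets borel"
    and d_ge: "1 \<le> d" and d_less: "real d < \<alpha>" and M_pos: "0 < M"
    and ball_le: "\<And>y r. 0 < r \<Longrightarrow> emeasure \<nu> (ball y r) \<le> ennreal (M * r powr \<alpha>)"
begin

lemma space_UNIV: "space \<nu> = UNIV"
  using sets_eq_imp_space_eq[OF sets_borel] by simp

text \<open>The kernel is infinite at its pole, so the pole must be a null set; r tends to 0 in the
  growth condition.\<close>

lemma emeasure_singleton_0: "emeasure \<nu> {y} = 0"
proof -
  have "((\<lambda>r. ennreal (M * r powr \<alpha>)) \<longlongrightarrow> ennreal (M * 0 powr \<alpha>)) (at_right 0)"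
    using d_less d_ge
    by (intro tendsto_ennrealI tendsto_mult tendsto_const tendsto_powr2 tendsto_ident_at)
       (auto simp: eventually_at_filter intro!: always_eventually)
  moreover have "\<forall>\<^sub>F r in at_right 0. emeasure \<nu> {y} \<le> ennreal (M * r powr \<alpha>)"
    unfolding eventually_at_filter
  proof (intro always_eventually allI impI)
    fix r :: real assume "r \<noteq> 0" "r \<in> {0<..}"
    then have "0 < r" by simp
    have "emeasure \<nu> {y} \<le> emeasure \<nu> (ball y r)"
      using \<open>0 < r\<close> by (intro emeasure_mono) (auto simp: sets_borel)
    with ball_le[OF \<open>0 < r\<close>, of y] show "emeasure \<nu> {y} \<le> ennreal (M * r powr \<alpha>)" by simp
  qed
  ultimately have "emeasure \<nu> {y} \<le> ennreal (M * 0 powr \<alpha>)"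
    by (rule tendsto_lowerbound) simp
  then show ?thesis by simp
qed

sublocale sigma_finite_measure \<nu>
proof (rule sigma_finite_measure.intro)
  show "\<exists>A. countable A \<and> A \<subseteq> sets \<nu> \<and> \<Union> A = space \<nu> \<and> (\<forall>a\<in>A. emeasure \<nu> a \<noteq> \<infinity>)"
  proof (intro exI[of _ "range (\<lambda>k::nat. ball 0 (real (Suc k)))"] conjI ballI)
    have "\<exists>k. x \<in> ball 0 (real (Suc k))" for x :: 'a
      proof -
      obtain k where "norm x < real k" using reals_Archimedean2 by blast
      then show ?thesis by (intro exI[of _ k]) simp
    qed
    then show "\<Union> (range (\<lambda>k::nat. ball (0::'a) (real (Suc k)))) = space \<nu>"
      unfolding space_UNIV by blast
    fix a assume "a \<in> range (\<lambda>k::nat. ball (0::'a) (real (Suc k)))"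
    then obtain k where "a = ball 0 (real (Suc k))" by blast
    then have "emeasure \<nu> a \<le> ennreal (M * real (Suc k) powr \<alpha>)" using ball_le[of "real (Suc k)" 0] by simp
    also have "\<dots> < \<infinity>" by simp
    finally show "emeasure \<nu> a \<noteq> \<infinity>" by simp
  qed (auto simp: sets_borel)
qed

text \<open>The summand 1 comes from the part of the set outside a ball, the quotient from the
  geometric series over dyadic balls inside it, whose ratio 2^(d - \<alpha>) is below 1 because d <
  \<alpha>.\<close>

definition riesz_const :: real where
  "riesz_const = 1 + M * 2 ^ d / (1 - 2 powr (real d - \<alpha>))"

text \<open>Split \<open>E\<close> at distance R = m^(1/\<alpha>) from y, where m is its measure.
  Outside, the kernel is at most R^(-d), which contributes m R^(-d). Inside, dyadic balls of radius
  R/2^j with weight (2^(j+1)/R)^d add up to a multiple of R^(\<alpha> - d). With this R both are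
  multiples of m^(1 - d/\<alpha>).\<close>

lemma riesz_set_integral_le:
  assumes E: "E \<in> sets borel" "0 < emeasure \<nu> E" "emeasure \<nu> E < top"
  shows "(\<integral>\<^sup>+x\<in>E. riesz d (x - y) \<partial>\<nu>)
           \<le> ennreal (riesz_const * measure \<nu> E powr (1 - real d / \<alpha>))"
proof -
  define m where "m = measure \<nu> E"
  have em: "emeasure \<nu> E = ennreal m" using E by (simp add: m_def emeasure_eq_ennreal_measure)
  with E have m: "0 < m" by simp
  define R where "R = m powr (1 / \<alpha>)"
  have R: "0 < R" using m by (simp add: R_def)
  have \<alpha>: "0 < \<alpha>" using d_less by linarith
  have [measurable]: "ball z r \<in> sets \<nu>" "{z} \<in> sets \<nu>" for z r by (simp_all add: sets_borel)
  have [measurable]: "E \<in> sets \<nu>" using E by (simp add: sets_borel)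
  define q where "q = (2::real) powr (real d - \<alpha>)"
  have q: "0 < q" "q < 1" using d_less by (auto simp: q_def powr_less_one)
  define c where "c = (\<lambda>j::nat. (2 ^ Suc j / R) ^ d)"
  \<comment> \<open>Far points, points of a dyadic shell, and the pole, which gets the weight
    \<open>top\<close> on a null set. A point of a shell is charged to the full ball containing that
    shell.\<close>
  have pw: "riesz d (x - y) * indicator E x \<le>
      ennreal (1 / R ^ d) * indicator E x
      + (\<Sum>j. ennreal (c j) * indicator (ball y (R / 2 ^ j)) x) + top * indicator {y} x" for x
  proof -
    consider "x = y" | "R \<le> norm (x - y)" | "0 < norm (x - y)" "norm (x - y) < R"
      by fastforce
    then show ?thesis
    proof cases
      case 1 then show ?thesis by simp
    next
      case 2
      then have "riesz d (x - y) * indicator E x \<le> ennreal (1 / R ^ d) * indicator E x"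
        using R by (intro mult_right_mono riesz_le) auto
      then show ?thesis by (simp add: add.assoc add_increasing2)
    next
      case 3
      have "(\<lambda>j. R / 2 ^ Suc j) \<longlonglongrightarrow> 0"
        using LIMSEQ_Suc[OF LIMSEQ_divide_realpow_zero[of 2 R]] by simp
      then have "\<forall>\<^sub>F j in sequentially. R / 2 ^ Suc j < norm (x - y)"
        using 3(1) by (rule order_tendstoD)
      then obtain j0 where j0: "R / 2 ^ Suc j0 \<le> norm (x - y)"
        by (meson eventually_happens' less_imp_le sequentially_bot)
      \<comment> \<open>The least index puts x in the shell R/2^(j+1) <= |x - y| < R/2^j: minimality
        gives the upper bound, and for j = 0 it is the case assumption.\<close>
      define j where "j = (LEAST j. R / 2 ^ Suc j \<le> norm (x - y))"
      have j: "R / 2 ^ Suc j \<le> norm (x - y)" unfolding j_def by (rule LeastI[of _ j0]) (rule j0)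
      have j': "norm (x - y) < R / 2 ^ j"
      proof (cases j)
        case 0 then show ?thesis using 3 by simp
      next
        case (Suc i)
        then have "i < j" by simp
        then have "\<not> R / 2 ^ Suc i \<le> norm (x - y)" unfolding j_def by (rule not_less_Least)
        then show ?thesis using Suc by simp
      qed
      have "riesz d (x - y) * indicator E x \<le> ennreal (1 / (R / 2 ^ Suc j) ^ d) * 1"
        using R j by (intro mult_mono riesz_le) (auto simp: indicator_def)
      also have "\<dots> = ennreal (c j) * indicator (ball y (R / 2 ^ j)) x"
        using j' by (simp add: c_def power_divide dist_norm norm_minus_commute)
      also have "\<dots> \<le> (\<Sum>j. ennreal (c j) * indicator (ball y (R / 2 ^ j)) x)"
        by (rule ennreal_le_suminf)
      finally show ?thesis by (simp add: add_increasing add_increasing2)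
    qed
  qed
  have sumc: "(\<Sum>j. ennreal (c j) * emeasure \<nu> (ball y (R / 2 ^ j)))
      \<le> ennreal (M * 2 ^ d * R powr (\<alpha> - d) / (1 - q))"
  proof -
    have "(\<Sum>j. ennreal (c j) * emeasure \<nu> (ball y (R / 2 ^ j)))
        \<le> (\<Sum>j. ennreal (M * 2 ^ d * R powr (\<alpha> - d) * q ^ j))"
    proof (intro suminf_le)
      fix j
      have "ennreal (c j) * emeasure \<nu> (ball y (R / 2 ^ j)) \<le> ennreal (c j) * ennreal (M * (R / 2 ^ j) powr \<alpha>)"
        using R by (intro mult_left_mono ball_le) auto
      also have "\<dots> = ennreal (c j * (M * (R / 2 ^ j) powr \<alpha>))"
        using R M_pos by (intro ennreal_mult[symmetric]) (auto simp: c_def)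
      also have "c j * (M * (R / 2 ^ j) powr \<alpha>) = M * 2 ^ d * R powr (\<alpha> - d) * q ^ j"
      proof -
        have "q ^ j = (2 ^ j) powr (real d - \<alpha>)"
        proof -
          have "q ^ j = q powr real j" using q by (simp add: powr_realpow)
          also have "\<dots> = 2 powr (real j * (real d - \<alpha>))"
            unfolding q_def powr_powr by (simp only: mult.commute)
          also have "\<dots> = (2 powr real j) powr (real d - \<alpha>)" by (simp only: powr_powr)
          finally show ?thesis by (simp add: powr_realpow)
        qed
        also have "\<dots> = (2 ^ j) ^ d / (2 ^ j) powr \<alpha>"
          by (simp add: powr_diff powr_realpow)
        finally have qj: "q ^ j = (2 ^ j) ^ d / (2 ^ j) powr \<alpha>" .
        have Ra: "R powr (\<alpha> - d) = R powr \<alpha> / R ^ d" using R by (simp add: powr_diff powr_realpow)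
        have "c j = 2 ^ d * (2 ^ j) ^ d / R ^ d"
          by (simp add: c_def power_divide power_mult_distrib)
        moreover have "(R / 2 ^ j) powr \<alpha> = R powr \<alpha> / (2 ^ j) powr \<alpha>"
          using R by (simp add: powr_divide)
        ultimately show ?thesis unfolding qj Ra by simp
      qed
      finally show "ennreal (c j) * emeasure \<nu> (ball y (R / 2 ^ j)) \<le> ennreal (M * 2 ^ d * R powr (\<alpha> - d) * q ^ j)" .
    qed auto
    also have "\<dots> = ennreal (M * 2 ^ d * R powr (\<alpha> - d) / (1 - q))"
    proof (rule suminf_ennreal_eq)
      show "(\<lambda>j. M * 2 ^ d * R powr (\<alpha> - d) * q ^ j) sums (M * 2 ^ d * R powr (\<alpha> - d) / (1 - q))"
        using sums_mult[OF geometric_sums[of q], of "M * 2 ^ d * R powr (\<alpha> - d)"] q by simp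
    qed (use M_pos q in auto)
    finally show ?thesis .
  qed
  have Rm: "R powr (\<alpha> - d) = m powr (1 - d / \<alpha>)" "1 / R ^ d * m = m powr (1 - d / \<alpha>)"
  proof -
    have "1 / \<alpha> * (\<alpha> - d) = 1 - d / \<alpha>" using \<alpha> by (simp add: field_simps)
    then show "R powr (\<alpha> - d) = m powr (1 - d / \<alpha>)" by (simp add: R_def powr_powr)
    have "R ^ d = m powr (d / \<alpha>)" using R m by (simp add: R_def powr_powr flip: powr_realpow)
    then show "1 / R ^ d * m = m powr (1 - d / \<alpha>)" using m by (simp add: powr_diff)
  qed
  have "(\<integral>\<^sup>+x\<in>E. riesz d (x - y) \<partial>\<nu>) \<le> (\<integral>\<^sup>+x. ennreal (1 / R ^ d) * indicator E x
      + (\<Sum>j. ennreal (c j) * indicator (ball y (R / 2 ^ j)) x) + top * indicator {y} x \<partial>\<nu>)"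
    by (intro nn_integral_mono pw)
  also have "\<dots> = ennreal (1 / R ^ d) * emeasure \<nu> E
      + (\<Sum>j. ennreal (c j) * emeasure \<nu> (ball y (R / 2 ^ j))) + top * emeasure \<nu> {y}"
    by (subst nn_integral_add, measurable, subst nn_integral_add, measurable, subst nn_integral_suminf, measurable)
       (simp add: nn_integral_cmult_indicator)
  also have "\<dots> \<le> ennreal (m powr (1 - d / \<alpha>)) + ennreal (M * 2 ^ d * R powr (\<alpha> - d) / (1 - q))"
  proof -
    have "ennreal (1 / R ^ d) * emeasure \<nu> E = ennreal (m powr (1 - d / \<alpha>))"
      using Rm(2) R m by (simp add: em ennreal_mult'[symmetric])
    then show ?thesis using sumc by (simp add: emeasure_singleton_0)
  qed
  also have "\<dots> = ennreal (riesz_const * m powr (1 - d / \<alpha>))"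
    using q M_pos by (subst ennreal_plus[symmetric]) (auto simp: riesz_const_def Rm q_def field_simps)
  finally show ?thesis by (simp add: m_def)
qed

end

lemma ball_growth_lborel:
  assumes "2 \<le> DIM('a::euclidean_space)"
  shows "ball_growth (lborel :: 'a measure) (DIM('a) - 1) (real DIM('a)) (unit_ball_vol (real DIM('a)))"
proof
  fix y :: 'a and r :: real assume "0 < r"
  then show "emeasure lborel (ball y r) \<le> ennreal (unit_ball_vol (real DIM('a)) * r powr real DIM('a))"
    by (simp add: emeasure_ball powr_realpow)
qed (use assms in auto)

definition lborel_riesz_const :: "nat \<Rightarrow> real" where
  "lborel_riesz_const n = ball_growth.riesz_const (n - 1) (real n) (unit_ball_vol (real n))"

lemma (in ball_growth) riesz_const_pos: "0 < riesz_const"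
proof -
  have "2 powr (real d - \<alpha>) < 1" using d_less by (simp add: powr_less_one)
  then show ?thesis using M_pos by (auto simp: riesz_const_def intro!: add_pos_nonneg divide_nonneg_nonneg)
qed

lemma lborel_riesz_const_pos:
  assumes "2 \<le> DIM('a::euclidean_space)"
  shows "0 < lborel_riesz_const DIM('a)"
  using ball_growth.riesz_const_pos[OF ball_growth_lborel[OF assms]] by (simp add: lborel_riesz_const_def)

lemma lborel_riesz_set_integral_le_finite:
  fixes E :: "'a::euclidean_space set"
  assumes n: "2 \<le> DIM('a)" and E: "E \<in> sets borel" "emeasure lborel E < top"
  shows "(\<integral>\<^sup>+x\<in>E. riesz (DIM('a) - 1) (x - y) \<partial>lborel)
     \<le> ennreal (lborel_riesz_const DIM('a) * measure lborel E powr (1 / DIM('a)))"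
proof (cases "emeasure lborel E = 0")
  case True
  then have "E \<in> null_sets lborel" using E by (auto simp: null_sets_def)
  then have "AE x in lborel. x \<notin> E" by (rule AE_not_in)
  then have "(\<integral>\<^sup>+x\<in>E. riesz (DIM('a) - 1) (x - y) \<partial>lborel) = (\<integral>\<^sup>+x. 0 \<partial>(lborel :: 'a measure))"
    by (intro nn_integral_cong_AE) (auto elim!: eventually_mono)
  then show ?thesis by simp
next
  case False
  interpret ball_growth "lborel :: 'a measure" "DIM('a) - 1" "real DIM('a)" "unit_ball_vol (real DIM('a))"
    by (rule ball_growth_lborel[OF n])
  have "1 - real (DIM('a) - 1) / real DIM('a) = 1 / DIM('a)"
    using n by (simp add: of_nat_diff field_simps)
  then show ?thesis
    using riesz_set_integral_le[of E y] E False by (simp add: lborel_riesz_const_def zero_less_iff_neq_zero)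
qed

text \<open>The fundamental theorem of calculus for r^(1/n), with the factor 1/n of the derivative
  estimated by 1. This is the origin of the weight r^(-(n-1)/n) in the theorem. The upper limit is
  written as an indicator so that m can later be the value of a distribution function and the
  integrations can be exchanged.\<close>

lemma nn_integral_powr_root:
  fixes n :: nat
  assumes "1 \<le> n" "0 < S" "S \<le> m"
  shows "ennreal (m powr (1 / n)) \<le> ennreal (S powr (1 / n))
     + (\<integral>\<^sup>+r\<in>{S..}. ennreal (r powr (- (real n - 1) / n)) * indicator {..<m} r \<partial>lborel)"
proof -
  have "(\<integral>\<^sup>+r\<in>{S..m}. ennreal (1 / n * r powr (1 / n - 1)) \<partial>lborel)
      = ennreal (m powr (1 / n) - S powr (1 / n))"
    using assms by (intro nn_integral_FTC_Icc) (auto intro!: derivative_eq_intros)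
  moreover have "ennreal (m powr (1 / n)) = ennreal (S powr (1 / n)) + ennreal (m powr (1 / n) - S powr (1 / n))"
    using assms by (subst ennreal_plus[symmetric]) (auto intro!: powr_mono2)
  ultimately have "ennreal (m powr (1 / n)) = ennreal (S powr (1 / n))
      + (\<integral>\<^sup>+r\<in>{S..m}. ennreal (1 / n * r powr (1 / n - 1)) \<partial>lborel)"
    by simp
  also have "(\<integral>\<^sup>+r\<in>{S..m}. ennreal (1 / n * r powr (1 / n - 1)) \<partial>lborel)
      \<le> (\<integral>\<^sup>+r\<in>{S..}. ennreal (r powr (- (real n - 1) / n)) * indicator {..<m} r \<partial>lborel)"
  proof (intro nn_integral_mono_AE)
    \<comment> \<open>The closed interval and the half-open indicator differ at r = m, hence a
      comparison almost everywhere.\<close>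
    show "AE r in lborel. ennreal (1 / n * r powr (1 / n - 1)) * indicator {S..m} r
        \<le> ennreal (r powr (- (real n - 1) / n)) * indicator {..<m} r * indicator {S..} r"
      using AE_lborel_singleton[of m]
    proof eventually_elim
      case (elim r)
      have "1 / n - 1 = - (real n - 1) / n" using assms by (simp add: field_simps)
      moreover have "1 / n * r powr (1 / n - 1) \<le> 1 * r powr (1 / n - 1)"
        using assms by (intro mult_right_mono) auto
      ultimately show ?case using elim by (auto simp: indicator_def intro!: ennreal_leI)
    qed
  qed
  finally show ?thesis by (simp add: add_left_mono)
qed

text \<open>Intersecting with balls reduces to finite measure m. If m is below S, its root is at
  most S^(1/n); otherwise the excess is the integral. The condition
  \<open>ennreal r < emeasure lborel E\<close> keeps its meaning when the measure is
  infinite.\<close>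

lemma lborel_riesz_set_integral_le:
  fixes E :: "'a::euclidean_space set"
  assumes n: "2 \<le> DIM('a)" and E[measurable]: "E \<in> sets borel" and S: "0 < S"
  shows "(\<integral>\<^sup>+x\<in>E. riesz (DIM('a) - 1) (x - y) \<partial>lborel)
     \<le> ennreal (lborel_riesz_const DIM('a)) * (ennreal (S powr (1 / DIM('a)))
       + (\<integral>\<^sup>+r\<in>{S..}. ennreal (r powr (- (real DIM('a) - 1) / DIM('a)))
            * indicator {r. ennreal r < emeasure lborel E} r \<partial>lborel))" (is "_ \<le> ?R")
proof -
  let ?f = "\<lambda>x. riesz (DIM('a) - 1) (x - y)"
  let ?K = "lborel_riesz_const DIM('a)"
  define A where "A = (\<lambda>N::nat. E \<inter> ball 0 (real N))"
  have A[measurable]: "A N \<in> sets borel" for N by (simp add: A_def)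
  have fin: "(\<integral>\<^sup>+x\<in>A N. ?f x \<partial>lborel) \<le> ?R" for N
  proof -
    have less: "emeasure lborel (A N) < top"
      using emeasure_mono[of "A N" "ball 0 (real N)" lborel] emeasure_lborel_ball_finite[of 0 "real N"]
      by (auto simp: A_def intro: le_less_trans)
    define m where "m = measure lborel (A N)"
    have m: "emeasure lborel (A N) = ennreal m" using less by (simp add: m_def emeasure_eq_ennreal_measure)
    have mE: "ennreal m \<le> emeasure lborel E" unfolding m[symmetric] by (rule emeasure_mono) (auto simp: A_def)
    have "ennreal (m powr (1 / DIM('a))) \<le> ennreal (S powr (1 / DIM('a)))
       + (\<integral>\<^sup>+r\<in>{S..}. ennreal (r powr (- (real DIM('a) - 1) / DIM('a)))
            * indicator {r. ennreal r < emeasure lborel E} r \<partial>lborel)"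
    proof (cases "S \<le> m")
      case True
      have "indicator {..<m} r \<le> (indicator {r. ennreal r < emeasure lborel E} r :: ennreal)" if "S \<le> r" for r
      proof (cases "r < m")
        case True
        then have "ennreal r < ennreal m" using that S by (simp add: ennreal_less_iff)
        with mE have "ennreal r < emeasure lborel E" by (rule less_le_trans[rotated])
        then show ?thesis by (simp add: indicator_def)
      qed simp
      then have "(\<integral>\<^sup>+r\<in>{S..}. ennreal (r powr (- (real DIM('a) - 1) / DIM('a))) * indicator {..<m} r \<partial>lborel)
          \<le> (\<integral>\<^sup>+r\<in>{S..}. ennreal (r powr (- (real DIM('a) - 1) / DIM('a)))
            * indicator {r. ennreal r < emeasure lborel E} r \<partial>lborel)"
        by (intro nn_integral_mono) (auto simp: indicator_def)
      then show ?thesis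
        using nn_integral_powr_root[of "DIM('a)" S m] True S n by (auto intro: order_trans add_left_mono)
    next
      case False
      then have "ennreal (m powr (1 / DIM('a))) \<le> ennreal (S powr (1 / DIM('a)))"
        by (intro ennreal_leI powr_mono2) (auto simp: m_def)
      then show ?thesis by (rule order_trans) simp
    qed
    then have "ennreal (?K * m powr (1 / DIM('a))) \<le> ?R"
      using lborel_riesz_const_pos[OF n] by (subst ennreal_mult') (auto intro!: mult_left_mono)
    with lborel_riesz_set_integral_le_finite[OF n A less, of y] show ?thesis
      by (simp add: m_def)
  qed
  have "(\<integral>\<^sup>+x\<in>E. ?f x \<partial>lborel) = emeasure (density lborel ?f) (\<Union>N. A N)"
  proof -
    have "(\<Union>N. A N) = E"
      using reals_Archimedean2 by (auto simp: A_def)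
    then show ?thesis by (simp add: emeasure_density)
  qed
  also have "\<dots> = (SUP N. emeasure (density lborel ?f) (A N))"
    by (intro SUP_emeasure_incseq[symmetric]) (auto simp: A_def incseq_def)
  also have "\<dots> \<le> ?R"
    using fin by (intro SUP_least) (simp add: emeasure_density)
  finally show ?thesis .
qed

section \<open>The set of directions in which a ball is seen\<close>

definition shadow_const :: "nat \<Rightarrow> real" where
  "shadow_const n = unit_ball_vol n * (9 * 2 ^ n * 6 ^ (n - 1) + 3 ^ n * 2 ^ (n - 1))"

lemma shadow_const_pos: "0 < shadow_const n"
  by (auto simp: shadow_const_def intro!: mult_pos_pos add_pos_pos)

text \<open>If the ball is far, L = |x - y| >= 2 r, the directions lie within \<rho> = 6 r / L of a
  segment of length 6 pointing from x to y. About 6/\<rho> balls of radius 2 \<rho> cover that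
  neighbourhood, which gives a measure of order \<rho>^(n-1). If it is near, then r / L > 1/2 and
  the volume of the ball of radius 3 suffices. These cases are the two summands of
  \<open>shadow_const\<close>; its 9 bounds (N + 1) \<rho>.\<close>

lemma emeasure_shadow_ball_le:
  fixes x y :: "'a::euclidean_space"
  assumes n: "2 \<le> DIM('a)" and r: "0 < r"
  shows "emeasure lborel {v. 1 \<le> norm v \<and> norm v \<le> 3 \<and> (\<exists>s>0. dist (x + s *\<^sub>R v) y < r)}
     \<le> ennreal (shadow_const DIM('a) * r ^ (DIM('a) - 1)) * riesz (DIM('a) - 1) (x - y)"
    (is "emeasure lborel ?V \<le> _")
proof (cases "x = y")
  case True
  then show ?thesis
    using n r shadow_const_pos[of "DIM('a)"] by (simp add: riesz_zero ennreal_mult_top)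
next
  case False
  define w where "w = y - x"
  define L where "L = norm w"
  let ?\<omega> = "unit_ball_vol (real DIM('a))"
  have L: "0 < L" using False by (simp add: L_def w_def)
  have rhs: "ennreal (shadow_const DIM('a) * r ^ (DIM('a) - 1)) * riesz (DIM('a) - 1) (x - y)
      = ennreal (shadow_const DIM('a) * (r / L) ^ (DIM('a) - 1))"
    using False r L shadow_const_pos[of "DIM('a)"]
    by (simp add: riesz_eq L_def w_def norm_minus_commute power_divide flip: ennreal_mult')
  show ?thesis
  proof (cases "L < 2 * r")
    case True
    have "emeasure lborel ?V \<le> emeasure lborel (cball (0::'a) 3)"
      by (rule emeasure_mono) (auto simp: dist_norm)
    also have "\<dots> = ennreal (?\<omega> * 3 ^ DIM('a))" by (simp add: emeasure_cball)
    also have "\<dots> \<le> ennreal (shadow_const DIM('a) * (r / L) ^ (DIM('a) - 1))"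
    proof (rule ennreal_leI)
      have "(1/2) ^ (DIM('a) - 1) \<le> (r / L) ^ (DIM('a) - 1)"
        using True L by (intro power_mono) (auto simp: field_simps)
      then have "?\<omega> * 3 ^ DIM('a) * 2 ^ (DIM('a) - 1) * (1/2) ^ (DIM('a) - 1)
          \<le> shadow_const DIM('a) * (r / L) ^ (DIM('a) - 1)"
        using shadow_const_pos[of "DIM('a)"] by (intro mult_mono) (auto simp: shadow_const_def algebra_simps)
      then show "?\<omega> * 3 ^ DIM('a) \<le> shadow_const DIM('a) * (r / L) ^ (DIM('a) - 1)"
        by (simp add: power_one_over)
    qed
    finally show ?thesis unfolding rhs .
  next
    case False
    define \<rho> where "\<rho> = 6 * r / L"
    have \<rho>: "0 < \<rho>" "\<rho> \<le> 3" using r L False by (auto simp: \<rho>_def field_simps)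
    define e where "e = w /\<^sub>R L"
    have e: "norm e = 1" "w = L *\<^sub>R e" using L by (auto simp: e_def L_def)
    define N where "N = nat \<lfloor>6 / \<rho>\<rfloor>"
    have "?V \<subseteq> (\<Union>j\<le>N. ball ((real j * \<rho>) *\<^sub>R e) (2 * \<rho>))"
    proof safe
      fix v s assume v: "1 \<le> norm v" "norm v \<le> 3" "0 < s" "dist (x + s *\<^sub>R v) y < r"
      have vw: "norm (s *\<^sub>R v - w) < r" using v by (simp add: dist_norm w_def algebra_simps)
      have "L \<le> norm (s *\<^sub>R v) + norm (s *\<^sub>R v - w)"
        unfolding L_def using norm_triangle_sub[of w "s *\<^sub>R v"] by (simp add: norm_minus_commute)
      also have "norm (s *\<^sub>R v) \<le> 3 * s" using v by simp
      finally have s: "L \<le> 6 * s" using vw False by linarith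
      \<comment> \<open>Dividing s v = w + error by s shows that v is close to \<tau> e. The bound L
        <= 6 s, in which r <= L/2 has absorbed the error, limits both \<tau> and the quotient r /
        s.\<close>
      define \<tau> where "\<tau> = L / s"
      have \<tau>: "0 < \<tau>" "\<tau> \<le> 6" using s v L by (auto simp: \<tau>_def field_simps)
      have "norm (v - \<tau> *\<^sub>R e) = norm (s *\<^sub>R v - w) / s"
      proof -
        have "v - \<tau> *\<^sub>R e = (s *\<^sub>R v - w) /\<^sub>R s" using v L by (simp add: \<tau>_def e_def scaleR_diff_right divide_inverse)
        then show ?thesis using v by (simp add: divide_inverse)
      qed
      also have "\<dots> < r / s" using vw v by (simp add: divide_strict_right_mono)
      also have "\<dots> \<le> \<rho>" using s v r L mult_left_mono[OF s, of r] by (simp add: \<rho>_def field_simps)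
      finally have vt: "norm (v - \<tau> *\<^sub>R e) < \<rho>" .
      define j where "j = nat \<lfloor>\<tau> / \<rho>\<rfloor>"
      have fl: "0 \<le> \<lfloor>\<tau> / \<rho>\<rfloor>" using \<tau> \<rho> by simp
      have j: "real j \<le> \<tau> / \<rho>" "\<tau> / \<rho> < real j + 1"
        unfolding j_def using fl by (simp_all add: of_nat_nat)
      have "j \<le> N" unfolding j_def N_def using \<tau> \<rho> by (intro nat_mono floor_mono divide_right_mono) auto
      have "\<bar>\<tau> - real j * \<rho>\<bar> \<le> \<rho>" using j \<rho> by (simp add: field_simps)
      then have "norm (\<tau> *\<^sub>R e - (real j * \<rho>) *\<^sub>R e) \<le> \<rho>"
        unfolding scaleR_diff_left[symmetric] by (simp add: e)
      then have "norm (v - (real j * \<rho>) *\<^sub>R e) < 2 * \<rho>"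
        using vt norm_triangle_ineq[of "v - \<tau> *\<^sub>R e" "\<tau> *\<^sub>R e - (real j * \<rho>) *\<^sub>R e"] by simp
      then have "v \<in> ball ((real j * \<rho>) *\<^sub>R e) (2 * \<rho>)" by (simp add: dist_norm norm_minus_commute)
      with \<open>j \<le> N\<close> show "v \<in> (\<Union>j\<le>N. ball ((real j * \<rho>) *\<^sub>R e) (2 * \<rho>))" by blast
    qed
    then have "emeasure lborel ?V \<le> emeasure lborel (\<Union>j\<le>N. ball ((real j * \<rho>) *\<^sub>R e) (2 * \<rho>))"
      by (rule emeasure_mono) (auto intro!: borel_open open_UN)
    also have "\<dots> \<le> (\<Sum>j\<le>N. emeasure lborel (ball ((real j * \<rho>) *\<^sub>R e) (2 * \<rho>)))"
      by (rule emeasure_subadditive_finite) auto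
    also have "\<dots> = ennreal (real (Suc N) * (?\<omega> * (2 * \<rho>) ^ DIM('a)))"
      using \<rho> by (simp add: emeasure_ball ennreal_mult ennreal_of_nat_eq_real_of_nat del: of_nat_Suc)
    also have "\<dots> \<le> ennreal (shadow_const DIM('a) * (r / L) ^ (DIM('a) - 1))"
    proof (rule ennreal_leI)
      have "real N \<le> 6 / \<rho>" unfolding N_def using \<rho> by simp
      then have "real (Suc N) * \<rho> \<le> 9" using \<rho> by (simp add: field_simps)
      have nn: "\<rho> ^ DIM('a) = \<rho> * \<rho> ^ (DIM('a) - 1)" using n by (simp flip: power_Suc)
      have "real (Suc N) * (?\<omega> * (2 * \<rho>) ^ DIM('a)) = (real (Suc N) * \<rho>) * (?\<omega> * 2 ^ DIM('a) * \<rho> ^ (DIM('a) - 1))"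
        unfolding power_mult_distrib nn by (simp only: mult_ac)
      also have "\<dots> \<le> 9 * (?\<omega> * 2 ^ DIM('a) * \<rho> ^ (DIM('a) - 1))"
        using \<open>real (Suc N) * \<rho> \<le> 9\<close> \<rho> by (intro mult_right_mono) auto
      also have "\<dots> = ?\<omega> * (9 * 2 ^ DIM('a) * 6 ^ (DIM('a) - 1)) * (r / L) ^ (DIM('a) - 1)"
        by (simp add: \<rho>_def power_mult_distrib power_divide)
      also have "\<dots> \<le> shadow_const DIM('a) * (r / L) ^ (DIM('a) - 1)"
        unfolding shadow_const_def using r L by (intro mult_right_mono mult_left_mono) auto
      finally show "real (Suc N) * (?\<omega> * (2 * \<rho>) ^ DIM('a)) \<le> shadow_const DIM('a) * (r / L) ^ (DIM('a) - 1)" .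
    qed
    finally show ?thesis unfolding rhs .
  qed
qed

section \<open>Shadows of boundary sets\<close>

lemma exists_radius_power:
  fixes D \<epsilon> :: real
  assumes "1 \<le> d" "0 \<le> D" "0 < \<epsilon>"
  shows "\<exists>r. D < r \<and> r ^ d = D ^ d + \<epsilon>"
proof -
  define r where "r = root d (D ^ d + \<epsilon>)"
  have r: "r ^ d = D ^ d + \<epsilon>" "0 \<le> r" using assms by (auto simp: r_def intro!: real_root_ge_zero add_nonneg_nonneg)
  then have "D ^ d < r ^ d" using assms by simp
  then have "D < r" using r(2) by (rule power_less_imp_less_base)
  with r show ?thesis by blast
qed

text \<open>Each covering set is replaced by an open ball about one of its points, with radius
  slightly above the diameter, so that sets of diameter 0 are covered too. The enlargement is made
  in r^d, with summable errors \<epsilon>/2^(i+1). Since the gauge contains half the diameter, the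
  price is the factor 2^d / \<open>unit_ball_vol d\<close>. The index set \<open>I\<close> leaves
  out empty covering sets, which have gauge 0 and no centre.\<close>

lemma hausdorff_outer_cover:
  fixes G :: "'a::metric_space set"
  assumes d: "1 \<le> d" and fin: "hausdorff_outer d G < top" and e: "0 < \<epsilon>"
  obtains I :: "nat set" and y :: "nat \<Rightarrow> 'a" and r :: "nat \<Rightarrow> real"
  where "G \<subseteq> (\<Union>i\<in>I. ball (y i) (r i))" "\<And>i. 0 < r i"
    "(\<Sum>i. ennreal (r i ^ d) * indicator I i)
       \<le> ennreal (2 ^ d / unit_ball_vol d) * (hausdorff_outer d G + ennreal \<epsilon>) + ennreal \<epsilon>"
proof -
  let ?\<kappa> = "ennreal (2 ^ d / unit_ball_vol (real d))"
  have "hausdorff_pre d 1 G \<le> hausdorff_outer d G"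
    unfolding hausdorff_outer_def by (rule SUP_upper) simp
  also have "\<dots> < hausdorff_outer d G + ennreal \<epsilon>"
    using fin e ennreal_add_left_cancel_less[of "hausdorff_outer d G" 0 "ennreal \<epsilon>"] by simp
  finally obtain C :: "nat \<Rightarrow> 'a set" where C: "G \<subseteq> (\<Union>i. C i)" "\<And>i. bounded (C i)"
      "(\<Sum>i. hausdorff_gauge d (C i)) < hausdorff_outer d G + ennreal \<epsilon>"
    unfolding hausdorff_pre_def by (subst (asm) INF_less_iff) auto
  define I where "I = {i. C i \<noteq> {}}"
  define y where "y = (\<lambda>i. SOME z. z \<in> C i)"
  have y: "y i \<in> C i" if "i \<in> I" for i using that unfolding I_def y_def by (auto intro: someI)
  have "\<exists>r. diameter (C i) < r \<and> r ^ d = diameter (C i) ^ d + \<epsilon> * (1/2) ^ Suc i" for i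
    using e d diameter_ge_0[OF C(2)] by (intro exists_radius_power) auto
  then obtain r where r: "\<And>i. diameter (C i) < r i" "\<And>i. r i ^ d = diameter (C i) ^ d + \<epsilon> * (1/2) ^ Suc i"
    by metis
  show ?thesis
  proof (rule that[where I=I and y=y and r=r])
    show "G \<subseteq> (\<Union>i\<in>I. ball (y i) (r i))"
    proof
      fix z assume "z \<in> G"
      then obtain i where i: "z \<in> C i" using C by blast
      then have "i \<in> I" by (auto simp: I_def)
      have "dist (y i) z \<le> diameter (C i)" by (rule diameter_bounded_bound[OF C(2) y[OF \<open>i \<in> I\<close>] i])
      also have "\<dots> < r i" by (rule r)
      finally show "z \<in> (\<Union>i\<in>I. ball (y i) (r i))" using \<open>i \<in> I\<close> by auto
    qed
    show "0 < r i" for i using r(1)[of i] diameter_ge_0[OF C(2)[of i]] by linarith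
    have term_le: "ennreal (r i ^ d) * indicator I i
        \<le> ?\<kappa> * hausdorff_gauge d (C i) + ennreal (\<epsilon> * (1/2) ^ Suc i)" for i
    proof (cases "i \<in> I")
      case True
      have "?\<kappa> * hausdorff_gauge d (C i) = ennreal (diameter (C i) ^ d)"
        using True unit_ball_vol_pos[of "real d"] diameter_ge_0[OF C(2)[of i]]
        by (simp add: I_def hausdorff_gauge_def power_divide ennreal_mult[symmetric] less_imp_neq[symmetric])
      then show ?thesis
        using True e diameter_ge_0[OF C(2)[of i]] by (simp add: r(2) flip: ennreal_plus)
    qed simp
    have "(\<Sum>i. ennreal (r i ^ d) * indicator I i)
        \<le> (\<Sum>i. ?\<kappa> * hausdorff_gauge d (C i) + ennreal (\<epsilon> * (1/2) ^ Suc i))"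
      by (intro suminf_le term_le) auto
    also have "\<dots> = ?\<kappa> * (\<Sum>i. hausdorff_gauge d (C i)) + (\<Sum>i. ennreal (\<epsilon> * (1/2) ^ Suc i))"
      by (simp add: suminf_add[symmetric])
    also have "(\<Sum>i. ennreal (\<epsilon> * (1/2) ^ Suc i)) = ennreal \<epsilon>"
      using sums_mult[OF power_half_series, of \<epsilon>] e by (intro suminf_ennreal_eq) auto
    also have "?\<kappa> * (\<Sum>i. hausdorff_gauge d (C i)) + ennreal \<epsilon>
        \<le> ?\<kappa> * (hausdorff_outer d G + ennreal \<epsilon>) + ennreal \<epsilon>"
      using C(3) by (intro add_right_mono mult_left_mono) auto
    finally show "(\<Sum>i. ennreal (r i ^ d) * indicator I i)
       \<le> ?\<kappa> * (hausdorff_outer d G + ennreal \<epsilon>) + ennreal \<epsilon>" .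
  qed
qed

text \<open>Base point and direction are kept together, so that joint measurability follows from
  openness in the product.\<close>

definition shadow_ball :: "'a::real_normed_vector \<Rightarrow> real \<Rightarrow> ('a \<times> 'a) set" where
  "shadow_ball y r = {(x, v). \<exists>s>0. dist (x + s *\<^sub>R v) y < r}"

lemma open_shadow_ball: "open (shadow_ball y r)"
proof -
  have "shadow_ball y r = (\<Union>s\<in>{0<..}. {p. dist (fst p + s *\<^sub>R snd p) y < r})"
    by (auto simp: shadow_ball_def)
  moreover have "open {p :: 'a \<times> 'a. dist (fst p + s *\<^sub>R snd p) y < r}" for s
    by (intro open_Collect_less continuous_intros)
  ultimately show ?thesis by auto
qed

abbreviation annulus :: "'a::real_normed_vector set" where
  "annulus \<equiv> {v. 1 \<le> norm v \<and> norm v \<le> 3}"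

lemma annulus_section_measurable:
  fixes Q :: "('a::euclidean_space \<times> 'a) set"
  assumes Q: "Q \<in> sets borel"
  shows "{v \<in> annulus. (x, v) \<in> Q} \<in> sets borel"
    and "(\<lambda>x. emeasure lborel {v \<in> annulus. (x, v) \<in> Q}) \<in> borel_measurable borel"
proof -
  have "UNIV \<times> annulus \<in> sets (borel :: ('a \<times> 'a) measure)"
    by (intro borel_closed closed_Times closed_Collect_conj closed_Collect_le continuous_intros)
  then have "Q \<inter> UNIV \<times> annulus \<in> sets (borel :: ('a \<times> 'a) measure)" using Q by blast
  then have s: "Q \<inter> UNIV \<times> annulus \<in> sets (borel \<Otimes>\<^sub>M (lborel :: 'a measure))"
    by (simp add: borel_prod[symmetric] cong: sets_pair_measure_cong)
  have eq: "Pair x -` (Q \<inter> UNIV \<times> annulus) = {v \<in> annulus. (x, v) \<in> Q}" for x by auto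
  show "{v \<in> annulus. (x, v) \<in> Q} \<in> sets borel" using sets_Pair1[OF s, of x] unfolding eq by simp
  show "(\<lambda>x. emeasure lborel {v \<in> annulus. (x, v) \<in> Q}) \<in> borel_measurable borel"
    using lborel.measurable_emeasure_Pair[OF s] unfolding eq by simp
qed

context ball_growth
begin

definition shadow_growth_const :: real where
  "shadow_growth_const = shadow_const DIM('a) * riesz_const * (2 ^ d / unit_ball_vol d)"

lemma shadow_growth_const_pos: "0 < shadow_growth_const"
  unfolding shadow_growth_const_def using shadow_const_pos[of "DIM('a)"] riesz_const_pos
  by (intro mult_pos_pos) auto

lemma shadow_set_integral_le:
  assumes n: "2 \<le> DIM('a)" and d: "d = DIM('a) - 1"
    and E[measurable]: "E \<in> sets borel" and Epos: "0 < emeasure \<nu> E" "emeasure \<nu> E < top"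
    and r: "0 < r"
  shows "(\<integral>\<^sup>+x\<in>E. emeasure lborel {v \<in> annulus. (x, v) \<in> shadow_ball y r} \<partial>\<nu>)
     \<le> ennreal (shadow_const DIM('a) * riesz_const * measure \<nu> E powr (1 - real d / \<alpha>) * r ^ d)"
proof -
  have Es: "E \<in> sets \<nu>" by (simp add: sets_borel)
  let ?s = "\<lambda>x. emeasure lborel {v \<in> annulus. (x, v) \<in> shadow_ball y r}"
  have "(\<integral>\<^sup>+x\<in>E. ?s x \<partial>\<nu>)
      \<le> (\<integral>\<^sup>+x. ennreal (shadow_const DIM('a) * r ^ d) * (riesz d (x - y) * indicator E x) \<partial>\<nu>)"
  proof (intro nn_integral_mono)
    fix x
    have "{v \<in> annulus. (x, v) \<in> shadow_ball y r} = {v. 1 \<le> norm v \<and> norm v \<le> 3 \<and> (\<exists>s>0. dist (x + s *\<^sub>R v) y < r)}"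
      by (auto simp: shadow_ball_def)
    then have "?s x \<le> ennreal (shadow_const DIM('a) * r ^ d) * riesz d (x - y)"
      using emeasure_shadow_ball_le[OF n r, of x y] d by simp
    then show "?s x * indicator E x
        \<le> ennreal (shadow_const DIM('a) * r ^ d) * (riesz d (x - y) * indicator E x)"
      unfolding mult.assoc[symmetric] by (rule mult_right_mono) simp
  qed
  also have "\<dots> = ennreal (shadow_const DIM('a) * r ^ d) * (\<integral>\<^sup>+x\<in>E. riesz d (x - y) \<partial>\<nu>)"
    using Es by (intro nn_integral_cmult) measurable
  also have "\<dots> \<le> ennreal (shadow_const DIM('a) * r ^ d) * ennreal (riesz_const * measure \<nu> E powr (1 - real d / \<alpha>))"
    by (intro mult_left_mono riesz_set_integral_le E Epos) simp
  also have "\<dots> = ennreal (shadow_const DIM('a) * riesz_const * measure \<nu> E powr (1 - real d / \<alpha>) * r ^ d)"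
    using r shadow_const_pos[of "DIM('a)"] riesz_const_pos
    by (subst ennreal_mult[symmetric]) (auto simp only: mult_ac intro!: mult_nonneg_nonneg zero_le_power powr_ge_zero)
  finally show ?thesis .
qed

text \<open>The pairs whose ray meets \<open>G\<close> form a projection, which need not be Borel.
  \<open>Q\<close> is a Borel set containing them: a countable intersection of shadows of ball
  covers whose errors 1/(l+1) tend to 0, so that in the limit the bound is a pure multiple of the
  Hausdorff measure of \<open>G\<close>. The same \<open>Q\<close> serves every
  \<open>E\<close>.\<close>

lemma shadow_cover:
  assumes n: "2 \<le> DIM('a)" and d: "d = DIM('a) - 1" and fin: "hausdorff_outer d G < top"
  obtains Q :: "('a \<times> 'a) set" where "Q \<in> sets borel"
    "\<And>x v s. 0 < s \<Longrightarrow> x + s *\<^sub>R v \<in> G \<Longrightarrow> (x, v) \<in> Q"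
    "\<And>E. E \<in> sets borel \<Longrightarrow> 0 < emeasure \<nu> E \<Longrightarrow> emeasure \<nu> E < top \<Longrightarrow>
       (\<integral>\<^sup>+x\<in>E. emeasure lborel {v \<in> annulus. (x, v) \<in> Q} \<partial>\<nu>)
         \<le> ennreal (shadow_growth_const * measure \<nu> E powr (1 - real d / \<alpha>)) * hausdorff_outer d G"
proof -
  define h where "h = enn2real (hausdorff_outer d G)"
  have h: "hausdorff_outer d G = ennreal h" "0 \<le> h" using fin by (auto simp: h_def)
  let ?\<kappa> = "2 ^ d / unit_ball_vol (real d)"
  have \<kappa>: "0 < ?\<kappa>" by simp
  define e where "e = (\<lambda>l::nat. 1 / real (Suc l))"
  have e: "0 < e l" for l by (simp add: e_def)
  define covers where "covers = (\<lambda>l I y r. G \<subseteq> (\<Union>i\<in>I. ball (y i) (r i)) \<and> (\<forall>i::nat. 0 < r i) \<and>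
      (\<Sum>i. ennreal (r i ^ d) * indicator I i) \<le> ennreal ?\<kappa> * (hausdorff_outer d G + ennreal (e l)) + ennreal (e l))"
  have "\<exists>I y r. covers l I y r" for l
    unfolding covers_def by (rule hausdorff_outer_cover[OF d_ge fin e[of l]]) blast
  then obtain I y r where "\<And>l. covers l (I l) (y l) (r l)" by metis
  then have cov: "\<And>l. G \<subseteq> (\<Union>i\<in>I l. ball (y l i) (r l i))" and rpos: "\<And>l i. 0 < r l i" and
    sum_le: "\<And>l. (\<Sum>i. ennreal (r l i ^ d) * indicator (I l) i) \<le> ennreal ?\<kappa> * (hausdorff_outer d G + ennreal (e l)) + ennreal (e l)"
    unfolding covers_def by auto
  define Q where "Q = (\<Inter>l. \<Union>i\<in>I l. shadow_ball (y l i) (r l i))"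
  show ?thesis
  proof (rule that[of Q])
    show "Q \<in> sets borel" unfolding Q_def
      by (intro sets.countable_INT'' sets.countable_UN') (auto intro: borel_open open_shadow_ball)
    show "(x, v) \<in> Q" if "0 < s" "x + s *\<^sub>R v \<in> G" for x v s
      unfolding Q_def
    proof (rule INT_I)
      fix l
      from cov that(2) obtain i where "i \<in> I l" "x + s *\<^sub>R v \<in> ball (y l i) (r l i)" by blast
      with that(1) show "(x, v) \<in> (\<Union>i\<in>I l. shadow_ball (y l i) (r l i))"
        by (auto simp: shadow_ball_def dist_commute)
    qed
    fix E :: "'a set" assume E[measurable]: "E \<in> sets borel" and Epos: "0 < emeasure \<nu> E" "emeasure \<nu> E < top"
    let ?P = "measure \<nu> E powr (1 - real d / \<alpha>)"
    let ?c = "shadow_const DIM('a) * riesz_const * ?P"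
    let ?sec = "\<lambda>l i x. {v \<in> annulus. (x, v) \<in> shadow_ball (y l i) (r l i)}"
    have c: "0 \<le> ?c" using shadow_const_pos[of "DIM('a)"] riesz_const_pos by simp
    have le: "(\<integral>\<^sup>+x\<in>E. emeasure lborel {v \<in> annulus. (x, v) \<in> Q} \<partial>\<nu>) \<le> ennreal (?c * (?\<kappa> * (h + e l) + e l))" for l
    proof -
      define S where "S = (\<lambda>i x. emeasure lborel (?sec l i x))"
      have S_meas: "S i \<in> borel_measurable \<nu>" for i
        using annulus_section_measurable(2)[OF borel_open[OF open_shadow_ball]]
        by (simp add: S_def[abs_def] sets_borel cong: measurable_cong_sets)
      note S_meas[measurable]
      have Es[measurable]: "E \<in> sets \<nu>" by (simp add: sets_borel)
      have "(\<integral>\<^sup>+x\<in>E. emeasure lborel {v \<in> annulus. (x, v) \<in> Q} \<partial>\<nu>)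
          \<le> (\<integral>\<^sup>+x. (\<Sum>i. indicator (I l) i * (S i x * indicator E x)) \<partial>\<nu>)"
      proof (intro nn_integral_mono)
        fix x
        have meas: "(?sec l i x) \<in> sets lborel" for i
          using annulus_section_measurable(1)[OF borel_open[OF open_shadow_ball]] by simp
        define T where "T = (\<lambda>i. if i \<in> I l then (?sec l i x) else {})"
        have T: "range T \<subseteq> sets lborel" using meas by (auto simp: T_def)
        have "{v \<in> annulus. (x, v) \<in> Q} \<subseteq> (\<Union>i. T i)" by (fastforce simp: Q_def T_def)
        then have "emeasure lborel {v \<in> annulus. (x, v) \<in> Q} \<le> emeasure lborel (\<Union>i. T i)"
          using T by (intro emeasure_mono) auto
        also have "\<dots> \<le> (\<Sum>i. emeasure lborel (T i))" by (rule emeasure_subadditive_countably[OF T])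
        also have "\<dots> = (\<Sum>i. indicator (I l) i * S i x)"
          by (intro suminf_cong) (auto simp: T_def S_def indicator_def)
        finally show "emeasure lborel {v \<in> annulus. (x, v) \<in> Q} * indicator E x \<le> (\<Sum>i. indicator (I l) i * (S i x * indicator E x))"
          by (auto simp: indicator_def)
      qed
      also have "\<dots> = (\<Sum>i. indicator (I l) i * (\<integral>\<^sup>+x. S i x * indicator E x \<partial>\<nu>))"
        by (subst nn_integral_suminf, measurable, subst nn_integral_cmult, measurable)
      also have "\<dots> \<le> (\<Sum>i. indicator (I l) i * (ennreal ?c * ennreal (r l i ^ d)))"
      proof (intro suminf_le mult_left_mono)
        fix i
        show "(\<integral>\<^sup>+x. S i x * indicator E x \<partial>\<nu>) \<le> ennreal ?c * ennreal (r l i ^ d)"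
          using shadow_set_integral_le[OF n d E Epos rpos[of l i], of "y l i"] c
          by (simp add: S_def ennreal_mult'[symmetric])
      qed auto
      also have "\<dots> = ennreal ?c * (\<Sum>i. ennreal (r l i ^ d) * indicator (I l) i)"
        by (subst ennreal_suminf_cmult[symmetric]) (intro suminf_cong, simp only: mult_ac)
      also have "\<dots> \<le> ennreal ?c * (ennreal ?\<kappa> * (hausdorff_outer d G + ennreal (e l)) + ennreal (e l))"
        by (intro mult_left_mono sum_le) simp
      also have "\<dots> = ennreal (?c * (?\<kappa> * (h + e l) + e l))"
      proof -
        have "ennreal (a * (k * (b + t) + t)) = ennreal a * (ennreal k * (ennreal b + ennreal t) + ennreal t)"
          if "0 \<le> a" "0 \<le> k" "0 \<le> b" "0 \<le> t" for a k b t :: real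
          using that by (simp add: ennreal_mult)
        from this[OF c less_imp_le[OF \<kappa>] h(2) less_imp_le[OF e[of l]]] show ?thesis by (simp only: h(1))
      qed
      finally show ?thesis .
    qed
    have "(\<lambda>l. ennreal (?c * (?\<kappa> * (h + e l) + e l))) \<longlonglongrightarrow> ennreal (?c * (?\<kappa> * (h + 0) + 0))"
      unfolding e_def by (intro tendsto_intros tendsto_ennrealI LIMSEQ_Suc[OF lim_1_over_n])
    then have "(\<integral>\<^sup>+x\<in>E. emeasure lborel {v \<in> annulus. (x, v) \<in> Q} \<partial>\<nu>) \<le> ennreal (?c * (?\<kappa> * (h + 0) + 0))"
      by (rule LIMSEQ_le_const) (use le in blast)
    also have "\<dots> = ennreal (shadow_growth_const * ?P) * hausdorff_outer d G"
    proof -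
      have "?c * (?\<kappa> * (h + 0) + 0) = (shadow_growth_const * ?P) * h"
        unfolding shadow_growth_const_def add_0_right by (simp only: mult_ac)
      then show ?thesis using h by (simp only: h(1) ennreal_mult'')
    qed
    finally show "(\<integral>\<^sup>+x\<in>E. emeasure lborel {v \<in> annulus. (x, v) \<in> Q} \<partial>\<nu>)
        \<le> ennreal (shadow_growth_const * ?P) * hausdorff_outer d G" .
  qed
qed

end

section \<open>Integration over rays and mollified kernels\<close>

text \<open>A substitute for polar coordinates. For fixed s the substitution y = x + s v has
  Jacobian s^n and turns the annulus into q/3 <= s <= q with q = |y - x|. The remaining integral of
  s^(-n) over this interval is at most (3/q)^n times its length 2q/3, which is the constant times
  q^(-(n-1)).\<close>

lemma nn_integral_rays_le:
  fixes x :: "'a::euclidean_space" and f :: "'a \<Rightarrow> ennreal"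
  assumes [measurable]: "f \<in> borel_measurable borel"
  shows "(\<integral>\<^sup>+v\<in>annulus. (\<integral>\<^sup>+s\<in>{0<..}. f (x + s *\<^sub>R v) \<partial>lborel) \<partial>lborel)
     \<le> ennreal (2 * 3 ^ (DIM('a) - 1)) * (\<integral>\<^sup>+y. f y * riesz (DIM('a) - 1) (y - x) \<partial>lborel)"
proof -
  let ?n = "DIM('a)"
  have n: "?n = Suc (?n - 1)" by simp
  let ?C = "ennreal (2 * 3 ^ (?n - 1))" and ?r = "\<lambda>y. riesz (?n - 1) (y - x)"
  let ?J = "\<lambda>s. \<integral>\<^sup>+v. f (x + s *\<^sub>R v) * indicator {0<..} s * indicator annulus v \<partial>lborel"
  have [measurable]: "annulus \<in> sets (borel :: 'a measure)"
    by (intro borel_closed closed_Collect_conj closed_Collect_le continuous_intros)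
  define g where "g = (\<lambda>(s::real) (y::'a). ennreal (1 / s ^ ?n) * indicator {s. 0 < s \<and> s \<le> norm (y - x) \<and> norm (y - x) \<le> 3 * s} s)"
  have [measurable]: "(\<lambda>(s, y). g s y) \<in> borel_measurable (borel \<Otimes>\<^sub>M borel)"
    unfolding g_def by measurable
  have "(\<integral>\<^sup>+v\<in>annulus. (\<integral>\<^sup>+s\<in>{0<..}. f (x + s *\<^sub>R v) \<partial>lborel) \<partial>lborel)
      = (\<integral>\<^sup>+v. (\<integral>\<^sup>+s. f (x + s *\<^sub>R v) * indicator {0<..} s * indicator annulus v \<partial>lborel) \<partial>lborel)"
    by (simp add: nn_integral_multc)
  also have "\<dots> = (\<integral>\<^sup>+s. ?J s \<partial>lborel)"
    by (intro lborel_pair.Fubini') measurable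
  also have "\<dots> = (\<integral>\<^sup>+s. (\<integral>\<^sup>+y. f y * g s y \<partial>lborel) \<partial>lborel)"
  proof (rule nn_integral_cong)
    fix s :: real
    show "?J s = (\<integral>\<^sup>+y. f y * g s y \<partial>lborel)"
    proof (cases "0 < s")
      case True
      have "(\<integral>\<^sup>+y. f y * g s y \<partial>lborel) = ennreal (\<bar>s\<bar> ^ ?n) * (\<integral>\<^sup>+v. f (x + s *\<^sub>R v) * g s (x + s *\<^sub>R v) \<partial>lborel)"
        using True by (intro nn_integral_affine) (auto simp: g_def)
      also have "\<dots> = (\<integral>\<^sup>+v. ennreal (s ^ ?n) * (f (x + s *\<^sub>R v) * g s (x + s *\<^sub>R v)) \<partial>lborel)"
        using True by (subst nn_integral_cmult) (auto simp: g_def)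
      also have "\<dots> = ?J s"
      proof (intro nn_integral_cong)
        fix v
        have "ennreal (s ^ ?n) * ennreal (1 / s ^ ?n) = 1"
          using True by (simp flip: ennreal_mult')
        then have "ennreal (s ^ ?n) * (c * ennreal (1 / s ^ ?n)) = c" for c
          by (metis mult.left_commute mult.right_neutral)
        then show "ennreal (s ^ ?n) * (f (x + s *\<^sub>R v) * g s (x + s *\<^sub>R v)) = f (x + s *\<^sub>R v) * indicator {0<..} s * indicator annulus v"
          using True by (auto simp: g_def indicator_def)
      qed
      finally show ?thesis by simp
    qed (simp add: g_def)
  qed
  also have "\<dots> = (\<integral>\<^sup>+y. (\<integral>\<^sup>+s. f y * g s y \<partial>lborel) \<partial>lborel)"
    by (intro lborel_pair.Fubini') measurable
  also have "\<dots> \<le> (\<integral>\<^sup>+y. ?C * (f y * ?r y) \<partial>lborel)"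
  proof (intro nn_integral_mono)
    fix y
    have [measurable]: "(\<lambda>s. g s y) \<in> borel_measurable borel" unfolding g_def by measurable
    have "(\<integral>\<^sup>+s. g s y \<partial>lborel) \<le> ?C * ?r y"
    proof (cases "y = x")
      case True
      then have "g s y = 0" for s by (auto simp: g_def indicator_def)
      then show ?thesis by simp
    next
      case False
      define q where "q = norm (y - x)"
      have q: "0 < q" using False by (simp add: q_def)
      have "(\<integral>\<^sup>+s. g s y \<partial>lborel) \<le> (\<integral>\<^sup>+s. ennreal ((3 / q) ^ ?n) * indicator {q / 3..q} s \<partial>lborel)"
      proof (intro nn_integral_mono)
        fix s
        show "g s y \<le> ennreal ((3 / q) ^ ?n) * indicator {q / 3..q} s"
        proof (cases "0 < s \<and> s \<le> q \<and> q \<le> 3 * s")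
          case True
          then have "1 / s ^ ?n \<le> (3 / q) ^ ?n"
            unfolding power_one_over[symmetric] using q by (intro power_mono) (auto simp: field_simps)
          with True show ?thesis by (simp add: g_def q_def[symmetric] indicator_def ennreal_leI)
        qed (simp add: g_def q_def[symmetric])
      qed
      also have "\<dots> = ennreal ((3 / q) ^ ?n * (q - q / 3))"
        using q by (subst ennreal_mult) (auto simp: nn_integral_cmult_indicator)
      also have "(3 / q) ^ ?n * (q - q / 3) = 2 * 3 ^ (?n - 1) * (1 / q ^ (?n - 1))"
      proof -
        have "(3 / q) ^ ?n = 3 / q * (3 / q) ^ (?n - 1)" by (metis n power_Suc)
        then show ?thesis using q by (simp add: power_divide)
      qed
      also have "ennreal (2 * 3 ^ (?n - 1) * (1 / q ^ (?n - 1))) = ?C * ?r y"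
        using False q by (subst ennreal_mult) (auto simp: riesz_eq q_def)
      finally show ?thesis .
    qed
    then have "f y * (\<integral>\<^sup>+s. g s y \<partial>lborel) \<le> f y * (?C * ?r y)"
      by (rule mult_left_mono) simp
    then show "(\<integral>\<^sup>+s. f y * g s y \<partial>lborel) \<le> ?C * (f y * ?r y)"
      by (simp add: nn_integral_cmult mult.left_commute)
  qed
  also have "\<dots> = ?C * (\<integral>\<^sup>+y. f y * ?r y \<partial>lborel)"
    by (intro nn_integral_cmult) measurable
  finally show ?thesis .
qed

section \<open>Means of the Riesz kernel over small balls\<close>

definition riesz_mean_const :: "nat \<Rightarrow> real" where
  "riesz_mean_const n = 2 ^ (n - 1) * (unit_ball_vol n + lborel_riesz_const n * unit_ball_vol n powr (1 / n))"

lemma riesz_mean_const_pos: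
  assumes "2 \<le> DIM('a::euclidean_space)"
  shows "0 < riesz_mean_const DIM('a)"
  using lborel_riesz_const_pos[OF assms] by (auto simp: riesz_mean_const_def intro!: mult_pos_pos add_pos_nonneg)

text \<open>The point is uniformity in k. If |y| >= 2/k, every w in the ball has |w| >= |y|/2 and
  the kernel is comparable with its value at y. Otherwise the integral of the kernel over a set is
  bounded by the n-th root of the measure of the set, and k < 2/|y| compares the result with the
  kernel at y.\<close>

lemma riesz_mean_le:
  fixes y :: "'a::euclidean_space"
  assumes n: "2 \<le> DIM('a)" and k: "0 < k"
  shows "ennreal (k ^ DIM('a)) * (\<integral>\<^sup>+w\<in>ball y (1 / k). riesz (DIM('a) - 1) w \<partial>lborel)
     \<le> ennreal (riesz_mean_const DIM('a)) * riesz (DIM('a) - 1) y"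
proof (cases "y = 0")
  case True
  then show ?thesis using n riesz_mean_const_pos[OF n] by (simp add: riesz_zero ennreal_mult_top)
next
  case False
  let ?n = "DIM('a)" and ?\<omega> = "unit_ball_vol (real DIM('a))" and ?K = "lborel_riesz_const DIM('a)"
  let ?d = "?n - 1"
  let ?I = "\<integral>\<^sup>+w\<in>ball y (1 / k). riesz ?d w \<partial>lborel"
  have nd: "k ^ ?n = k * k ^ ?d" using n by (simp flip: power_Suc)
  have rhs: "ennreal (riesz_mean_const ?n) * riesz ?d y = ennreal (riesz_mean_const ?n / norm y ^ ?d)"
    using riesz_mean_const_pos[OF n] False by (simp add: riesz_eq flip: ennreal_mult')
  show ?thesis
  proof (cases "2 / k \<le> norm y")
    case True
    have "?I \<le> (\<integral>\<^sup>+w. ennreal (1 / (norm y / 2) ^ ?d) * indicator (ball y (1 / k)) w \<partial>lborel)"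
    proof (intro nn_integral_mono)
      fix w
      show "riesz ?d w * indicator (ball y (1 / k)) w \<le> ennreal (1 / (norm y / 2) ^ ?d) * indicator (ball y (1 / k)) w"
      proof (cases "w \<in> ball y (1 / k)")
        case w: True
        have "norm y \<le> norm w + norm (y - w)" using norm_triangle_sub[of y w] by simp
        then have "norm y / 2 \<le> norm w" using w True k by (simp add: dist_norm)
        then have "riesz ?d w \<le> ennreal (1 / (norm y / 2) ^ ?d)" using False by (intro riesz_le) auto
        then show ?thesis by (rule mult_right_mono) simp
      qed simp
    qed
    also have "\<dots> = ennreal (1 / (norm y / 2) ^ ?d * (?\<omega> * (1 / k) ^ ?n))"
      using k by (subst ennreal_mult) (auto simp: nn_integral_cmult_indicator emeasure_ball)
    finally have "ennreal (k ^ ?n) * ?I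
        \<le> ennreal (k ^ ?n) * ennreal (1 / (norm y / 2) ^ ?d * (?\<omega> * (1 / k) ^ ?n))"
      by (rule mult_left_mono) simp
    also have "\<dots> = ennreal (k ^ ?n * (1 / (norm y / 2) ^ ?d * (?\<omega> * (1 / k) ^ ?n)))"
      using k by (intro ennreal_mult[symmetric]) auto
    also have "k ^ ?n * (1 / (norm y / 2) ^ ?d * (?\<omega> * (1 / k) ^ ?n)) = 2 ^ ?d * ?\<omega> / norm y ^ ?d"
      using k by (simp add: power_divide field_simps)
    also have "ennreal (2 ^ ?d * ?\<omega> / norm y ^ ?d) \<le> ennreal (riesz_mean_const ?n / norm y ^ ?d)"
      using lborel_riesz_const_pos[OF n]
      by (intro ennreal_leI divide_right_mono) (auto simp: riesz_mean_const_def)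
    finally show ?thesis unfolding rhs .
  next
    case small: False
    have "?I
        \<le> ennreal (?K * measure lborel (ball y (1 / k)) powr (1 / ?n))"
      using lborel_riesz_set_integral_le_finite[OF n, of "ball y (1 / k)" 0] emeasure_lborel_ball_finite[of y "1/k"] by simp
    also have "measure lborel (ball y (1 / k)) = ?\<omega> * (1 / k) ^ ?n"
      using k by (simp add: measure_def emeasure_ball)
    also have "(?\<omega> * (1 / k) ^ ?n) powr (1 / ?n) = ?\<omega> powr (1 / ?n) / k"
    proof -
      have "((1 / k) ^ ?n) powr (1 / ?n) = 1 / k"
        using k by (simp add: powr_powr flip: powr_realpow)
      then show ?thesis using k by (simp add: powr_mult)
    qed
    finally have "ennreal (k ^ ?n) * ?I
        \<le> ennreal (k ^ ?n) * ennreal (?K * (?\<omega> powr (1 / ?n) / k))"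
      by (rule mult_left_mono) simp
    also have "\<dots> = ennreal (k ^ ?d * (?K * ?\<omega> powr (1 / ?n)))"
      using k lborel_riesz_const_pos[OF n] by (subst ennreal_mult[symmetric]) (auto simp: nd field_simps)
    also have "\<dots> \<le> ennreal (riesz_mean_const ?n / norm y ^ ?d)"
    proof (rule ennreal_leI)
      have "k ^ ?d \<le> (2 / norm y) ^ ?d"
        using small k False by (intro power_mono) (auto simp: field_simps)
      then have "k ^ ?d * (?K * ?\<omega> powr (1 / ?n)) \<le> (2 / norm y) ^ ?d * (?\<omega> + ?K * ?\<omega> powr (1 / ?n))"
        using lborel_riesz_const_pos[OF n] by (intro mult_mono) auto
      then show "k ^ ?d * (?K * ?\<omega> powr (1 / ?n)) \<le> riesz_mean_const ?n / norm y ^ ?d"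
        by (simp add: riesz_mean_const_def power_divide)
    qed
    finally show ?thesis unfolding rhs .
  qed
qed

section \<open>Smooth bump functions\<close>

text \<open>The exponent m makes the family stable under differentiation: the derivative of a member
  is a combination of the members with exponents m + 1 and m + 2.\<close>

definition bump :: "nat \<Rightarrow> real \<Rightarrow> real" where
  "bump m t = (if 0 < t then exp (- (1 / t)) / t ^ m else 0)"

lemma has_real_derivative_bump:
  "(bump m has_real_derivative bump (m + 2) t - real m * bump (m + 1) t) (at t)"
proof -
  consider "t < 0" | "t = 0" | "0 < t" by linarith
  then show ?thesis
  proof cases
    case 1
    have "((\<lambda>_. 0) has_real_derivative 0) (at t)" by simp
    then have "(bump m has_real_derivative 0) (at t)"
      by (rule has_field_derivative_transform_within_open[where S = "{..<0}"]) (use 1 in \<open>auto simp: bump_def\<close>)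
    then show ?thesis using 1 by (simp add: bump_def)
  next
    case 2
    \<comment> \<open>From the right the difference quotient is x^(m+1) / exp x with x = 1/h, and x
      tends to infinity.\<close>
    have "((\<lambda>h. bump m h / h) \<longlongrightarrow> 0) (at 0)"
    proof (rule filterlim_split_at)
      have "\<forall>\<^sub>F h in at_left (0::real). bump m h / h = 0"
        by (auto simp: eventually_at_filter bump_def intro!: always_eventually)
      then show "((\<lambda>h. bump m h / h) \<longlongrightarrow> 0) (at_left 0)"
        by (rule tendsto_eventually)
      have "((\<lambda>h. inverse h ^ Suc m / exp (inverse h)) \<longlongrightarrow> (0::real)) (at_right 0)"
        by (rule filterlim_compose[OF tendsto_power_div_exp_0 filterlim_inverse_at_top_right])
      moreover have "\<forall>\<^sub>F h in at_right (0::real). inverse h ^ Suc m / exp (inverse h) = bump m h / h"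
        by (auto simp: eventually_at_filter bump_def exp_minus field_simps intro!: always_eventually)
      ultimately show "((\<lambda>h. bump m h / h) \<longlongrightarrow> 0) (at_right 0)"
        by (rule Lim_transform_eventually)
    qed
    then show ?thesis using 2 by (simp add: has_field_derivative_iff bump_def)
  next
    case 3
    have "((\<lambda>t. exp (- (1 / t)) / t ^ m) has_real_derivative bump (m + 2) t - real m * bump (m + 1) t) (at t)"
    proof -
      have "((\<lambda>t. exp (- (1 / t))) has_real_derivative exp (- (1 / t)) / t\<^sup>2) (at t)"
        using 3 by (auto intro!: derivative_eq_intros simp: power2_eq_square)
      moreover have "((\<lambda>t. t ^ m) has_real_derivative real m * t ^ (m - 1)) (at t)"
        by (auto intro!: derivative_eq_intros)
      ultimately have "((\<lambda>t. exp (- (1 / t)) / t ^ m) has_real_derivative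
          (exp (- (1 / t)) / t\<^sup>2 * t ^ m - exp (- (1 / t)) * (real m * t ^ (m - 1))) / (t ^ m * t ^ m)) (at t)"
        using 3 by (intro DERIV_divide) auto
      moreover have "(exp (- (1 / t)) / t\<^sup>2 * t ^ m - exp (- (1 / t)) * (real m * t ^ (m - 1))) / (t ^ m * t ^ m)
          = bump (m + 2) t - real m * bump (m + 1) t"
        using 3 by (cases m) (simp_all add: bump_def power2_eq_square field_simps)
      ultimately show ?thesis by simp
    qed
    then show ?thesis
      by (rule has_field_derivative_transform_within_open[where S = "{0<..}"]) (use 3 in \<open>auto simp: bump_def\<close>)
  qed
qed

lemma bump_nonneg: "0 \<le> bump m t"
  by (simp add: bump_def)

text \<open>Test functions need all iterated partial derivatives. An algebra that contains the
  mollifier and is stable under partial derivatives provides them by induction on the list of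
  indices, with no formula for higher derivatives.\<close>

inductive_set bump_alg :: "real \<Rightarrow> (real^'n \<Rightarrow> real) set" for k :: real where
  const: "(\<lambda>_. c) \<in> bump_alg k"
| coord: "(\<lambda>z. z $ i) \<in> bump_alg k"
| gen: "(\<lambda>z. bump m (1 - k\<^sup>2 * (z \<bullet> z))) \<in> bump_alg k"
| add: "f \<in> bump_alg k \<Longrightarrow> g \<in> bump_alg k \<Longrightarrow> (\<lambda>z. f z + g z) \<in> bump_alg k"
| mult: "f \<in> bump_alg k \<Longrightarrow> g \<in> bump_alg k \<Longrightarrow> (\<lambda>z. f z * g z) \<in> bump_alg k"

lemma partial_deriv_eq: "(f has_derivative f') (at x) \<Longrightarrow> partial_deriv i f x = f' (axis i 1)"
  unfolding partial_deriv_def by (simp flip: frechet_derivative_at)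

text \<open>Sums and products are the Leibniz rules. For the bump of the quadratic 1 - k^2 |z|^2 the
  chain rule gives bumps with larger exponents times a multiple of a coordinate, which is why
  coordinates are among the generators.\<close>

lemma bump_alg_deriv:
  assumes "f \<in> bump_alg k"
  shows "(\<forall>x. f differentiable (at x)) \<and> (\<forall>i. partial_deriv i f \<in> bump_alg k)"
  using assms
proof induction
  case (const c)
  have "partial_deriv i (\<lambda>_. c) = (\<lambda>_. 0)" for i :: 'a
    by (intro ext) (rule partial_deriv_eq[OF has_derivative_const])
  then show ?case by (simp add: bump_alg.const)
next
  case (coord j)
  have der: "((\<lambda>z. z $ j) has_derivative (\<lambda>h. h $ j)) (at x)" for x :: "real^'a"
    by (rule bounded_linear_imp_has_derivative) (rule bounded_linear_vec_nth)
  have "partial_deriv i (\<lambda>z. z $ j) = (\<lambda>_. if i = j then 1 else 0)" for i :: 'a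
    by (intro ext, subst partial_deriv_eq[OF der]) (simp add: axis_def)
  with der show ?case by (auto simp: differentiable_def intro: bump_alg.const)
next
  case (gen m)
  let ?b = "\<lambda>t. bump (m + 2) t - real m * bump (m + 1) t"
  have der: "((\<lambda>z. bump m (1 - k\<^sup>2 * (z \<bullet> z))) has_derivative (\<lambda>h. ?b (1 - k\<^sup>2 * (x \<bullet> x)) * (- (2 * k\<^sup>2 * (x \<bullet> h))))) (at x)"
    for x :: "real^'a"
  proof -
    have "((\<lambda>z. 1 - k\<^sup>2 * (z \<bullet> z)) has_derivative (\<lambda>h. - (2 * k\<^sup>2 * (x \<bullet> h)))) (at x)"
      by (auto intro!: derivative_eq_intros simp: inner_commute)
    from has_derivative_compose[OF this has_real_derivative_bump[of m, unfolded has_field_derivative_def]]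
    show ?thesis .
  qed
  have "partial_deriv i (\<lambda>z. bump m (1 - k\<^sup>2 * (z \<bullet> z))) =
      (\<lambda>z. (bump (m + 2) (1 - k\<^sup>2 * (z \<bullet> z)) + (- real m) * bump (m + 1) (1 - k\<^sup>2 * (z \<bullet> z))) * ((- 2 * k\<^sup>2) * z $ i))" for i :: 'a
    by (intro ext, subst partial_deriv_eq[OF der]) (simp add: inner_axis)
  moreover have "(\<lambda>z. (bump (m + 2) (1 - k\<^sup>2 * (z \<bullet> z)) + (- real m) * bump (m + 1) (1 - k\<^sup>2 * (z \<bullet> z))) * ((- 2 * k\<^sup>2) * z $ i))
      \<in> bump_alg k" for i :: 'a
    by (intro bump_alg.intros)
  ultimately have "partial_deriv i (\<lambda>z. bump m (1 - k\<^sup>2 * (z \<bullet> z))) \<in> bump_alg k" for i :: 'a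
    by (simp only:)
  moreover have "(\<lambda>z. bump m (1 - k\<^sup>2 * (z \<bullet> z))) differentiable (at x)" for x :: "real^'a"
    using der[of x] unfolding differentiable_def by blast
  ultimately show ?case by blast
next
  case (add f g)
  have fd: "f differentiable (at x)" "g differentiable (at x)" for x
    using add.IH by simp_all
  have pd: "partial_deriv i f \<in> bump_alg k" "partial_deriv i g \<in> bump_alg k" for i
    using add.IH by simp_all
  have "partial_deriv i (\<lambda>z. f z + g z) = (\<lambda>z. partial_deriv i f z + partial_deriv i g z)" for i
  proof
    fix z
    have "((\<lambda>z. f z + g z) has_derivative (\<lambda>h. frechet_derivative f (at z) h + frechet_derivative g (at z) h)) (at z)"
      by (rule has_derivative_add[OF frechet_derivative_works[THEN iffD1, OF fd(1)] frechet_derivative_works[THEN iffD1, OF fd(2)]])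
    from partial_deriv_eq[OF this] show "partial_deriv i (\<lambda>z. f z + g z) z = partial_deriv i f z + partial_deriv i g z"
      by (simp add: partial_deriv_def)
  qed
  moreover have "(\<lambda>z. partial_deriv i f z + partial_deriv i g z) \<in> bump_alg k" for i
    by (intro bump_alg.add pd)
  moreover have "(\<lambda>z. f z + g z) differentiable (at x)" for x
    by (intro differentiable_add fd)
  ultimately show ?case by simp
next
  case (mult f g)
  have fd: "f differentiable (at x)" "g differentiable (at x)" for x
    using mult.IH by simp_all
  have pd: "partial_deriv i f \<in> bump_alg k" "partial_deriv i g \<in> bump_alg k" for i
    using mult.IH by simp_all
  have "partial_deriv i (\<lambda>z. f z * g z) = (\<lambda>z. f z * partial_deriv i g z + partial_deriv i f z * g z)" for i
  proof
    fix z
    have "((\<lambda>z. f z * g z) has_derivative (\<lambda>h. f z * frechet_derivative g (at z) h + frechet_derivative f (at z) h * g z)) (at z)"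
      by (rule has_derivative_mult[OF frechet_derivative_works[THEN iffD1, OF fd(1)] frechet_derivative_works[THEN iffD1, OF fd(2)]])
    from partial_deriv_eq[OF this] show "partial_deriv i (\<lambda>z. f z * g z) z = f z * partial_deriv i g z + partial_deriv i f z * g z"
      by (simp add: partial_deriv_def)
  qed
  moreover have "(\<lambda>z. f z * partial_deriv i g z + partial_deriv i f z * g z) \<in> bump_alg k" for i
    by (intro bump_alg.add bump_alg.mult pd mult.hyps)
  moreover have "(\<lambda>z. f z * g z) differentiable (at x)" for x
    by (intro differentiable_mult fd)
  ultimately show ?case by simp
qed

lemma bump_alg_continuous: "f \<in> bump_alg k \<Longrightarrow> continuous_on S f"
  using bump_alg_deriv[of f k] by (meson continuous_at_imp_continuous_on differentiable_imp_continuous_within)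

lemma vec_expansion: "v = (\<Sum>i\<in>UNIV. (v $ i) *\<^sub>R axis i (1::real))"
  by (simp add: vec_eq_iff axis_def if_distrib cong: if_cong)

lemma bump_alg_has_derivative:
  fixes f :: "real^'n \<Rightarrow> real"
  assumes "f \<in> bump_alg k"
  shows "(f has_derivative (\<lambda>h. (\<chi> i. partial_deriv i f x) \<bullet> h)) (at x)"
proof -
  have D: "(f has_derivative frechet_derivative f (at x)) (at x)"
    using bump_alg_deriv[OF assms] by (simp add: frechet_derivative_works[symmetric])
  then interpret bounded_linear "frechet_derivative f (at x)" by (rule has_derivative_bounded_linear)
  have "frechet_derivative f (at x) h = (\<chi> i. partial_deriv i f x) \<bullet> h" for h
  proof -
    have "frechet_derivative f (at x) h = frechet_derivative f (at x) (\<Sum>i\<in>UNIV. (h $ i) *\<^sub>R axis i 1)"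
      using vec_expansion[of h] by simp
    also have "\<dots> = (\<Sum>i\<in>UNIV. h $ i * partial_deriv i f x)" by (simp add: sum scaleR partial_deriv_def)
    finally show ?thesis by (simp add: inner_vec_def mult.commute)
  qed
  then show ?thesis by (intro has_derivative_eq_rhs[OF D] ext)
qed

section \<open>Averages of smooth functions along a segment\<close>

definition smear :: "real^'n \<Rightarrow> real^'n \<Rightarrow> real \<Rightarrow> (real^'n \<Rightarrow> real) \<Rightarrow> real^'n \<Rightarrow> real" where
  "smear x v L f z = integral {0..L} (\<lambda>t. f (x + t *\<^sub>R v - z))"

lemma smear_has_derivative:
  fixes f :: "real^'n \<Rightarrow> real"
  assumes f: "f \<in> bump_alg k"
  shows "(smear x v L f has_derivative (\<lambda>h. - integral {0..L} (\<lambda>t. (\<chi> i. partial_deriv i f (x + t *\<^sub>R v - z)) \<bullet> h))) (at z)"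
proof -
  define g where "g = (\<lambda>w. (\<chi> i. partial_deriv i f w))"
  have g: "continuous_on S g" for S
    unfolding g_def using bump_alg_deriv[OF f] bump_alg_continuous by (intro continuous_on_vec_lambda) blast
  \<comment> \<open>Differentiation under the integral sign asks for a continuous family of bounded
    linear maps, so the negated gradient is wrapped as an inner product functional.\<close>
  define fx where "fx = (\<lambda>z t. blinfun_inner_right (- g (x + t *\<^sub>R v - z)))"
  have cont: "continuous_on (UNIV \<times> cbox 0 L) (\<lambda>(z, t). fx z t)"
    unfolding fx_def split_beta
    by (intro bounded_linear.continuous_on[OF bounded_linear_blinfun_inner_right] continuous_on_minus
        continuous_on_compose2[OF g[of UNIV]] continuous_intros) auto
  have "((\<lambda>z. integral (cbox 0 L) (\<lambda>t. f (x + t *\<^sub>R v - z))) has_derivative blinfun_apply (integral (cbox 0 L) (fx z))) (at z within UNIV)"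
  proof (rule leibniz_rule[OF _ _ cont])
    fix z t
    have "((\<lambda>z. x + t *\<^sub>R v - z) has_derivative (\<lambda>h. - h)) (at z)" by (auto intro!: derivative_eq_intros)
    from has_derivative_compose[OF this bump_alg_has_derivative[OF f]]
    show "((\<lambda>z. f (x + t *\<^sub>R v - z)) has_derivative blinfun_apply (fx z t)) (at z within UNIV)"
      by (rule has_derivative_eq_rhs[OF has_derivative_at_withinI]) (simp add: fx_def g_def fun_eq_iff)
    show "(\<lambda>t. f (x + t *\<^sub>R v - z)) integrable_on cbox 0 L"
      by (intro integrable_continuous continuous_on_compose2[OF bump_alg_continuous[OF f, of UNIV]] continuous_intros) auto
  qed auto
  moreover have "blinfun_apply (integral (cbox 0 L) (fx z)) h = - integral {0..L} (\<lambda>t. g (x + t *\<^sub>R v - z) \<bullet> h)" for h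
  proof -
    have "continuous_on (cbox 0 L) (fx z)"
      unfolding fx_def
      by (intro bounded_linear.continuous_on[OF bounded_linear_blinfun_inner_right] continuous_on_minus
          continuous_on_compose2[OF g[of UNIV]] continuous_intros) auto
    then have "fx z integrable_on cbox 0 L" by (rule integrable_continuous)
    then have "blinfun_apply (integral (cbox 0 L) (fx z)) h = integral (cbox 0 L) (\<lambda>t. blinfun_apply (fx z t) h)"
      by (rule blinfun_apply_integral)
    then show ?thesis by (simp add: fx_def)
  qed
  moreover have "smear x v L f = (\<lambda>z. integral (cbox 0 L) (\<lambda>t. f (x + t *\<^sub>R v - z)))"
    by (simp add: smear_def fun_eq_iff)
  ultimately have "(smear x v L f has_derivative (\<lambda>h. - integral {0..L} (\<lambda>t. g (x + t *\<^sub>R v - z) \<bullet> h))) (at z)"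
    by (metis (no_types, lifting) ext)
  then show ?thesis unfolding g_def .
qed

text \<open>The derivative in z falls on f with a sign, because f is evaluated at x + t v - z. The
  sign is written as a product with the constant -1, which keeps the new integrand in
  \<open>bump_alg k\<close> and lets the step be iterated.\<close>

lemma partial_deriv_smear:
  assumes f: "f \<in> bump_alg k"
  shows "partial_deriv i (smear x v L f) = smear x v L (\<lambda>w. - 1 * partial_deriv i f w)"
proof
  fix z
  have "partial_deriv i (smear x v L f) z = - integral {0..L} (\<lambda>t. (\<chi> i. partial_deriv i f (x + t *\<^sub>R v - z)) \<bullet> axis i 1)"
    by (rule partial_deriv_eq[OF smear_has_derivative[OF f]])
  also have "\<dots> = smear x v L (\<lambda>w. - 1 * partial_deriv i f w) z"
    by (simp add: inner_axis smear_def)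
  finally show "partial_deriv i (smear x v L f) z = smear x v L (\<lambda>w. - 1 * partial_deriv i f w) z" .
qed

lemma smooth_smear:
  assumes "f \<in> bump_alg k"
  shows "smooth_fun (smear x v L f)"
proof -
  have "\<exists>g\<in>bump_alg k. fold partial_deriv is (smear x v L f) = smear x v L g" for "is"
    using assms
  proof (induction "is" arbitrary: f)
    case (Cons i "is")
    have "(\<lambda>w. - 1 * partial_deriv i f w) \<in> bump_alg k"
      using bump_alg_deriv[OF Cons.prems] by (intro bump_alg.mult bump_alg.const) auto
    from Cons.IH[OF this] show ?case by (simp add: partial_deriv_smear[OF Cons.prems])
  qed auto
  moreover have "smear x v L g differentiable (at z)" if "g \<in> bump_alg k" for g z
    using smear_has_derivative[OF that] unfolding differentiable_def by blast
  ultimately show ?thesis unfolding smooth_fun_def by metis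
qed

lemma smear_directional_deriv:
  assumes f: "f \<in> bump_alg k" and L: "0 \<le> L"
  shows "(\<Sum>j\<in>UNIV. v $ j * partial_deriv j (smear x v L f) z) = f (x - z) - f (x + L *\<^sub>R v - z)"
proof -
  let ?g = "\<lambda>t. \<chi> i. partial_deriv i f (x + t *\<^sub>R v - z)"
  have "(\<Sum>j\<in>UNIV. v $ j * partial_deriv j (smear x v L f) z) = - integral {0..L} (\<lambda>t. ?g t \<bullet> v)"
  proof -
    interpret bounded_linear "\<lambda>h. - integral {0..L} (\<lambda>t. ?g t \<bullet> h)"
      by (rule has_derivative_bounded_linear[OF smear_has_derivative[OF f]])
    have "v = (\<Sum>i\<in>UNIV. (v $ i) *\<^sub>R axis i 1)"
      by (rule vec_expansion)
    then have "- integral {0..L} (\<lambda>t. ?g t \<bullet> v)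
       = - integral {0..L} (\<lambda>t. ?g t \<bullet> (\<Sum>i\<in>UNIV. (v $ i) *\<^sub>R axis i 1))"
      by simp
    also have "\<dots> = (\<Sum>j\<in>UNIV. v $ j * partial_deriv j (smear x v L f) z)"
      by (simp only: sum scaleR partial_deriv_eq[OF smear_has_derivative[OF f]] real_scaleR_def)
    finally show ?thesis by simp
  qed
  moreover have "((\<lambda>t. ?g t \<bullet> v) has_integral f (x + L *\<^sub>R v - z) - f (x + 0 *\<^sub>R v - z)) {0..L}"
  proof (rule fundamental_theorem_of_calculus[OF L])
    fix t
    have "((\<lambda>t. x + t *\<^sub>R v - z) has_derivative (\<lambda>h. h *\<^sub>R v)) (at t within {0..L})" by (auto intro!: derivative_eq_intros)
    from has_derivative_compose[OF this bump_alg_has_derivative[OF f]]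
    show "((\<lambda>t. f (x + t *\<^sub>R v - z)) has_vector_derivative ?g t \<bullet> v) (at t within {0..L})"
      by (simp add: has_vector_derivative_def)
  qed
  ultimately show ?thesis by (simp add: integral_unique)
qed

section \<open>Increments of mollified functions along segments\<close>

text \<open>Not normalised to integral 1: the values stay in [0, 1] and the support in the ball of
  radius 1/k, while the mass is carried along and divided out later.\<close>

definition moll :: "real \<Rightarrow> real^'n \<Rightarrow> real" where
  "moll k w = bump 0 (1 - k\<^sup>2 * (w \<bullet> w))"

lemma moll_bump_alg: "moll k \<in> bump_alg k"
  unfolding moll_def[abs_def] by (rule bump_alg.gen)

lemma moll_continuous: "continuous_on S (moll k)"
  by (rule bump_alg_continuous[OF moll_bump_alg])

lemma moll_measurable [measurable]: "moll k \<in> borel_measurable borel"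
  by (rule borel_measurable_continuous_onI[OF moll_continuous])

lemma moll_nonneg: "0 \<le> moll k w"
  by (simp add: moll_def bump_nonneg)

lemma moll_le_1: "moll k w \<le> 1"
  by (simp add: moll_def bump_def)

lemma moll_eq_0:
  assumes "0 < k" "1 / k \<le> norm w"
  shows "moll k w = 0"
proof -
  have "1 \<le> k * norm w" using assms by (simp add: field_simps)
  then have "1 \<le> (k * norm w)\<^sup>2" by simp
  then show ?thesis by (simp add: moll_def bump_def power_mult_distrib power2_norm_eq_inner)
qed

lemma moll_ge:
  assumes "0 < k" "norm w \<le> 1 / (2 * k)"
  shows "exp (- (4 / 3)) \<le> moll k w"
proof -
  have "k * norm w \<le> 1 / 2" using assms by (simp add: field_simps)
  then have "(k * norm w)\<^sup>2 \<le> (1 / 2)\<^sup>2" using assms by (intro power_mono) auto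
  then have "k\<^sup>2 * (w \<bullet> w) \<le> 1 / 4" by (simp add: power_mult_distrib power2_norm_eq_inner power_one_over)
  then show ?thesis by (simp add: moll_def bump_def field_simps)
qed

lemma integrable_L1_loc_mult:
  fixes g w :: "real^'n \<Rightarrow> real"
  assumes g: "g \<in> L1_loc \<Omega>" and \<Omega>: "open \<Omega>"
    and w: "continuous_on UNIV w" and T: "compact T" "T \<subseteq> \<Omega>" and supp: "\<And>z. z \<notin> T \<Longrightarrow> w z = 0"
  shows "integrable (lebesgue_on \<Omega>) (\<lambda>z. g z * w z)"
proof -
  have gT: "integrable (lebesgue_on T) g" using g T by (simp add: L1_loc_def)
  have "compact (w ` T)" using w T by (intro compact_continuous_image) (auto intro: continuous_on_subset)
  then obtain B where B: "\<And>z. z \<in> T \<Longrightarrow> norm (w z) \<le> B"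
    using compact_imp_bounded[of "w ` T"] by (auto simp: bounded_iff)
  have T_sets: "T \<in> sets lebesgue" using T by (auto intro: lmeasurable_compact fmeasurableD)
  have "integrable (lebesgue_on T) (\<lambda>z. g z * w z)"
  proof (rule Bochner_Integration.integrable_bound)
    show "integrable (lebesgue_on T) (\<lambda>z. B * g z)" using gT by simp
    have "w \<in> borel_measurable (lebesgue_on T)"
      using w T_sets by (intro continuous_imp_measurable_on_sets_lebesgue) (auto intro: continuous_on_subset)
    then show "(\<lambda>z. g z * w z) \<in> borel_measurable (lebesgue_on T)"
      using gT by (intro borel_measurable_times) auto
    show "AE z in lebesgue_on T. norm (g z * w z) \<le> norm (B * g z)"
    proof (intro AE_I2)
      fix z assume "z \<in> space (lebesgue_on T)"
      then have "z \<in> T" by (simp add: space_restrict_space)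
      then have "norm (w z) \<le> norm B" using B[of z] by simp
      then show "norm (g z * w z) \<le> norm (B * g z)" by (simp add: abs_mult mult_left_mono mult.commute[of "\<bar>B\<bar>"])
    qed
  qed
  then have "integrable lebesgue (\<lambda>z. indicator T z *\<^sub>R (g z * w z))"
    using T_sets by (simp add: integrable_restrict_space)
  also have "(\<lambda>z. indicator T z *\<^sub>R (g z * w z)) = (\<lambda>z. indicator \<Omega> z *\<^sub>R (g z * w z))"
    using supp T by (auto simp: indicator_def fun_eq_iff)
  finally show ?thesis
    using \<Omega> by (simp add: integrable_restrict_space borel_open)
qed

lemma L1_loc_inner:
  assumes "u \<in> L1_loc \<Omega>"
  shows "(\<lambda>z. u z \<bullet> c) \<in> L1_loc \<Omega>"
  using assms by (auto simp: L1_loc_def)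

lemma L1_loc_component:
  fixes u :: "real^'n \<Rightarrow> real^'m"
  assumes "u \<in> L1_loc \<Omega>"
  shows "(\<lambda>z. u z $ i) \<in> L1_loc \<Omega>"
  using L1_loc_inner[OF assms, of "axis i 1"] by (simp add: inner_axis)

lemma L1_loc_component2:
  fixes G :: "real^'n \<Rightarrow> real^'n^'n"
  assumes "G \<in> L1_loc \<Omega>"
  shows "(\<lambda>z. G z $ i $ j) \<in> L1_loc \<Omega>"
  using L1_loc_inner[OF assms, of "axis i (axis j 1)"] by (simp add: inner_axis)

text \<open>The quadratic form is the Frobenius inner product of A with the rank one matrix of
  entries v_i v_j, whose norm is |v|^2; then the Cauchy-Schwarz inequality.\<close>

lemma quadratic_form_le:
  fixes A :: "real^'n^'n"
  shows "\<bar>\<Sum>i\<in>UNIV. \<Sum>j\<in>UNIV. v $ i * v $ j * A $ i $ j\<bar> \<le> (norm v)\<^sup>2 * norm A"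
proof -
  define V :: "real^'n^'n" where "V = (\<chi> i j. v $ i * v $ j)"
  have "(norm V)\<^sup>2 = (\<Sum>i\<in>UNIV. \<Sum>j\<in>UNIV. (v $ i)\<^sup>2 * (v $ j)\<^sup>2)"
    unfolding power2_norm_eq_inner by (simp add: inner_vec_def V_def power2_eq_square mult_ac)
  also have "\<dots> = (\<Sum>i\<in>UNIV. (v $ i)\<^sup>2) * (\<Sum>j\<in>UNIV. (v $ j)\<^sup>2)"
    by (simp add: sum_product)
  also have "\<dots> = ((norm v)\<^sup>2)\<^sup>2"
    unfolding power2_norm_eq_inner by (simp add: inner_vec_def power2_eq_square)
  finally have "norm V = (norm v)\<^sup>2" by (rule power2_eq_imp_eq) auto
  moreover have "(\<Sum>i\<in>UNIV. \<Sum>j\<in>UNIV. v $ i * v $ j * A $ i $ j) = V \<bullet> A"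
    by (simp add: inner_vec_def V_def)
  ultimately show ?thesis using Cauchy_Schwarz_ineq2[of V A] by simp
qed

lemma compact_tube:
  fixes x v :: "'a::euclidean_space"
  shows "compact {z. \<exists>t\<in>{0..L}. norm (x + t *\<^sub>R v - z) \<le> r}"
proof -
  have "{z. \<exists>t\<in>{0..L}. norm (x + t *\<^sub>R v - z) \<le> r} = (\<lambda>(t, w). x + t *\<^sub>R v - w) ` ({0..L} \<times> cball 0 r)"
    by (force simp: image_iff)
  moreover have "compact ((\<lambda>(t, w). x + t *\<^sub>R v - w) ` ({0..L} \<times> cball 0 r))"
    unfolding split_beta by (intro compact_continuous_image compact_Times continuous_intros) auto
  ultimately show ?thesis by simp
qed

text \<open>The test function is \<open>z \<mapsto> \<integral>\<^sub>0\<^sup>L moll k (x + tv - z) dt\<close>: its derivative in the direction \<open>v\<close>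
  telescopes to the difference of the mollifiers centred at the endpoints of the segment.\<close>

lemma mollified_increment_le:
  fixes u :: "real^'n \<Rightarrow> real^'n" and f :: "real^'n \<Rightarrow> ennreal"
  assumes \<Omega>: "open \<Omega>" and u: "u \<in> L1_loc \<Omega>" and G: "has_sym_grad \<Omega> u G"
    and f[measurable]: "f \<in> borel_measurable borel"
    and Gf: "AE z in lborel. z \<in> \<Omega> \<longrightarrow> ennreal (norm (G z)) \<le> f z"
    and k: "0 < k" and L: "0 \<le> L"
    and T: "{z. \<exists>t\<in>{0..L}. norm (x + t *\<^sub>R v - z) \<le> 1 / k} \<subseteq> \<Omega>"
  shows "ennreal \<bar>(LINT z|lebesgue_on \<Omega>. (u z \<bullet> v) * moll k (x - z)) -
           (LINT z|lebesgue_on \<Omega>. (u z \<bullet> v) * moll k (x + L *\<^sub>R v - z))\<bar>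
     \<le> ennreal ((norm v)\<^sup>2) * (\<integral>\<^sup>+t\<in>{0..L}. (\<integral>\<^sup>+z. f z * ennreal (moll k (x + t *\<^sub>R v - z)) \<partial>lborel) \<partial>lborel)"
proof -
  let ?sum = "\<lambda>F. \<Sum>i\<in>UNIV. \<Sum>j\<in>UNIV. v $ i * v $ j * F i j"
  let ?W = "\<lambda>z. \<integral>\<^sup>+t. f z * (indicator {0..L} t * ennreal (moll k (x + t *\<^sub>R v - z))) \<partial>lborel"
  define T where "T = {z. \<exists>t\<in>{0..L}. norm (x + t *\<^sub>R v - z) \<le> 1 / k}"
  have T\<Omega>: "T \<subseteq> \<Omega>" using assms by (simp add: T_def)
  have Tc: "compact T" unfolding T_def by (rule compact_tube)
  define \<phi> where "\<phi> = smear x v L (moll k)"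
  have \<phi>_nonneg: "0 \<le> \<phi> z" for z
    unfolding \<phi>_def smear_def by (intro integral_nonneg moll_nonneg integrable_continuous_interval
        continuous_on_compose2[OF moll_continuous[of UNIV]] continuous_intros) auto
  have \<phi>_supp: "\<phi> z = 0" if "z \<notin> T" for z
  proof -
    have "moll k (x + t *\<^sub>R v - z) = 0" if "t \<in> {0..L}" for t
      using that \<open>z \<notin> T\<close> k by (intro moll_eq_0) (auto simp: T_def not_le intro: less_imp_le)
    then have "integral {0..L} (\<lambda>t. moll k (x + t *\<^sub>R v - z)) = integral {0..L} (\<lambda>t. 0)"
      by (intro Henstock_Kurzweil_Integration.integral_cong)
    then show ?thesis by (simp add: \<phi>_def smear_def)
  qed
  have smooth: "smooth_fun \<phi>" unfolding \<phi>_def by (rule smooth_smear[OF moll_bump_alg])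
  have diff: "fold partial_deriv is \<phi> differentiable (at z)" for "is" z
    using smooth by (simp add: smooth_fun_def)
  have \<phi>_cont: "continuous_on UNIV \<phi>"
    using diff[of "[]"] by (auto intro!: continuous_at_imp_continuous_on differentiable_imp_continuous_within)
  have \<phi>'_cont: "continuous_on UNIV (partial_deriv j \<phi>)" for j
    using diff[of "[j]"] by (auto intro!: continuous_at_imp_continuous_on differentiable_imp_continuous_within)
  have \<phi>'_supp: "partial_deriv j \<phi> z = 0" if "z \<notin> T" for j z
  proof -
    have "((\<lambda>_. 0) has_derivative (\<lambda>_. 0)) (at z)" by simp
    then have "(\<phi> has_derivative (\<lambda>_. 0)) (at z)"
      by (rule has_derivative_transform_within_open[where s = "- T"])
         (use that \<phi>_supp compact_imp_closed[OF Tc] in \<open>auto simp: open_Compl\<close>)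
    then show ?thesis by (rule partial_deriv_eq)
  qed
  have sub: "closure {z. \<phi> z \<noteq> 0} \<subseteq> T"
    using \<phi>_supp compact_imp_closed[OF Tc] by (intro closure_minimal) auto
  then have "\<phi> \<in> test_funs \<Omega>"
    using smooth T\<Omega> compact_Int_closed[OF Tc closed_closure, of "{z. \<phi> z \<noteq> 0}"]
    by (auto simp: test_funs_def Int_absorb1)
  then have eq: "distr_sym_grad \<Omega> u i j \<phi> = (LINT z|lebesgue_on \<Omega>. G z $ i $ j * \<phi> z)" for i j
    using G by (simp add: has_sym_grad_def)
  have GL: "G \<in> L1_loc \<Omega>" using G by (simp add: has_sym_grad_def)
  define I where "I = (\<lambda>p. LINT z|lebesgue_on \<Omega>. (u z \<bullet> v) * moll k (p - z))"
  have int_u: "integrable (lebesgue_on \<Omega>) (\<lambda>z. u z $ i * partial_deriv j \<phi> z)" for i j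
    by (rule integrable_L1_loc_mult[OF L1_loc_component[OF u] \<Omega> \<phi>'_cont Tc T\<Omega> \<phi>'_supp])
  have int_G: "integrable (lebesgue_on \<Omega>) (\<lambda>z. G z $ i $ j * \<phi> z)" for i j
    by (rule integrable_L1_loc_mult[OF L1_loc_component2[OF GL] \<Omega> \<phi>_cont Tc T\<Omega> \<phi>_supp])
  have int_I: "integrable (lebesgue_on \<Omega>) (\<lambda>z. (u z \<bullet> v) * moll k (x + t *\<^sub>R v - z))" if "t \<in> {0..L}" for t
  proof (rule integrable_L1_loc_mult[OF L1_loc_inner[OF u] \<Omega> _ Tc T\<Omega>])
    show "continuous_on UNIV (\<lambda>z. moll k (x + t *\<^sub>R v - z))"
      by (intro continuous_on_compose2[OF moll_continuous[of UNIV]] continuous_intros) auto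
    show "moll k (x + t *\<^sub>R v - z) = 0" if "z \<notin> T" for z
      using \<open>t \<in> {0..L}\<close> that k by (intro moll_eq_0) (auto simp: T_def not_le intro: less_imp_le)
  qed
  \<comment> \<open>Contraction with the symmetric weights v_i v_j does not see the antisymmetric
    part of the gradient. This is why the symmetric part alone controls the component of u along
    v.\<close>
  have "?sum (\<lambda>i j. distr_sym_grad \<Omega> u i j \<phi>)
      = ?sum (\<lambda>i j. distr_grad \<Omega> u i j \<phi>)"
  proof -
    have "?sum (\<lambda>i j. distr_grad \<Omega> u j i \<phi>) = (\<Sum>j\<in>UNIV. \<Sum>i\<in>UNIV. v $ i * v $ j * distr_grad \<Omega> u j i \<phi>)"
      by (rule sum.swap)
    then have "?sum (\<lambda>i j. distr_grad \<Omega> u j i \<phi>) = ?sum (\<lambda>i j. distr_grad \<Omega> u i j \<phi>)"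
      by (simp add: mult_ac)
    then show ?thesis
      by (simp add: distr_sym_grad_def distrib_left add_divide_distrib sum.distrib flip: sum_divide_distrib)
  qed
  also have "\<dots> = - (LINT z|lebesgue_on \<Omega>. ?sum (\<lambda>i j. u z $ i * partial_deriv j \<phi> z))"
    using int_u by (simp add: distr_grad_def sum_negf)
  also have "(\<lambda>z. \<Sum>i\<in>UNIV. \<Sum>j\<in>UNIV. v $ i * v $ j * (u z $ i * partial_deriv j \<phi> z))
      = (\<lambda>z. (u z \<bullet> v) * moll k (x + 0 *\<^sub>R v - z) - (u z \<bullet> v) * moll k (x + L *\<^sub>R v - z))"
  proof
    fix z
    have "?sum (\<lambda>i j. u z $ i * partial_deriv j \<phi> z)
        = (u z \<bullet> v) * (\<Sum>j\<in>UNIV. v $ j * partial_deriv j \<phi> z)"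
      unfolding inner_vec_def sum_product inner_real_def by (intro sum.cong refl) (simp only: mult_ac)
    also have "(\<Sum>j\<in>UNIV. v $ j * partial_deriv j \<phi> z) = moll k (x - z) - moll k (x + L *\<^sub>R v - z)"
      unfolding \<phi>_def by (rule smear_directional_deriv[OF moll_bump_alg L])
    finally show "?sum (\<lambda>i j. u z $ i * partial_deriv j \<phi> z)
        = (u z \<bullet> v) * moll k (x + 0 *\<^sub>R v - z) - (u z \<bullet> v) * moll k (x + L *\<^sub>R v - z)"
      by (simp add: right_diff_distrib)
  qed
  also have "(LINT z|lebesgue_on \<Omega>. (u z \<bullet> v) * moll k (x + 0 *\<^sub>R v - z) - (u z \<bullet> v) * moll k (x + L *\<^sub>R v - z))
      = I x - I (x + L *\<^sub>R v)"
    using int_I[of 0] int_I[of L] L by (simp add: I_def)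
  finally have sum_eq: "?sum (\<lambda>i j. distr_sym_grad \<Omega> u i j \<phi>) = - (I x - I (x + L *\<^sub>R v))" .
  define h where "h = (\<lambda>z. (\<Sum>i\<in>UNIV. \<Sum>j\<in>UNIV. v $ i * v $ j * G z $ i $ j) * \<phi> z)"
  have h_eq: "h = (\<lambda>z. \<Sum>i\<in>UNIV. \<Sum>j\<in>UNIV. v $ i * v $ j * (G z $ i $ j * \<phi> z))"
    by (simp add: h_def sum_distrib_right mult.assoc)
  have int_h: "integrable (lebesgue_on \<Omega>) h"
    unfolding h_eq using int_G by auto
  have "(LINT z|lebesgue_on \<Omega>. h z) = ?sum (\<lambda>i j. distr_sym_grad \<Omega> u i j \<phi>)"
    unfolding h_eq using int_G by (simp add: eq)
  with sum_eq have "\<bar>I x - I (x + L *\<^sub>R v)\<bar> = norm (LINT z|lebesgue_on \<Omega>. h z)" by simp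
  then have "ennreal \<bar>I x - I (x + L *\<^sub>R v)\<bar> \<le> (\<integral>\<^sup>+z. ennreal (norm (h z)) \<partial>lebesgue_on \<Omega>)"
    using integral_norm_bound_ennreal[OF int_h] by simp
  also have "\<dots> = (\<integral>\<^sup>+z. ennreal (norm (h z)) * indicator \<Omega> z \<partial>lebesgue)"
    using \<Omega> by (intro nn_integral_restrict_space) (simp add: borel_open)
  also have "\<dots> \<le> (\<integral>\<^sup>+z. ennreal ((norm v)\<^sup>2) * (f z * ennreal (\<phi> z)) \<partial>lebesgue)"
  proof (intro nn_integral_mono_AE)
    show "AE z in lebesgue. ennreal (norm (h z)) * indicator \<Omega> z \<le> ennreal ((norm v)\<^sup>2) * (f z * ennreal (\<phi> z))"
      using AE_completion[OF Gf]
    proof eventually_elim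
      case (elim z)
      show ?case
      proof (cases "z \<in> \<Omega>")
        case True
        have "norm (h z) \<le> (norm v)\<^sup>2 * norm (G z) * \<phi> z"
          unfolding h_def using quadratic_form_le[of v "G z"] \<phi>_nonneg[of z] by (simp add: abs_mult mult_right_mono)
        then have "ennreal (norm (h z)) \<le> ennreal ((norm v)\<^sup>2 * norm (G z) * \<phi> z)" by (rule ennreal_leI)
        also have "\<dots> = ennreal ((norm v)\<^sup>2) * (ennreal (norm (G z)) * ennreal (\<phi> z))"
          using \<phi>_nonneg[of z] by (simp add: ennreal_mult mult.assoc)
        also have "\<dots> \<le> ennreal ((norm v)\<^sup>2) * (f z * ennreal (\<phi> z))"
          using elim True by (intro mult_left_mono mult_right_mono) auto
        finally show ?thesis using True by simp
      qed simp
    qed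
  qed
  also have "\<dots> = (\<integral>\<^sup>+z. ennreal ((norm v)\<^sup>2) * (f z * ennreal (\<phi> z)) \<partial>lborel)"
    by (rule nn_integral_completion)
  \<comment> \<open>Writing \<phi> as an integral over t and exchanging the integrals turns the
    bound into an average along the segment of mollifications of f.\<close>
  also have "\<dots> = (\<integral>\<^sup>+z. ennreal ((norm v)\<^sup>2) * ?W z \<partial>lborel)"
  proof (intro nn_integral_cong)
    fix z
    have "((\<lambda>t. moll k (x + t *\<^sub>R v - z)) has_integral \<phi> z) {0..L}"
      unfolding \<phi>_def smear_def by (intro integrable_integral integrable_continuous_interval
        continuous_on_compose2[OF moll_continuous[of UNIV]] continuous_intros) auto
    then have "(\<integral>\<^sup>+t. ennreal (indicator {0..L} t * moll k (x + t *\<^sub>R v - z)) \<partial>lborel) = ennreal (\<phi> z)"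
      by (intro nn_integral_has_integral_lebesgue moll_nonneg)
    then have "ennreal (\<phi> z) = (\<integral>\<^sup>+t. indicator {0..L} t * ennreal (moll k (x + t *\<^sub>R v - z)) \<partial>lborel)"
      by (simp add: ennreal_mult' ennreal_indicator)
    then show "ennreal ((norm v)\<^sup>2) * (f z * ennreal (\<phi> z))
        = ennreal ((norm v)\<^sup>2) * ?W z"
      by (simp add: nn_integral_cmult)
  qed
  also have "\<dots> = ennreal ((norm v)\<^sup>2) * (\<integral>\<^sup>+z. ?W z \<partial>lborel)"
    by (intro nn_integral_cmult) measurable
  also have "(\<integral>\<^sup>+z. ?W z \<partial>lborel)
      = (\<integral>\<^sup>+t. (\<integral>\<^sup>+z. f z * (indicator {0..L} t * ennreal (moll k (x + t *\<^sub>R v - z))) \<partial>lborel) \<partial>lborel)"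
    by (intro lborel_pair.Fubini') measurable
  also have "\<dots> = (\<integral>\<^sup>+t\<in>{0..L}. (\<integral>\<^sup>+z. f z * ennreal (moll k (x + t *\<^sub>R v - z)) \<partial>lborel) \<partial>lborel)"
  proof (rule nn_integral_cong)
    fix t
    show "(\<integral>\<^sup>+z. f z * (indicator {0..L} t * ennreal (moll k (x + t *\<^sub>R v - z))) \<partial>lborel)
        = (\<integral>\<^sup>+z. f z * ennreal (moll k (x + t *\<^sub>R v - z)) \<partial>lborel) * indicator {0..L} t"
      by (cases "t \<in> {0..L}") simp_all
  qed
  finally show ?thesis by (simp add: I_def)
qed

section \<open>Mass of the mollifier and convergence of mollifications\<close>

definition moll_mass :: "'n::finite itself \<Rightarrow> real \<Rightarrow> real" where
  "moll_mass _ k = (LINT z|(lborel :: (real^'n) measure). moll k z)"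

lemma moll_minus: "moll k (- w) = moll k w"
  by (simp add: moll_def)

lemma integrable_moll_shift:
  fixes p :: "real^'n"
  assumes k: "0 < k"
  shows "integrable lborel (\<lambda>z. moll k (p - z))"
proof (rule Bochner_Integration.integrable_bound)
  show "integrable lborel (indicator (ball p (1 / k)) :: real^'n \<Rightarrow> real)"
    using emeasure_lborel_ball_finite[of p "1 / k"] by (simp add: integrable_indicator_iff)
  have "norm (moll k (p - z)) \<le> norm (indicator (ball p (1 / k)) z :: real)" for z
    using moll_eq_0[OF k, of "p - z"] moll_nonneg[of k "p - z"] moll_le_1[of k "p - z"]
    by (auto simp: indicator_def dist_norm not_less)
  then show "AE z in lborel. norm (moll k (p - z)) \<le> norm (indicator (ball p (1 / k)) z :: real)" by simp
qed measurable

lemma moll_mass_shift: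
  fixes p :: "real^'n"
  assumes k: "0 < k"
  shows "(LINT z|lborel. moll k (p - z)) = moll_mass TYPE('n) k"
proof -
  have "(\<integral>\<^sup>+z. ennreal (moll k (z :: real^'n)) \<partial>lborel) = (\<integral>\<^sup>+z. ennreal (moll k (p - z)) \<partial>lborel)"
    using nn_integral_affine[of "\<lambda>z :: real^'n. ennreal (moll k z)" "- 1" p] by simp
  then show ?thesis
    by (simp add: moll_mass_def integral_eq_nn_integral moll_nonneg)
qed

text \<open>On the ball of radius 1/(2k) the argument of the bump is at least 3/4, so the mollifier
  is at least exp(-4/3) there. The reciprocal of this number times the volume of that ball is
  \<open>moll_const n * k ^ n\<close>.\<close>

definition moll_const :: "nat \<Rightarrow> real" where
  "moll_const n = 2 ^ n * exp (4 / 3) / unit_ball_vol n"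

lemma moll_const_pos: "0 < moll_const n"
  by (simp add: moll_const_def)

lemma moll_mass_bounds:
  assumes k: "0 < k"
  shows "0 < moll_mass TYPE('n::finite) k" "1 / moll_mass TYPE('n) k \<le> moll_const CARD('n) * k ^ CARD('n)"
proof -
  let ?\<omega> = "unit_ball_vol (real CARD('n))"
  have int: "integrable (lborel :: (real^'n) measure) (moll k)"
    using integrable_moll_shift[OF k, of "0 :: real^'n"] by (simp add: moll_minus)
  have "ennreal (exp (- (4 / 3)) * (?\<omega> * (1 / (2 * k)) ^ CARD('n)))
      = (\<integral>\<^sup>+z. ennreal (exp (- (4 / 3))) * indicator (ball (0 :: real^'n) (1 / (2 * k))) z \<partial>lborel)"
    using k by (subst ennreal_mult) (auto simp: nn_integral_cmult_indicator emeasure_ball)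
  also have "\<dots> \<le> (\<integral>\<^sup>+z. ennreal (moll k (z :: real^'n)) \<partial>lborel)"
    using moll_ge[OF k, where 'a = 'n] by (intro nn_integral_mono) (auto simp: indicator_def dist_norm intro!: ennreal_leI)
  also have "\<dots> = ennreal (moll_mass TYPE('n) k)"
    using int by (simp add: moll_mass_def nn_integral_eq_integral moll_nonneg)
  finally have "exp (- (4 / 3)) * (?\<omega> * (1 / (2 * k)) ^ CARD('n)) \<le> moll_mass TYPE('n) k"
    by (rule ennreal_le_iff[THEN iffD1, rotated]) (simp add: moll_mass_def moll_nonneg integral_nonneg_AE)
  moreover have pos: "0 < exp (- (4 / 3)) * (?\<omega> * (1 / (2 * k)) ^ CARD('n))" using k by simp
  ultimately show mpos: "0 < moll_mass TYPE('n) k" by linarith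
  have "1 / moll_mass TYPE('n) k \<le> 1 / (exp (- (4 / 3)) * (?\<omega> * (1 / (2 * k)) ^ CARD('n)))"
    using \<open>_ \<le> moll_mass TYPE('n) k\<close> pos mpos by (intro divide_left_mono) simp_all
  also have "\<dots> = moll_const CARD('n) * k ^ CARD('n)"
    using k by (simp add: moll_const_def exp_minus power_divide power_mult_distrib field_simps)
  finally show "1 / moll_mass TYPE('n) k \<le> moll_const CARD('n) * k ^ CARD('n)" .
qed

lemma eventually_mollification_close:
  fixes g :: "real^'n \<Rightarrow> real"
  assumes \<Omega>: "open \<Omega>" and g: "g \<in> L1_loc \<Omega>" "continuous_on \<Omega> g" and p: "p \<in> \<Omega>" and \<eta>: "0 < \<eta>"
  shows "\<forall>\<^sub>F k in at_top. \<bar>(LINT z|lebesgue_on \<Omega>. g z * moll k (p - z)) - g p * moll_mass TYPE('n) k\<bar>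
           \<le> \<eta> * moll_mass TYPE('n) k"
proof -
  obtain \<delta> where \<delta>: "0 < \<delta>" "ball p \<delta> \<subseteq> \<Omega>" "\<And>z. z \<in> \<Omega> \<Longrightarrow> dist z p < \<delta> \<Longrightarrow> dist (g z) (g p) < \<eta>"
  proof -
    obtain d1 where "0 < d1" "ball p d1 \<subseteq> \<Omega>" using \<Omega> p by (auto simp: open_contains_ball)
    moreover obtain d2 where "0 < d2" "\<And>z. z \<in> \<Omega> \<Longrightarrow> dist z p < d2 \<Longrightarrow> dist (g z) (g p) < \<eta>"
      using g(2) p \<eta> unfolding continuous_on_iff by metis
    ultimately show ?thesis by (intro that[of "min d1 d2"]) auto
  qed
  have "\<forall>\<^sub>F k in at_top. 1 / \<delta> < k" by (rule eventually_gt_at_top)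
  then show ?thesis
  proof eventually_elim
    case (elim k)
    have k: "0 < k" using elim \<delta> by (meson divide_pos_pos less_trans zero_less_one)
    have k\<delta>: "1 / k < \<delta>" using elim \<delta> k by (simp add: field_simps)
    let ?m = "\<lambda>z. moll k (p - z)"
    have supp: "?m z = 0" if "z \<notin> cball p (1 / k)" for z
      using that k by (intro moll_eq_0) (auto simp: dist_norm)
    have "integrable (lebesgue_on \<Omega>) (\<lambda>z. g z * ?m z)"
    proof (rule integrable_L1_loc_mult[OF g(1) \<Omega> _ _ _ supp])
      show "continuous_on UNIV ?m"
        by (intro continuous_on_compose2[OF moll_continuous[of UNIV]] continuous_intros) auto
      have "cball p (1 / k) \<subseteq> ball p \<delta>" using k\<delta> by auto
      with \<delta> show "cball p (1 / k) \<subseteq> \<Omega>" by blast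
    qed auto
    then have int1: "integrable lebesgue (\<lambda>z. indicator \<Omega> z *\<^sub>R (g z * ?m z))"
      using \<Omega> by (simp add: integrable_restrict_space borel_open)
    have int2: "integrable lebesgue ?m"
      using integrable_moll_shift[OF k, of p] by (simp add: integrable_completion)
    have mass: "(LINT z|lebesgue. ?m z) = moll_mass TYPE('n) k"
      using moll_mass_shift[OF k, of p] by (simp add: integral_completion)
    have "(LINT z|lebesgue_on \<Omega>. g z * ?m z) - g p * moll_mass TYPE('n) k
        = (LINT z|lebesgue. indicator \<Omega> z *\<^sub>R (g z * ?m z) - g p * ?m z)"
      using int1 int2 mass \<Omega> by (simp add: integral_restrict_space borel_open)
    also have "\<bar>\<dots>\<bar> \<le> (LINT z|lebesgue. \<eta> * ?m z)"
    proof (rule order_trans[OF integral_abs_bound integral_mono])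
      fix z
      show "\<bar>indicator \<Omega> z *\<^sub>R (g z * ?m z) - g p * ?m z\<bar> \<le> \<eta> * ?m z"
      proof (cases "z \<in> cball p (1 / k)")
        case True
        then have z: "dist z p < \<delta>" using k\<delta> by (simp add: dist_commute)
        then have "z \<in> \<Omega>" using \<delta>(2) by (auto simp: dist_commute)
        have "\<bar>g z - g p\<bar> \<le> \<eta>" using \<delta>(3)[OF \<open>z \<in> \<Omega>\<close> z] by (simp add: dist_real_def)
        then have "\<bar>(g z - g p) * ?m z\<bar> \<le> \<eta> * ?m z"
          using moll_nonneg[of k "p - z"] by (simp add: abs_mult mult_right_mono)
        then show ?thesis using \<open>z \<in> \<Omega>\<close> by (simp add: left_diff_distrib)
      qed (simp add: supp)
    qed (use int1 int2 in auto)
    also have "\<dots> = \<eta> * moll_mass TYPE('n) k" using int2 mass by simp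
    finally show ?case .
  qed
qed

text \<open>If the ray stays in \<Omega>, the bounded support of u provides a point where u
  vanishes. Otherwise the segment is stopped just before the first exit: it has to be a compact
  subset of \<Omega> to leave room for mollification, and continuity of u on the closure makes the
  error at most \<eta>.\<close>

lemma ray_endpoint:
  fixes u :: "'a::euclidean_space \<Rightarrow> 'b::real_normed_vector"
  assumes \<Omega>: "open \<Omega>" and u: "continuous_on (closure \<Omega>) u" "bounded {y \<in> closure \<Omega>. u y \<noteq> 0}"
    and x: "x \<in> \<Omega>" and v: "v \<noteq> 0" and \<eta>: "0 < \<eta>"
    and b: "\<And>s. 0 < s \<Longrightarrow> x + s *\<^sub>R v \<in> frontier \<Omega> \<Longrightarrow> ennreal (norm (u (x + s *\<^sub>R v))) \<le> b"
  obtains L where "0 \<le> L" "\<And>t. t \<in> {0..L} \<Longrightarrow> x + t *\<^sub>R v \<in> \<Omega>" "ennreal (norm (u (x + L *\<^sub>R v))) \<le> b + ennreal \<eta>"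
proof (cases "\<forall>s\<ge>0. x + s *\<^sub>R v \<in> \<Omega>")
  case True
  obtain B where B: "0 < B" "\<And>y. y \<in> closure \<Omega> \<Longrightarrow> u y \<noteq> 0 \<Longrightarrow> norm y \<le> B"
    using u(2) unfolding bounded_pos by auto
  define L where "L = (B + norm x + 1) / norm v"
  have L: "0 \<le> L" using B v by (simp add: L_def)
  have "norm (L *\<^sub>R v) = B + norm x + 1" using v B by (simp add: L_def)
  then have "B < norm (x + L *\<^sub>R v)" using norm_triangle_ineq4[of "x + L *\<^sub>R v" x] by simp
  moreover have "x + L *\<^sub>R v \<in> closure \<Omega>" using True L closure_subset by blast
  ultimately have "u (x + L *\<^sub>R v) = 0" using B(2) by fastforce
  with L True show ?thesis by (intro that[of L]) auto
next
  case False
  define S where "S = {s. 0 \<le> s \<and> x + s *\<^sub>R v \<notin> \<Omega>}"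
  have "S = {0..} \<inter> (\<lambda>s. x + s *\<^sub>R v) -` (- \<Omega>)" by (auto simp: S_def)
  moreover have "closed ((\<lambda>s. x + s *\<^sub>R v) -` (- \<Omega>))"
    using \<Omega> by (intro closed_vimage continuous_intros) auto
  ultimately have "closed S" by auto
  moreover have ne: "S \<noteq> {}" "bdd_below S" using False by (auto simp: S_def intro: bdd_belowI)
  ultimately have "Inf S \<in> S" by (intro closed_contains_Inf)
  define e where "e = Inf S"
  have e: "0 \<le> e" "x + e *\<^sub>R v \<notin> \<Omega>" using \<open>Inf S \<in> S\<close> by (auto simp: e_def S_def)
  have "e \<noteq> 0" using e x by auto
  with e have epos: "0 < e" by simp
  have in\<Omega>: "x + s *\<^sub>R v \<in> \<Omega>" if "0 \<le> s" "s < e" for s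
  proof (rule ccontr)
    assume "x + s *\<^sub>R v \<notin> \<Omega>"
    then have "s \<in> S" using that by (simp add: S_def)
    then have "e \<le> s" unfolding e_def using ne by (intro cInf_lower)
    with that show False by simp
  qed
  have cl: "x + s *\<^sub>R v \<in> closure \<Omega>" if "0 \<le> s" "s \<le> e" for s
  proof -
    have "(\<lambda>s. x + s *\<^sub>R v) ` closure {0..<e} \<subseteq> closure \<Omega>"
      using in\<Omega> closure_subset by (intro image_closure_subset continuous_intros) fastforce+
    then show ?thesis using that epos by (auto simp: image_subset_iff)
  qed
  have "x + e *\<^sub>R v \<in> frontier \<Omega>" using e cl[of e] \<Omega> by (simp add: frontier_def interior_open)
  then have be: "ennreal (norm (u (x + e *\<^sub>R v))) \<le> b" using epos by (intro b)
  have "continuous_on {0..e} (\<lambda>s. u (x + s *\<^sub>R v))"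
    using cl by (intro continuous_on_compose2[OF u(1)] continuous_intros) auto
  then obtain \<delta> where \<delta>: "0 < \<delta>" "\<And>s. s \<in> {0..e} \<Longrightarrow> dist s e < \<delta> \<Longrightarrow> dist (u (x + s *\<^sub>R v)) (u (x + e *\<^sub>R v)) < \<eta>"
    using epos \<eta> unfolding continuous_on_iff by (metis atLeastAtMost_iff less_imp_le order_refl)
  define L where "L = max 0 (e - \<delta> / 2)"
  have L: "0 \<le> L" "L < e" "dist L e < \<delta>" using \<delta> epos by (auto simp: L_def dist_real_def)
  have "norm (u (x + L *\<^sub>R v)) \<le> norm (u (x + e *\<^sub>R v)) + dist (u (x + L *\<^sub>R v)) (u (x + e *\<^sub>R v))"
    by (metis dist_norm norm_triangle_sub)
  also have "\<dots> \<le> norm (u (x + e *\<^sub>R v)) + \<eta>" using \<delta>(2)[of L] L by auto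
  finally have "ennreal (norm (u (x + L *\<^sub>R v))) \<le> ennreal (norm (u (x + e *\<^sub>R v))) + ennreal \<eta>"
    using \<eta> by (simp flip: ennreal_plus)
  also have "\<dots> \<le> b + ennreal \<eta>" using be by (rule add_right_mono)
  finally show ?thesis using L in\<Omega> by (intro that[of L]) auto
qed

section \<open>The pointwise estimate\<close>

definition mollify :: "real \<Rightarrow> (real^'n \<Rightarrow> ennreal) \<Rightarrow> real^'n \<Rightarrow> ennreal" where
  "mollify k f y = ennreal (1 / moll_mass TYPE('n) k) * (\<integral>\<^sup>+z. f z * ennreal (moll k (y - z)) \<partial>lborel)"

lemma mollify_measurable [measurable]:
  assumes [measurable]: "f \<in> borel_measurable borel"
  shows "mollify k f \<in> borel_measurable borel"
  unfolding mollify_def[abs_def] by measurable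

text \<open>The scale beyond which the bound holds depends on v through the length L of the segment.
  The bound itself does not mention L: the integrand is nonnegative, so the integral is extended to
  the whole ray, and f is defined on all of space.\<close>

lemma eventually_ray_estimate:
  fixes u :: "real^'n \<Rightarrow> real^'n" and f :: "real^'n \<Rightarrow> ennreal"
  assumes \<Omega>: "open \<Omega>" and u: "u \<in> L1_loc \<Omega>" "u \<in> Cb_closure \<Omega>" and G: "has_sym_grad \<Omega> u G"
    and f[measurable]: "f \<in> borel_measurable borel"
    and Gf: "AE z in lborel. z \<in> \<Omega> \<longrightarrow> ennreal (norm (G z)) \<le> f z"
    and x: "x \<in> \<Omega>" and \<eta>: "0 < \<eta>"
    and b: "\<And>s. 0 < s \<Longrightarrow> x + s *\<^sub>R v \<in> frontier \<Omega> \<Longrightarrow> ennreal (norm (u (x + s *\<^sub>R v))) \<le> b"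
  shows "\<forall>\<^sub>F k in at_top. ennreal \<bar>u x \<bullet> v\<bar> \<le> ennreal (norm v) * b + ennreal \<eta>
           + ennreal ((norm v)\<^sup>2) * (\<integral>\<^sup>+s\<in>{0<..}. mollify k f (x + s *\<^sub>R v) \<partial>lborel)"
proof (cases "v = 0")
  case False
  then have N: "0 < norm v" by simp
  have ucl: "continuous_on (closure \<Omega>) u" "bounded {y \<in> closure \<Omega>. u y \<noteq> 0}"
    using u(2) by (auto simp: Cb_closure_def)
  have u\<Omega>: "continuous_on \<Omega> u" using ucl(1) closure_subset by (rule continuous_on_subset)
  have "0 < \<eta> / (3 * norm v)" using \<eta> N by simp
  from ray_endpoint[OF \<Omega> ucl x False this b]
  obtain L where L: "0 \<le> L" "\<And>t. t \<in> {0..L} \<Longrightarrow> x + t *\<^sub>R v \<in> \<Omega>"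
      "ennreal (norm (u (x + L *\<^sub>R v))) \<le> b + ennreal (\<eta> / (3 * norm v))"
    by metis
  define p where "p = x + L *\<^sub>R v"
  have p: "p \<in> \<Omega>" using L by (simp add: p_def)
  have up: "ennreal \<bar>u p \<bullet> v\<bar> \<le> ennreal (norm v) * b + ennreal (\<eta> / 3)"
  proof -
    have "ennreal \<bar>u p \<bullet> v\<bar> \<le> ennreal (norm v * norm (u p))"
      using Cauchy_Schwarz_ineq2[of "u p" v] by (intro ennreal_leI) (simp add: mult.commute)
    also have "\<dots> = ennreal (norm v) * ennreal (norm (u p))" by (simp add: ennreal_mult)
    also have "\<dots> \<le> ennreal (norm v) * (b + ennreal (\<eta> / (3 * norm v)))"
      using L(3) by (intro mult_left_mono) (simp_all add: p_def)
    also have "\<dots> = ennreal (norm v) * b + ennreal (\<eta> / 3)"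
      using N \<eta> by (simp add: distrib_left ennreal_mult'[symmetric])
    finally show ?thesis .
  qed
  have "compact ((\<lambda>t. x + t *\<^sub>R v) ` {0..L})"
    by (intro compact_continuous_image continuous_intros) auto
  moreover have "(\<lambda>t. x + t *\<^sub>R v) ` {0..L} \<subseteq> \<Omega>" using L by auto
  ultimately obtain \<epsilon> where \<epsilon>: "0 < \<epsilon>" "(\<Union>y\<in>(\<lambda>t. x + t *\<^sub>R v) ` {0..L}. ball y \<epsilon>) \<subseteq> \<Omega>"
    using \<Omega> by (metis compact_subset_open_imp_ball_epsilon_subset)
  have uv: "(\<lambda>z. u z \<bullet> v) \<in> L1_loc \<Omega>" "continuous_on \<Omega> (\<lambda>z. u z \<bullet> v)"
    by (rule L1_loc_inner[OF u(1)]) (intro continuous_intros u\<Omega>)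
  have \<eta>3: "0 < \<eta> / 3" using \<eta> by simp
  have "\<forall>\<^sub>F k in at_top. 1 / \<epsilon> < k" by (rule eventually_gt_at_top)
  with eventually_mollification_close[OF \<Omega> uv x \<eta>3] eventually_mollification_close[OF \<Omega> uv p \<eta>3]
  show ?thesis
  proof eventually_elim
    case (elim k)
    have k: "0 < k" using elim \<epsilon> by (meson divide_pos_pos less_trans zero_less_one)
    have k\<epsilon>: "1 / k < \<epsilon>" using elim \<epsilon> k by (simp add: field_simps)
    define M where "M = moll_mass TYPE('n) k"
    let ?V = "ennreal ((norm v)\<^sup>2) * (\<integral>\<^sup>+s\<in>{0<..}. mollify k f (x + s *\<^sub>R v) \<partial>lborel)"
    let ?W = "\<integral>\<^sup>+t\<in>{0..L}. (\<integral>\<^sup>+z. f z * ennreal (moll k (x + t *\<^sub>R v - z)) \<partial>lborel) \<partial>lborel"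
    have M: "0 < M" unfolding M_def by (rule moll_mass_bounds[OF k])
    define I where "I = (\<lambda>p. LINT z|lebesgue_on \<Omega>. (u z \<bullet> v) * moll k (p - z))"
    have "{z. \<exists>t\<in>{0..L}. norm (x + t *\<^sub>R v - z) \<le> 1 / k} \<subseteq> \<Omega>"
    proof safe
      fix z t assume t: "t \<in> {0..L}" "norm (x + t *\<^sub>R v - z) \<le> 1 / k"
      then have "z \<in> ball (x + t *\<^sub>R v) \<epsilon>" using k\<epsilon> by (simp add: dist_norm)
      with t \<epsilon>(2) show "z \<in> \<Omega>" by blast
    qed
    from mollified_increment_le[OF \<Omega> u(1) G f Gf k L(1) this]
    have inc: "ennreal \<bar>I x - I p\<bar> \<le> ennreal ((norm v)\<^sup>2) *
        ?W"
      by (simp add: I_def p_def)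
    \<comment> \<open>Two thirds of \<eta> pay for replacing the mollified values by those of u at x
      and at p; the last third is the loss in the value at p.\<close>
    have "\<bar>I x - (u x \<bullet> v) * M\<bar> \<le> \<eta> / 3 * M" "\<bar>I p - (u p \<bullet> v) * M\<bar> \<le> \<eta> / 3 * M"
      using elim by (simp_all add: I_def M_def)
    then have "\<bar>(u x \<bullet> v) * M\<bar> \<le> \<bar>I x - I p\<bar> + \<bar>(u p \<bullet> v) * M\<bar> + 2 * (\<eta> / 3 * M)" by linarith
    also have "\<bar>(u p \<bullet> v) * M\<bar> = \<bar>u p \<bullet> v\<bar> * M" using M by (simp add: abs_mult)
    finally have "\<bar>u x \<bullet> v\<bar> * M \<le> \<bar>I x - I p\<bar> + \<bar>u p \<bullet> v\<bar> * M + 2 * (\<eta> / 3 * M)"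
      using M by (simp add: abs_mult)
    then have "\<bar>u x \<bullet> v\<bar> \<le> 1 / M * \<bar>I x - I p\<bar> + \<bar>u p \<bullet> v\<bar> + 2 * \<eta> / 3"
      using M by (simp add: field_simps)
    then have "ennreal \<bar>u x \<bullet> v\<bar> \<le> ennreal (1 / M * \<bar>I x - I p\<bar> + \<bar>u p \<bullet> v\<bar> + 2 * \<eta> / 3)" by (rule ennreal_leI)
    also have "\<dots> = ennreal (1 / M) * ennreal \<bar>I x - I p\<bar> + ennreal \<bar>u p \<bullet> v\<bar> + ennreal (2 * \<eta> / 3)"
      using M \<eta> by (subst ennreal_mult[symmetric]) (auto simp flip: ennreal_plus)
    also have "\<dots> \<le> ?V
        + (ennreal (norm v) * b + ennreal (\<eta> / 3)) + ennreal (2 * \<eta> / 3)"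
    proof (intro add_mono up order_refl)
      have "ennreal (1 / M) * ennreal \<bar>I x - I p\<bar> \<le> ennreal (1 / M) * (ennreal ((norm v)\<^sup>2) *
          ?W)"
        using inc by (rule mult_left_mono) simp
      also have "\<dots> = ennreal ((norm v)\<^sup>2) * (ennreal (1 / M) *
          ?W)"
        by (rule mult.left_commute)
      also have "ennreal (1 / M) * ?W
          = (\<integral>\<^sup>+t\<in>{0..L}. mollify k f (x + t *\<^sub>R v) \<partial>lborel)"
        unfolding mollify_def M_def[symmetric] mult.assoc by (intro nn_integral_cmult[symmetric]) measurable
      also have "\<dots> \<le> (\<integral>\<^sup>+s\<in>{0<..}. mollify k f (x + s *\<^sub>R v) \<partial>lborel)"
        using AE_lborel_singleton[of "0 :: real"]
        by (intro nn_integral_mono_AE) (auto elim!: eventually_mono simp: indicator_def)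
      finally show "ennreal (1 / M) * ennreal \<bar>I x - I p\<bar>
          \<le> ?V"
        by (simp add: mult_left_mono)
    qed
    also have "?V
        + (ennreal (norm v) * b + ennreal (\<eta> / 3)) + ennreal (2 * \<eta> / 3)
        = ennreal (norm v) * b + (ennreal (\<eta> / 3) + ennreal (2 * \<eta> / 3))
        + ?V"
      by (simp only: add_ac)
    also have "ennreal (\<eta> / 3) + ennreal (2 * \<eta> / 3) = ennreal \<eta>"
      using \<eta> by (simp flip: ennreal_plus)
    finally show ?case .
  qed
qed simp

text \<open>Exchanging the integrals moves the mollification from f onto the kernel. There the
  mollifier is at most the indicator of a ball of radius 1/k and its inverse mass is at most a
  multiple of k^n, so that \<open>riesz_mean_le\<close> applies uniformly in k.\<close>

lemma riesz_mollify_le: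
  fixes f :: "real^'n \<Rightarrow> ennreal"
  assumes n: "2 \<le> CARD('n)" and f[measurable]: "f \<in> borel_measurable borel" and k: "0 < k"
  shows "(\<integral>\<^sup>+y. mollify k f y * riesz (CARD('n) - 1) (y - x) \<partial>lborel)
     \<le> ennreal (moll_const CARD('n) * riesz_mean_const CARD('n))
        * (\<integral>\<^sup>+z. f z * riesz (CARD('n) - 1) (z - x) \<partial>lborel)"
proof -
  let ?n = "CARD('n)" and ?r = "riesz (CARD('n) - 1) :: real^'n \<Rightarrow> ennreal"
  let ?c = "ennreal (moll_const ?n * k ^ ?n)"
  let ?near = "\<lambda>y z. indicator {z. dist y z < 1 / k} z :: ennreal"
  let ?B = "\<lambda>z. \<integral>\<^sup>+w\<in>ball (z - x) (1 / k). ?r w \<partial>lborel"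
  have "(\<integral>\<^sup>+y. mollify k f y * ?r (y - x) \<partial>lborel)
      \<le> (\<integral>\<^sup>+y. (\<integral>\<^sup>+z. ?c * (f z * (?near y z * ?r (y - x))) \<partial>lborel) \<partial>lborel)"
  proof (rule nn_integral_mono)
    fix y
    have "(\<integral>\<^sup>+z. f z * ennreal (moll k (y - z)) \<partial>lborel) \<le> (\<integral>\<^sup>+z. f z * ?near y z \<partial>lborel)"
    proof (intro nn_integral_mono mult_left_mono)
      fix z
      show "ennreal (moll k (y - z)) \<le> ?near y z"
        using moll_eq_0[OF k, of "y - z"] moll_le_1[of k "y - z"]
        by (auto simp: indicator_def dist_norm not_less)
    qed simp
    moreover have "ennreal (1 / moll_mass TYPE('n) k) \<le> ?c"
      using moll_mass_bounds(2)[OF k] by (rule ennreal_leI)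
    ultimately have "mollify k f y * ?r (y - x)
        \<le> ?c * (\<integral>\<^sup>+z. f z * ?near y z \<partial>lborel) * ?r (y - x)"
      unfolding mollify_def by (intro mult_right_mono mult_mono) auto
    also have "\<dots> = (\<integral>\<^sup>+z. ?c * (f z * (?near y z * ?r (y - x))) \<partial>lborel)"
    proof -
      have "(\<integral>\<^sup>+z. ?c * (f z * (?near y z * ?r (y - x))) \<partial>lborel)
          = ?c * (\<integral>\<^sup>+z. f z * ?near y z * ?r (y - x) \<partial>lborel)"
        unfolding mult.assoc by (intro nn_integral_cmult) measurable
      also have "(\<integral>\<^sup>+z. f z * ?near y z * ?r (y - x) \<partial>lborel)
          = (\<integral>\<^sup>+z. f z * ?near y z \<partial>lborel) * ?r (y - x)"
        by (intro nn_integral_multc) measurable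
      finally show ?thesis by (simp only: mult.assoc)
    qed
    finally show "mollify k f y * ?r (y - x)
        \<le> (\<integral>\<^sup>+z. ?c * (f z * (?near y z * ?r (y - x))) \<partial>lborel)" .
  qed
  also have "\<dots> = (\<integral>\<^sup>+z. (\<integral>\<^sup>+y. ?c * (f z * (?near y z * ?r (y - x))) \<partial>lborel) \<partial>lborel)"
    by (intro lborel_pair.Fubini') measurable
  also have "\<dots> \<le> (\<integral>\<^sup>+z. ennreal (moll_const ?n * riesz_mean_const ?n) * (f z * ?r (z - x)) \<partial>lborel)"
  proof (rule nn_integral_mono)
    fix z
    have "(\<integral>\<^sup>+y. ?near y z * ?r (y - x) \<partial>lborel)
        = (\<integral>\<^sup>+w. ?near (x + 1 *\<^sub>R w) z * ?r (x + 1 *\<^sub>R w - x) \<partial>lborel)"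
      by (subst nn_integral_affine[where c = 1 and t = x]) simp_all
    also have "\<dots> = ?B z"
      by (intro nn_integral_cong) (auto simp: indicator_def dist_norm algebra_simps norm_minus_commute)
    finally have shift: "(\<integral>\<^sup>+y. ?near y z * ?r (y - x) \<partial>lborel) = ?B z" .
    have mean: "ennreal (k ^ ?n) * ?B z \<le> ennreal (riesz_mean_const ?n) * ?r (z - x)"
      using riesz_mean_le[of k "z - x"] n k by simp
    have "(\<integral>\<^sup>+y. ?c * (f z * (?near y z * ?r (y - x))) \<partial>lborel)
        = ?c * (f z * ?B z)"
    proof -
      have "(\<integral>\<^sup>+y. ?c * (f z * (?near y z * ?r (y - x))) \<partial>lborel)
          = ?c * (\<integral>\<^sup>+y. f z * (?near y z * ?r (y - x)) \<partial>lborel)"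
        by (intro nn_integral_cmult) measurable
      also have "(\<integral>\<^sup>+y. f z * (?near y z * ?r (y - x)) \<partial>lborel)
          = f z * (\<integral>\<^sup>+y. ?near y z * ?r (y - x) \<partial>lborel)"
        by (intro nn_integral_cmult) measurable
      finally show ?thesis by (simp only: shift)
    qed
    also have "\<dots> = ennreal (moll_const ?n) * f z * (ennreal (k ^ ?n) * ?B z)"
      using k moll_const_pos[of ?n] by (subst ennreal_mult) (auto simp only: mult_ac intro: less_imp_le zero_le_power)
    also have "\<dots> \<le> ennreal (moll_const ?n) * f z * (ennreal (riesz_mean_const ?n) * ?r (z - x))"
      using mean by (rule mult_left_mono) simp
    also have "\<dots> = ennreal (moll_const ?n * riesz_mean_const ?n) * (f z * ?r (z - x))"
    proof -
      have "ennreal (moll_const ?n * riesz_mean_const ?n) = ennreal (moll_const ?n) * ennreal (riesz_mean_const ?n)"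
        using moll_const_pos[of ?n] riesz_mean_const_pos[where 'a = "real^'n"] n by (intro ennreal_mult) auto
      then show ?thesis by (simp only: mult_ac)
    qed
    finally show "(\<integral>\<^sup>+y. ?c * (f z * (?near y z * ?r (y - x))) \<partial>lborel)
        \<le> ennreal (moll_const ?n * riesz_mean_const ?n) * (f z * ?r (z - x))" .
  qed
  also have "\<dots> = ennreal (moll_const ?n * riesz_mean_const ?n) * (\<integral>\<^sup>+z. f z * ?r (z - x) \<partial>lborel)"
    by (intro nn_integral_cmult) measurable
  finally show ?thesis .
qed

text \<open>The factors are the bound 9 for |v|^2 on the annulus, the constant of the integration
  over rays, and the loss caused by mollification.\<close>

definition pointwise_const :: "nat \<Rightarrow> real" where
  "pointwise_const n = 9 * (2 * 3 ^ (n - 1)) * (moll_const n * riesz_mean_const n)"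

lemma emeasure_annulus_finite: "emeasure lborel (annulus :: 'a::euclidean_space set) < top"
proof -
  have "emeasure lborel (annulus :: 'a set) \<le> emeasure lborel (cball (0::'a) 3)"
    by (intro emeasure_mono) (auto simp: dist_norm)
  then show ?thesis using emeasure_lborel_cball_finite[of "0::'a" 3] by (auto intro: le_less_trans)
qed

text \<open>With a = u(x), the ball D of radius 1 about 2 a / |a| consists of directions in which
  the component of a is at least |a|, since a . (2 a / |a|) = 2 |a| and moving by less than 1
  changes this by at most |a|. The volume of D is the factor on the left. D lies in the annulus,
  where |v| <= 3 explains the factor of the boundary term.\<close>

lemma pointwise_estimate:
  fixes u :: "real^'n \<Rightarrow> real^'n" and f :: "real^'n \<Rightarrow> ennreal"
  assumes n: "2 \<le> CARD('n)"
    and \<Omega>: "open \<Omega>" and u: "u \<in> L1_loc \<Omega>" "u \<in> Cb_closure \<Omega>" and G: "has_sym_grad \<Omega> u G"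
    and f[measurable]: "f \<in> borel_measurable borel"
    and Gf: "AE z in lborel. z \<in> \<Omega> \<longrightarrow> ennreal (norm (G z)) \<le> f z"
    and x: "x \<in> \<Omega>" and b_meas[measurable]: "b \<in> borel_measurable borel"
    and b: "\<And>s v. 0 < s \<Longrightarrow> x + s *\<^sub>R v \<in> frontier \<Omega> \<Longrightarrow> ennreal (norm (u (x + s *\<^sub>R v))) \<le> b v"
  shows "ennreal (unit_ball_vol CARD('n)) * ennreal (norm (u x))
     \<le> ennreal (pointwise_const CARD('n)) * (\<integral>\<^sup>+z. f z * riesz (CARD('n) - 1) (z - x) \<partial>lborel)
        + 3 * (\<integral>\<^sup>+v\<in>annulus. b v \<partial>lborel)"
proof (cases "u x = 0")
  case False
  let ?n = "CARD('n)" and ?\<omega> = "unit_ball_vol (real CARD('n))"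
  let ?A = "annulus :: (real^'n) set"
  let ?b = "\<integral>\<^sup>+v\<in>?A. b v \<partial>lborel" and ?P = "ennreal (pointwise_const ?n)"
  let ?m = "moll_const ?n * riesz_mean_const ?n" and ?a = "emeasure lborel ?A"
  have [measurable]: "?A \<in> sets borel"
    by (intro borel_closed closed_Collect_conj closed_Collect_le continuous_intros)
  define a where "a = u x"
  have a: "0 < norm a" using False by (simp add: a_def)
  define D where "D = ball ((2 / norm a) *\<^sub>R a) 1"
  have [measurable]: "D \<in> sets borel" by (simp add: D_def)
  have nD: "norm ((2 / norm a) *\<^sub>R a) = 2" using a by simp
  have DA: "D \<subseteq> ?A"
  proof
    fix v assume "v \<in> D"
    then have "norm ((2 / norm a) *\<^sub>R a - v) < 1" by (simp add: D_def dist_norm)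
    with norm_triangle_ineq3[of "(2 / norm a) *\<^sub>R a" v] have "\<bar>2 - norm v\<bar> < 1"
      unfolding nD by linarith
    then show "v \<in> ?A" by auto
  qed
  have Da: "norm a \<le> \<bar>a \<bullet> v\<bar>" if "v \<in> D" for v
  proof -
    define w where "w = (2 / norm a) *\<^sub>R a"
    have "norm (w - v) < 1" using that by (simp add: D_def dist_norm w_def)
    then have "norm a * norm (w - v) \<le> norm a * 1" by (intro mult_left_mono) auto
    with Cauchy_Schwarz_ineq2[of a "w - v"] have "a \<bullet> (w - v) \<le> norm a" by linarith
    moreover have "a \<bullet> w = 2 * norm a" using a by (simp add: w_def power2_norm_eq_inner[symmetric] power2_eq_square)
    ultimately show ?thesis by (simp add: inner_diff_right)
  qed
  define J where "J = (\<integral>\<^sup>+z. f z * riesz (?n - 1) (z - x) \<partial>lborel)"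
  define F where "F = (\<lambda>m v. \<integral>\<^sup>+s\<in>{0<..}. mollify (real (Suc m)) f (x + s *\<^sub>R v) \<partial>lborel)"
  have [measurable]: "F m \<in> borel_measurable borel" for m unfolding F_def[abs_def] by measurable
  have main: "ennreal ?\<omega> * ennreal (norm a) \<le> ?P * J + 3 * ?b
      + ennreal \<eta> * ?a" if \<eta>: "0 < \<eta>" for \<eta>
  proof -
    define R where "R = (\<lambda>m v. 3 * b v + ennreal \<eta> + 9 * F m v)"
    have [measurable]: "R m \<in> borel_measurable borel" for m unfolding R_def[abs_def] by measurable
    have "ennreal ?\<omega> * ennreal (norm a) = (\<integral>\<^sup>+v. ennreal (norm a) * indicator D v \<partial>lborel)"
      by (subst nn_integral_cmult_indicator) (auto simp: D_def emeasure_ball mult.commute)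
    also have "\<dots> \<le> (\<integral>\<^sup>+v. liminf (\<lambda>m. R m v * indicator D v) \<partial>lborel)"
    proof (rule nn_integral_mono)
      fix v
      show "ennreal (norm a) * indicator D v \<le> liminf (\<lambda>m. R m v * indicator D v)"
      proof (cases "v \<in> D")
        case True
        have v3: "norm v \<le> 3" using DA True by auto
        have "\<forall>\<^sub>F m in sequentially. ennreal \<bar>a \<bullet> v\<bar> \<le> ennreal (norm v) * b v + ennreal \<eta> + ennreal ((norm v)\<^sup>2) * F m v"
          unfolding F_def a_def
          using eventually_ray_estimate[OF \<Omega> u G f Gf x \<eta> b]
            filterlim_compose[OF filterlim_real_sequentially filterlim_Suc]
          by (rule eventually_compose_filterlim)
        then have "\<forall>\<^sub>F m in sequentially. ennreal (norm a) \<le> R m v"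
        proof eventually_elim
          case (elim m)
          have "ennreal (norm a) \<le> ennreal \<bar>a \<bullet> v\<bar>" using Da[OF True] by (rule ennreal_leI)
          also note elim
          also have "ennreal (norm v) * b v + ennreal \<eta> + ennreal ((norm v)\<^sup>2) * F m v \<le> ennreal 3 * b v + ennreal \<eta> + ennreal 9 * F m v"
            using v3 power_mono[OF v3, of 2] by (intro add_mono mult_right_mono ennreal_leI) auto
          finally show ?case by (simp add: R_def)
        qed
        then show ?thesis using True by (simp add: Liminf_bounded)
      qed simp
    qed
    \<comment> \<open>Fatou's lemma: the ray estimate holds from a scale on that depends on v, with
      no uniform choice.\<close>
    also have "\<dots> \<le> liminf (\<lambda>m. \<integral>\<^sup>+v. R m v * indicator D v \<partial>lborel)"
      by (intro nn_integral_liminf) measurable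
    also have "\<dots> \<le> liminf (\<lambda>m::nat. ?P * J + 3 * ?b + ennreal \<eta> * ?a)"
    proof (intro Liminf_mono always_eventually allI)
      fix m
      have "(\<integral>\<^sup>+v. R m v * indicator D v \<partial>lborel) \<le> (\<integral>\<^sup>+v. R m v * indicator ?A v \<partial>lborel)"
        using DA by (intro nn_integral_mono mult_left_mono) (auto simp: indicator_def)
      also have "\<dots> = (\<integral>\<^sup>+v. 3 * (b v * indicator ?A v) + ennreal \<eta> * indicator ?A v + 9 * (F m v * indicator ?A v) \<partial>lborel)"
        by (intro nn_integral_cong) (simp add: R_def indicator_def)
      also have "\<dots> = 3 * ?b + ennreal \<eta> * ?a + 9 * (\<integral>\<^sup>+v\<in>?A. F m v \<partial>lborel)"
        by (simp add: nn_integral_add nn_integral_cmult)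
      also have "(\<integral>\<^sup>+v\<in>?A. F m v \<partial>lborel) \<le> ennreal (2 * 3 ^ (?n - 1)) * (\<integral>\<^sup>+y. mollify (real (Suc m)) f y * riesz (?n - 1) (y - x) \<partial>lborel)"
        unfolding F_def using nn_integral_rays_le[of "mollify (real (Suc m)) f" x] by simp
      also have "\<dots> \<le> ennreal (2 * 3 ^ (?n - 1)) * (ennreal (?m) * J)"
        unfolding J_def by (intro mult_left_mono riesz_mollify_le n f) auto
      finally have "(\<integral>\<^sup>+v. R m v * indicator D v \<partial>lborel) \<le> 3 * ?b + ennreal \<eta> * ?a
          + 9 * (ennreal (2 * 3 ^ (?n - 1)) * (ennreal (?m) * J))"
        by (simp add: add_left_mono mult_left_mono)
      also have "9 * (ennreal (2 * 3 ^ (?n - 1)) * (ennreal (?m) * J)) = ?P * J"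
      proof -
        have "0 \<le> ?m"
          using moll_const_pos[of ?n] riesz_mean_const_pos[where 'a = "real^'n"] n by simp
        then have "?P = ennreal 9 * ennreal (2 * 3 ^ (?n - 1)) * ennreal ?m"
          unfolding pointwise_const_def by (simp only: ennreal_mult'' ennreal_mult' zero_le_numeral zero_le_power mult_nonneg_nonneg)
        then show ?thesis by (simp add: mult.assoc)
      qed
      finally show "(\<integral>\<^sup>+v. R m v * indicator D v \<partial>lborel)
          \<le> ?P * J + 3 * ?b + ennreal \<eta> * ?a"
        by (simp only: add_ac)
    qed
    finally show ?thesis by (simp add: Liminf_const)
  qed
  have "ennreal ?\<omega> * ennreal (norm a) \<le> ?P * J + 3 * ?b"
  proof (rule ennreal_le_epsilon)
    fix e :: real assume e: "0 < e"
    define q where "q = enn2real (?a)"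
    have q: "?a = ennreal q" "0 \<le> q" using emeasure_annulus_finite[where 'a = "real^'n"] by (auto simp: q_def)
    have "ennreal (e / (q + 1)) * ?a \<le> ennreal e"
      using e q by (simp add: ennreal_mult'[symmetric] ennreal_leI field_simps)
    with main[of "e / (q + 1)"] e q show "ennreal ?\<omega> * ennreal (norm a)
        \<le> ?P * J + 3 * ?b + ennreal e"
      by (auto intro: order_trans add_left_mono)
  qed
  then show ?thesis by (simp add: a_def J_def)
qed simp

section \<open>Layer cake estimates for rearrangements\<close>

text \<open>The generalised inverse of a distribution function, separated from measures so that
  Lebesgue measure and the Hausdorff outer measure of superlevel sets are treated alike.\<close>

definition decr_inverse :: "(real \<Rightarrow> ennreal) \<Rightarrow> real \<Rightarrow> ennreal" where
  "decr_inverse h s = (INF t\<in>{t. 0 \<le> t \<and> h t \<le> ennreal s}. ennreal t)"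

lemma decr_rearr_eq:
  "decr_rearr M f = decr_inverse (\<lambda>t. emeasure M {x \<in> space M. t < norm (f x)})"
  by (simp add: decr_rearr_def[abs_def] decr_inverse_def[abs_def])

lemma decr_inverse_ge:
  assumes h: "antimono h" and "ennreal r < h t"
  shows "ennreal t \<le> decr_inverse h r"
  unfolding decr_inverse_def
proof (rule INF_greatest)
  fix t' assume "t' \<in> {t. 0 \<le> t \<and> h t \<le> ennreal r}"
  then have "h t' < h t" using assms(2) by auto
  have "t < t'"
  proof (rule ccontr)
    assume "\<not> t < t'"
    then have "h t \<le> h t'" by (intro antimonoD[OF h]) simp
    with \<open>h t' < h t\<close> show False by simp
  qed
  then show "ennreal t \<le> ennreal t'" by (simp add: ennreal_leI)
qed

lemma le_of_decr_inverse_less: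
  assumes h: "antimono h" and "decr_inverse h s < ennreal t"
  shows "h t \<le> ennreal s"
proof -
  obtain t' where t': "0 \<le> t'" "h t' \<le> ennreal s" "ennreal t' < ennreal t"
    using assms(2) unfolding decr_inverse_def INF_less_iff by auto
  then have "t' \<le> t" by (simp add: ennreal_less_iff)
  then have "h t \<le> h t'" using h by (rule antimonoD[rotated])
  with t' show ?thesis by simp
qed

lemma decr_inverse_antimono:
  assumes "r \<le> s"
  shows "decr_inverse h s \<le> decr_inverse h r"
  unfolding decr_inverse_def using assms by (intro INF_superset_mono) (auto intro: order_trans ennreal_leI)

lemma antimono_borel_measurable:
  fixes h :: "real \<Rightarrow> ennreal"
  assumes "antimono h"
  shows "h \<in> borel_measurable borel"
proof (rule borel_measurableI_greater)
  fix y
  have "is_interval {x. y < h x}"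
    unfolding is_interval_1 using assms by (auto dest: antimonoD intro: less_le_trans)
  then show "{x \<in> space borel. y < h x} \<in> sets borel"
    by (simp add: real_interval_borel_measurable)
qed

text \<open>A decreasing function is at the right end of an interval no larger than its mean. This
  converts the truncation levels into integrals that the theorem admits on its right side.\<close>

lemma mult_decr_inverse_le:
  assumes "0 \<le> S"
  shows "ennreal S * decr_inverse h S \<le> (\<integral>\<^sup>+r\<in>{0..S}. decr_inverse h r \<partial>lborel)"
proof -
  have "ennreal S * decr_inverse h S = (\<integral>\<^sup>+r. decr_inverse h S * indicator {0..S} r \<partial>lborel)"
    using assms by (simp add: nn_integral_cmult_indicator mult.commute)
  also have "\<dots> \<le> (\<integral>\<^sup>+r\<in>{0..S}. decr_inverse h r \<partial>lborel)"
    by (intro nn_integral_mono) (auto simp: indicator_def decr_inverse_antimono)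
  finally show ?thesis .
qed

lemma nn_integral_upper_layers_le:
  assumes h: "antimono h" and l: "0 \<le> l"
  shows "(\<integral>\<^sup>+t\<in>{l<..}. indicator {t. ennreal r < h t} t \<partial>lborel) \<le> decr_inverse h r"
proof (cases "decr_inverse h r")
  case (real w)
  have "(\<integral>\<^sup>+t\<in>{l<..}. indicator {t. ennreal r < h t} t \<partial>lborel) \<le> (\<integral>\<^sup>+t. indicator {0..w} t \<partial>lborel)"
  proof (intro nn_integral_mono)
    fix t
    have "t \<le> w" if "l < t" "ennreal r < h t"
      using decr_inverse_ge[OF h that(2)] real by simp
    then show "indicator {t. ennreal r < h t} t * indicator {l<..} t \<le> (indicator {0..w} t :: ennreal)"
      using l by (auto simp: indicator_def)
  qed
  also have "\<dots> = decr_inverse h r" using real by simp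
  finally show ?thesis .
qed simp

lemma measurable_layers:
  fixes h :: "real \<Rightarrow> ennreal"
  assumes "antimono h"
  shows "(\<lambda>p. indicator {t. ennreal (snd p) < h t} (fst p) :: ennreal) \<in> borel_measurable (borel \<Otimes>\<^sub>M borel)"
proof -
  have [measurable]: "h \<in> borel_measurable borel" by (rule antimono_borel_measurable[OF assms])
  have "Measurable.pred (borel \<Otimes>\<^sub>M borel) (\<lambda>p. ennreal (snd p) < h (fst p))" by measurable
  then have "(\<lambda>p. indicator {p. ennreal (snd p) < h (fst p)} p :: ennreal) \<in> borel_measurable (borel \<Otimes>\<^sub>M borel)"
    by (intro borel_measurable_indicator) (simp add: pred_def space_pair_measure)
  then show ?thesis by (simp add: indicator_def)
qed

text \<open>Layer cake read backwards: h(t) is the length of the set of r in [0, h(t)), which lies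
  in [0, S] for t > l. After exchanging the integrals, the t with r < h(t) fill at most the interval
  up to the generalised inverse at r.\<close>

lemma nn_integral_distribution_le:
  fixes h :: "real \<Rightarrow> ennreal"
  assumes h: "antimono h" and l: "0 \<le> l" and S: "\<And>t. l < t \<Longrightarrow> h t \<le> ennreal S"
  shows "(\<integral>\<^sup>+t\<in>{l<..}. h t \<partial>lborel) \<le> (\<integral>\<^sup>+r\<in>{0..S}. decr_inverse h r \<partial>lborel)"
proof -
  define X where "X = (\<lambda>(t::real) (r::real). indicator {t. ennreal r < h t} t * indicator {l<..} t * indicator {0..S} r :: ennreal)"
  have [measurable]: "(\<lambda>(t, r). X t r) \<in> borel_measurable (borel \<Otimes>\<^sub>M borel)"
    using measurable_layers[OF h] unfolding X_def split_beta by measurable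
  have "(\<integral>\<^sup>+t\<in>{l<..}. h t \<partial>lborel) \<le> (\<integral>\<^sup>+t. (\<integral>\<^sup>+r. X t r \<partial>lborel) \<partial>lborel)"
  proof (intro nn_integral_mono)
    fix t
    show "h t * indicator {l<..} t \<le> (\<integral>\<^sup>+r. X t r \<partial>lborel)"
    proof (cases "l < t")
      case True
      then obtain q where q: "h t = ennreal q" "0 \<le> q" using S[OF True] by (cases "h t") (auto simp: top_unique)
      have "h t = (\<integral>\<^sup>+r. indicator {0..<q} r \<partial>lborel)" using q by simp
      also have "\<dots> \<le> (\<integral>\<^sup>+r. X t r \<partial>lborel)"
        using True S[OF True] q unfolding X_def
        by (intro nn_integral_mono) (auto simp: indicator_def ennreal_less_iff ennreal_le_iff2)
      finally show ?thesis using True by simp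
    qed simp
  qed
  also have "\<dots> = (\<integral>\<^sup>+r. (\<integral>\<^sup>+t. X t r \<partial>lborel) \<partial>lborel)"
    by (intro lborel_pair.Fubini') measurable
  also have "\<dots> \<le> (\<integral>\<^sup>+r\<in>{0..S}. decr_inverse h r \<partial>lborel)"
  proof (intro nn_integral_mono)
    fix r
    have "(\<integral>\<^sup>+t. X t r \<partial>lborel) = (\<integral>\<^sup>+t\<in>{l<..}. indicator {t. ennreal r < h t} t \<partial>lborel) * indicator {0..S} r"
      by (cases "r \<in> {0..S}") (simp_all add: X_def)
    also have "\<dots> \<le> decr_inverse h r * indicator {0..S} r"
      by (intro mult_right_mono nn_integral_upper_layers_le h l) simp
    finally show "(\<integral>\<^sup>+t. X t r \<partial>lborel) \<le> decr_inverse h r * indicator {0..S} r" .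
  qed
  finally show ?thesis .
qed

text \<open>A Riemann sum at right endpoints of a decreasing function. Boundary values are
  discretised because every level requires its own choice of a cover, and only countably many can be
  handled.\<close>

lemma suminf_layers_le:
  fixes h :: "real \<Rightarrow> ennreal"
  assumes h: "antimono h" and \<delta>: "0 < \<delta>"
  shows "(\<Sum>j. ennreal \<delta> * h (l + real (Suc j) * \<delta>)) \<le> (\<integral>\<^sup>+t\<in>{l<..}. h t \<partial>lborel)"
proof -
  let ?h = "\<lambda>j. h (l + real (Suc j) * \<delta>)"
  define I where "I = (\<lambda>j::nat. {l + real j * \<delta><..l + real (Suc j) * \<delta>})"
  have disj: "disjoint_family I"
    unfolding disjoint_family_on_def
  proof (intro ballI impI)
    have *: "I i \<inter> I j = {}" if "i < j" for i j
    proof -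
      have "real (Suc i) * \<delta> \<le> real j * \<delta>" using that \<delta> by (intro mult_right_mono) auto
      then show ?thesis by (auto simp: I_def)
    qed
    fix i j :: nat assume "i \<noteq> j"
    then show "I i \<inter> I j = {}" using *[of i j] *[of j i] by (metis Int_commute linorder_neqE_nat)
  qed
  have len: "emeasure lborel (I j) = ennreal \<delta>" for j
    using \<delta> by (simp add: I_def algebra_simps)
  have "(\<Sum>j. ennreal \<delta> * ?h j) = (\<Sum>j. \<integral>\<^sup>+t. ?h j * indicator (I j) t \<partial>lborel)"
    by (intro suminf_cong, subst nn_integral_cmult_indicator) (simp_all only: len mult.commute, simp add: I_def)
  also have "\<dots> = (\<integral>\<^sup>+t. (\<Sum>j. ?h j * indicator (I j) t) \<partial>lborel)"
    by (intro nn_integral_suminf[symmetric]) (auto simp: I_def)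
  also have "\<dots> \<le> (\<integral>\<^sup>+t\<in>{l<..}. h t \<partial>lborel)"
  proof (intro nn_integral_mono)
    fix t
    show "(\<Sum>j. ?h j * indicator (I j) t) \<le> h t * indicator {l<..} t"
    proof (cases "\<exists>j. t \<in> I j")
      case True
      then obtain j where j: "t \<in> I j" by blast
      have "(\<Sum>j. ?h j * indicator (I j) t) = ?h j"
        by (rule suminf_cmult_indicator[OF disj j])
      also have "\<dots> \<le> h t" using j by (intro antimonoD[OF h]) (simp add: I_def)
      finally have "(\<Sum>j. ?h j * indicator (I j) t) \<le> h t" .
      moreover have "0 \<le> real j * \<delta>" using \<delta> by simp
      then have "l < t" using j unfolding I_def by auto
      ultimately show ?thesis by simp
    qed simp
  qed
  finally show ?thesis .
qed

lemma layer_count: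
  fixes w l \<delta> :: real
  assumes \<delta>: "0 < \<delta>" and l: "0 \<le> l" and w: "0 \<le> w" and P: "\<And>j::nat. l + real (Suc j) * \<delta> < w \<Longrightarrow> j \<in> P"
  shows "ennreal w \<le> ennreal l + ennreal \<delta> + (\<Sum>j. ennreal \<delta> * indicator P j)"
proof -
  \<comment> \<open>The number of levels l + (j + 1) \<delta> strictly below w; conversion to
    \<open>nat\<close> makes it 0 when there are none.\<close>
  define J where "J = nat (\<lceil>(w - l) / \<delta>\<rceil> - 1)"
  have "(w - l) / \<delta> \<le> real J + 1" unfolding J_def by linarith
  then have J: "w \<le> l + \<delta> + real J * \<delta>" using \<delta> by (simp add: field_simps)
  have inP: "j \<in> P" if "j < J" for j
  proof (rule P)
    have "real (Suc j) < (w - l) / \<delta>" using that unfolding J_def by linarith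
    then show "l + real (Suc j) * \<delta> < w" using \<delta> by (simp add: field_simps)
  qed
  have "ennreal w \<le> ennreal (l + \<delta> + real J * \<delta>)" using J by (rule ennreal_leI)
  also have "\<dots> = ennreal l + ennreal \<delta> + ennreal (real J * \<delta>)" using l \<delta> by simp
  also have "ennreal (real J * \<delta>) = (\<Sum>j<J. ennreal \<delta> * indicator P j)"
    using \<delta> inP by (simp add: ennreal_mult ennreal_of_nat_eq_real_of_nat)
  also have "\<dots> \<le> (\<Sum>j. ennreal \<delta> * indicator P j)" by (intro sum_le_suminf) auto
  finally show ?thesis by (simp add: add_left_mono)
qed

section \<open>Riesz potentials of functions split at a level\<close>

lemma (in ball_growth) riesz_potential_set_integral_le:
  assumes [measurable]: "g \<in> borel_measurable borel"
    and E: "E \<in> sets borel" "0 < emeasure \<nu> E" "emeasure \<nu> E < top"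
  shows "(\<integral>\<^sup>+x\<in>E. (\<integral>\<^sup>+z. g z * riesz d (z - x) \<partial>lborel) \<partial>\<nu>)
     \<le> ennreal (riesz_const * measure \<nu> E powr (1 - real d / \<alpha>)) * (\<integral>\<^sup>+z. g z \<partial>lborel)"
proof -
  interpret pair_sigma_finite \<nu> "lborel :: 'a measure" ..
  let ?C = "ennreal (riesz_const * measure \<nu> E powr (1 - real d / \<alpha>))"
  have [measurable]: "E \<in> sets \<nu>" using E by (simp add: sets_borel)
  have "(\<integral>\<^sup>+x\<in>E. (\<integral>\<^sup>+z. g z * riesz d (z - x) \<partial>lborel) \<partial>\<nu>)
      = (\<integral>\<^sup>+x. (\<integral>\<^sup>+z. g z * (riesz d (z - x) * indicator E x) \<partial>lborel) \<partial>\<nu>)"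
    by (intro nn_integral_cong) (simp add: nn_integral_multc flip: mult.assoc)
  also have "\<dots> = (\<integral>\<^sup>+z. (\<integral>\<^sup>+x. g z * (riesz d (z - x) * indicator E x) \<partial>\<nu>) \<partial>lborel)"
    by (intro Fubini'[symmetric]) measurable
  also have "\<dots> \<le> (\<integral>\<^sup>+z. ?C * g z \<partial>lborel)"
  proof (rule nn_integral_mono)
    fix z
    have "(\<integral>\<^sup>+x. g z * (riesz d (z - x) * indicator E x) \<partial>\<nu>) = g z * (\<integral>\<^sup>+x\<in>E. riesz d (x - z) \<partial>\<nu>)"
      by (subst nn_integral_cmult, measurable) (simp only: riesz_minus_commute)
    also have "\<dots> \<le> g z * ?C"
      by (intro mult_left_mono riesz_set_integral_le E) simp
    finally show "(\<integral>\<^sup>+x. g z * (riesz d (z - x) * indicator E x) \<partial>\<nu>)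
        \<le> ?C * g z"
      by (simp only: mult.commute)
  qed
  also have "\<dots> = ?C * (\<integral>\<^sup>+z. g z \<partial>lborel)"
    by (intro nn_integral_cmult) measurable
  finally show ?thesis .
qed

text \<open>For l >= 0 this is the positive part of f - l, and \<open>lower_part\<close> is the
  minimum of f and l. Both are written as integrals over levels, which avoids subtraction in
  \<open>ennreal\<close> and lets distribution functions appear by exchanging integrals.\<close>

definition upper_part :: "real \<Rightarrow> ('a \<Rightarrow> ennreal) \<Rightarrow> 'a \<Rightarrow> ennreal" where
  "upper_part l f z = (\<integral>\<^sup>+t\<in>{l<..}. indicator {t. ennreal t < f z} t \<partial>lborel)"

definition lower_part :: "real \<Rightarrow> ('a \<Rightarrow> ennreal) \<Rightarrow> 'a \<Rightarrow> ennreal" where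
  "lower_part l f z = (\<integral>\<^sup>+t\<in>{0<..l}. indicator {t. ennreal t < f z} t \<partial>lborel)"

lemma layers_sets [measurable]: "{t. ennreal t < y} \<in> sets borel"
proof -
  have "Measurable.pred borel (\<lambda>t. ennreal t < y)" by measurable
  then show ?thesis by (simp add: pred_def)
qed

lemma measurable_superlevel:
  fixes f :: "'a::euclidean_space \<Rightarrow> ennreal"
  assumes [measurable]: "f \<in> borel_measurable borel"
  shows "(\<lambda>(z, t). indicator {t. ennreal t < f z} t :: ennreal) \<in> borel_measurable (borel \<Otimes>\<^sub>M borel)"
proof -
  have "Measurable.pred (borel \<Otimes>\<^sub>M borel) (\<lambda>p. ennreal (snd p) < f (fst p))" by measurable
  then have "(\<lambda>p. indicator {p. ennreal (snd p) < f (fst p)} p :: ennreal) \<in> borel_measurable (borel \<Otimes>\<^sub>M borel)"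
    by (intro borel_measurable_indicator) (simp add: pred_def space_pair_measure)
  then show ?thesis by (simp add: indicator_def split_beta)
qed

lemma upper_part_measurable [measurable]:
  fixes f :: "'a::euclidean_space \<Rightarrow> ennreal"
  assumes [measurable]: "f \<in> borel_measurable borel"
  shows "upper_part l f \<in> borel_measurable borel"
proof -
  note measurable_superlevel[OF assms, measurable]
  show ?thesis unfolding upper_part_def[abs_def] by measurable
qed

lemma lower_part_measurable [measurable]:
  fixes f :: "'a::euclidean_space \<Rightarrow> ennreal"
  assumes [measurable]: "f \<in> borel_measurable borel"
  shows "lower_part l f \<in> borel_measurable borel"
proof -
  note measurable_superlevel[OF assms, measurable]
  show ?thesis unfolding lower_part_def[abs_def] by measurable
qed

lemma le_lower_plus_upper:
  assumes l: "0 \<le> l"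
  shows "f z \<le> lower_part l f z + upper_part l f z"
proof -
  let ?lay = "\<lambda>t. indicator {t. ennreal t < f z} t :: ennreal"
  have "f z \<le> (\<integral>\<^sup>+t\<in>{0<..}. ?lay t \<partial>lborel)"
  proof (cases "f z")
    case (real w)
    have "f z = (\<integral>\<^sup>+t. indicator {0<..<w} t \<partial>lborel)" using real by simp
    also have "\<dots> \<le> (\<integral>\<^sup>+t\<in>{0<..}. ?lay t \<partial>lborel)"
      using real by (intro nn_integral_mono) (auto simp: indicator_def ennreal_less_iff)
    finally show ?thesis .
  next
    case top
    have "(\<integral>\<^sup>+t\<in>{0<..}. ?lay t \<partial>lborel) = (\<integral>\<^sup>+t. indicator {0::real<..} t \<partial>lborel)"
      using top by (intro nn_integral_cong) (simp add: indicator_def)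
    also have "\<dots> = top"
    proof -
      have "of_nat N \<le> emeasure lborel {0::real<..}" for N
      proof -
        have "{0<..<real N} \<subseteq> {0<..}" by auto
        from emeasure_mono[OF this, of lborel] show ?thesis by (simp add: ennreal_of_nat_eq_real_of_nat)
      qed
      then have "top \<le> emeasure lborel {0::real<..}"
        unfolding ennreal_SUP_of_nat_eq_top[symmetric] by (intro SUP_least)
      then show ?thesis by (simp add: top_unique)
    qed
    finally show ?thesis by simp
  qed
  also have "\<dots> = (\<integral>\<^sup>+t. ?lay t * indicator {0<..l} t + ?lay t * indicator {l<..} t \<partial>lborel)"
    using l by (intro nn_integral_cong) (auto simp: indicator_def)
  also have "\<dots> = lower_part l f z + upper_part l f z"
    unfolding lower_part_def upper_part_def by (intro nn_integral_add) measurable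
  finally show ?thesis .
qed

abbreviation distribution_fun :: "('a::euclidean_space \<Rightarrow> ennreal) \<Rightarrow> real \<Rightarrow> ennreal" where
  "distribution_fun f t \<equiv> emeasure lborel {z. ennreal t < f z}"

lemma superlevel_sets [measurable]:
  fixes f :: "'a::euclidean_space \<Rightarrow> ennreal"
  assumes [measurable]: "f \<in> borel_measurable borel"
  shows "{z. ennreal t < f z} \<in> sets borel"
proof -
  have "Measurable.pred borel (\<lambda>z. ennreal t < f z)" by measurable
  then show ?thesis by (simp add: pred_def)
qed

lemma distribution_fun_antimono:
  fixes f :: "'a::euclidean_space \<Rightarrow> ennreal"
  assumes [measurable]: "f \<in> borel_measurable borel"
  shows "antimono (distribution_fun f)"
  by (intro antimonoI emeasure_mono) (auto intro: le_less_trans[OF ennreal_leI])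

lemma nn_integral_upper_part_le:
  fixes f :: "'a::euclidean_space \<Rightarrow> ennreal"
  assumes f[measurable]: "f \<in> borel_measurable borel" and l: "0 \<le> l"
    and S: "\<And>t. l < t \<Longrightarrow> distribution_fun f t \<le> ennreal S"
  shows "(\<integral>\<^sup>+z. upper_part l f z \<partial>lborel) \<le> (\<integral>\<^sup>+r\<in>{0..S}. decr_inverse (distribution_fun f) r \<partial>lborel)"
proof -
  note measurable_superlevel[OF f, measurable]
  let ?lay = "\<lambda>t z. indicator {t. ennreal t < f z} t * indicator {l<..} t :: ennreal"
  have "(\<integral>\<^sup>+z. upper_part l f z \<partial>lborel) = (\<integral>\<^sup>+t. (\<integral>\<^sup>+z. ?lay t z \<partial>lborel) \<partial>lborel)"
    unfolding upper_part_def by (intro lborel_pair.Fubini') measurable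
  also have "\<dots> = (\<integral>\<^sup>+t\<in>{l<..}. distribution_fun f t \<partial>lborel)"
  proof (rule nn_integral_cong)
    fix t
    have "(\<integral>\<^sup>+z. ?lay t z \<partial>lborel) = (\<integral>\<^sup>+z. indicator {l<..} t * indicator {z. ennreal t < f z} z \<partial>lborel)"
      by (intro nn_integral_cong) (auto simp: indicator_def)
    also have "\<dots> = indicator {l<..} t * distribution_fun f t" by (intro nn_integral_cmult_indicator) simp
    finally show "(\<integral>\<^sup>+z. ?lay t z \<partial>lborel) = distribution_fun f t * indicator {l<..} t"
      by (simp add: mult.commute)
  qed
  also have "\<dots> \<le> (\<integral>\<^sup>+r\<in>{0..S}. decr_inverse (distribution_fun f) r \<partial>lborel)"
    by (intro nn_integral_distribution_le distribution_fun_antimono f l S)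
  finally show ?thesis .
qed

text \<open>The estimate for sets is applied to the superlevel set at each t in (0, l] and
  integrated in t. The constant part gives l S^(1/n). In the other part the integrals are exchanged,
  and for fixed r the levels with r < h(t) have total length at most the rearrangement at r. The
  outcome is uniform in x, so the second integral of the theorem carries no power of s.\<close>

lemma riesz_lower_part_le:
  fixes f :: "'a::euclidean_space \<Rightarrow> ennreal"
  assumes n: "2 \<le> DIM('a)" and f[measurable]: "f \<in> borel_measurable borel" and l: "0 \<le> l" and S: "0 < S"
  shows "(\<integral>\<^sup>+z. lower_part l f z * riesz (DIM('a) - 1) (z - x) \<partial>lborel)
     \<le> ennreal (lborel_riesz_const DIM('a)) * (ennreal (l * S powr (1 / DIM('a)))
        + (\<integral>\<^sup>+r\<in>{S..}. ennreal (r powr (- (real DIM('a) - 1) / DIM('a))) * decr_inverse (distribution_fun f) r \<partial>lborel))"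
proof -
  note measurable_superlevel[OF f, measurable]
  let ?n = "DIM('a)" and ?h = "distribution_fun f"
  let ?K = "ennreal (lborel_riesz_const ?n)"
  let ?lay = "\<lambda>t z. indicator {t. ennreal t < f z} t * indicator {0<..l} t * riesz (?n - 1) (z - x)"
  define p where "p = (\<lambda>r::real. ennreal (r powr (- (real ?n - 1) / ?n)))"
  have [measurable]: "p \<in> borel_measurable borel" unfolding p_def by measurable
  have h: "antimono ?h" by (rule distribution_fun_antimono[OF f])
  have [measurable]: "?h \<in> borel_measurable borel" by (rule antimono_borel_measurable[OF h])
  define X where "X = (\<lambda>t r. p r * indicator {t. ennreal r < ?h t} t * indicator {S..} r * indicator {0<..l} t)"
  have [measurable]: "(\<lambda>(t, r). X t r) \<in> borel_measurable (borel \<Otimes>\<^sub>M borel)"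
    unfolding X_def split_beta using measurable_layers[OF h] by measurable
  have "(\<integral>\<^sup>+z. lower_part l f z * riesz (?n - 1) (z - x) \<partial>lborel)
      = (\<integral>\<^sup>+z. (\<integral>\<^sup>+t. ?lay t z \<partial>lborel) \<partial>lborel)"
    unfolding lower_part_def by (intro nn_integral_cong nn_integral_multc[symmetric]) measurable
  also have "\<dots> = (\<integral>\<^sup>+t. (\<integral>\<^sup>+z. ?lay t z \<partial>lborel) \<partial>lborel)"
    by (intro lborel_pair.Fubini') measurable
  also have "\<dots> \<le> (\<integral>\<^sup>+t. ?K * (ennreal (S powr (1 / ?n)) * indicator {0<..l} t + (\<integral>\<^sup>+r. X t r \<partial>lborel)) \<partial>lborel)"
  proof (rule nn_integral_mono)
    fix t
    have "(\<integral>\<^sup>+z. ?lay t z \<partial>lborel)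
        = (\<integral>\<^sup>+z\<in>{z. ennreal t < f z}. riesz (?n - 1) (z - x) \<partial>lborel) * indicator {0<..l} t"
      by (subst nn_integral_multc[symmetric], measurable) (intro nn_integral_cong, auto simp: indicator_def)
    also have "\<dots> \<le> (?K * (ennreal (S powr (1 / ?n)) + (\<integral>\<^sup>+r\<in>{S..}. p r * indicator {r. ennreal r < ?h t} r \<partial>lborel))) * indicator {0<..l} t"
      unfolding p_def by (intro mult_right_mono lborel_riesz_set_integral_le n S) auto
    also have "\<dots> = ?K * (ennreal (S powr (1 / ?n)) * indicator {0<..l} t + (\<integral>\<^sup>+r. X t r \<partial>lborel))"
    proof (cases "t \<in> {0<..l}")
      case True
      have "(\<integral>\<^sup>+r\<in>{S..}. p r * indicator {r. ennreal r < ?h t} r \<partial>lborel) = (\<integral>\<^sup>+r. X t r \<partial>lborel)"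
        using True by (intro nn_integral_cong) (simp add: X_def indicator_def)
      then show ?thesis using True by simp
    qed (simp add: X_def)
    finally show "(\<integral>\<^sup>+z. ?lay t z \<partial>lborel)
        \<le> ?K * (ennreal (S powr (1 / ?n)) * indicator {0<..l} t + (\<integral>\<^sup>+r. X t r \<partial>lborel))" .
  qed
  also have "\<dots> = ?K * ((\<integral>\<^sup>+t. ennreal (S powr (1 / ?n)) * indicator {0<..l} t \<partial>lborel) + (\<integral>\<^sup>+t. (\<integral>\<^sup>+r. X t r \<partial>lborel) \<partial>lborel))"
    by (subst nn_integral_cmult, measurable, subst nn_integral_add, measurable)
  also have "(\<integral>\<^sup>+t. ennreal (S powr (1 / ?n)) * indicator {0<..l} t \<partial>lborel) = ennreal (l * S powr (1 / ?n))"
    using l by (subst nn_integral_cmult_indicator) (auto simp: ennreal_mult[symmetric] mult.commute)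
  also have "(\<integral>\<^sup>+t. (\<integral>\<^sup>+r. X t r \<partial>lborel) \<partial>lborel) = (\<integral>\<^sup>+r. (\<integral>\<^sup>+t. X t r \<partial>lborel) \<partial>lborel)"
    by (intro lborel_pair.Fubini') measurable
  also have "\<dots> \<le> (\<integral>\<^sup>+r\<in>{S..}. p r * decr_inverse ?h r \<partial>lborel)"
  proof (rule nn_integral_mono)
    fix r
    have "(\<integral>\<^sup>+t. X t r \<partial>lborel) \<le> (\<integral>\<^sup>+t. p r * indicator {S..} r * (indicator {t. ennreal r < ?h t} t * indicator {0<..} t) \<partial>lborel)"
      by (intro nn_integral_mono) (auto simp: X_def indicator_def)
    also have "\<dots> = p r * indicator {S..} r * (\<integral>\<^sup>+t\<in>{0<..}. indicator {t. ennreal r < ?h t} t \<partial>lborel)"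
      by (intro nn_integral_cmult) measurable
    also have "\<dots> \<le> p r * indicator {S..} r * decr_inverse ?h r"
      by (intro mult_left_mono nn_integral_upper_layers_le h) auto
    finally show "(\<integral>\<^sup>+t. X t r \<partial>lborel) \<le> p r * decr_inverse ?h r * indicator {S..} r"
      by (simp only: mult_ac)
  qed
  finally show ?thesis unfolding p_def by (simp add: add_left_mono mult_left_mono)
qed

section \<open>The estimate averaged over a set\<close>

lemma hausdorff_superlevel_antimono: "antimono (\<lambda>t. hausdorff_outer d {y \<in> F. t < norm (u y)})"
proof (rule antimonoI)
  fix s t :: real assume "s \<le> t"
  then have "{y \<in> F. t < norm (u y)} \<subseteq> {y \<in> F. s < norm (u y)}" by auto
  then show "hausdorff_outer d {y \<in> F. t < norm (u y)} \<le> hausdorff_outer d {y \<in> F. s < norm (u y)}"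
    unfolding hausdorff_outer_def by (intro SUP_mono) (auto intro: hausdorff_pre_mono)
qed

text \<open>Below the truncation levels \<open>lf\<close> and \<open>lg\<close> the bounds are
  uniform in x, so integration over \<open>E\<close> merely multiplies them by m. Above them the
  integration is done first, and the kernel estimate for \<nu> gives the factor P = m^(1 -
  d/\<alpha>) in front of an L^1 type quantity.\<close>

lemma set_averaged_estimate:
  fixes u :: "real^'n \<Rightarrow> real^'n" and f :: "real^'n \<Rightarrow> ennreal" and \<nu> :: "(real^'n) measure"
  assumes n: "2 \<le> CARD('n)"
    and \<nu>: "ball_growth \<nu> (CARD('n) - 1) \<alpha> M"
    and \<Omega>: "open \<Omega>" and u: "u \<in> L1_loc \<Omega>" "u \<in> Cb_closure \<Omega>" and G: "has_sym_grad \<Omega> u G"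
    and f[measurable]: "f \<in> borel_measurable borel"
    and Gf: "AE z in lborel. z \<in> \<Omega> \<longrightarrow> ennreal (norm (G z)) \<le> f z"
    and E: "E \<in> sets borel" "E \<subseteq> \<Omega>" "0 < emeasure \<nu> E" "emeasure \<nu> E < top"
    and t: "\<And>x. x \<in> E \<Longrightarrow> t \<le> norm (u x)"
    and lf: "0 \<le> lf" and S: "0 < S" and hf: "\<And>t. lf < t \<Longrightarrow> distribution_fun f t \<le> ennreal S"
    and lg: "0 \<le> lg" and hg: "\<And>t. lg < t \<Longrightarrow> hausdorff_outer (CARD('n) - 1) {y \<in> frontier \<Omega>. t < norm (u y)} \<le> ennreal \<sigma>"
  defines "m \<equiv> measure \<nu> E" and "P \<equiv> measure \<nu> E powr (1 - real (CARD('n) - 1) / \<alpha>)"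
    and "K \<equiv> ball_growth.riesz_const (CARD('n) - 1) \<alpha> M"
    and "Ksh \<equiv> ball_growth.shadow_growth_const TYPE(real^'n) (CARD('n) - 1) \<alpha> M"
  shows "ennreal (unit_ball_vol CARD('n)) * ennreal t * ennreal m \<le>
     ennreal (pointwise_const CARD('n)) *
       (ennreal (K * P) * (\<integral>\<^sup>+r\<in>{0..S}. decr_inverse (distribution_fun f) r \<partial>lborel)
        + ennreal (lborel_riesz_const CARD('n)) * (ennreal (lf * S powr (1 / CARD('n)))
           + (\<integral>\<^sup>+r\<in>{S..}. ennreal (r powr (- (real CARD('n) - 1) / CARD('n))) * decr_inverse (distribution_fun f) r \<partial>lborel)) * ennreal m)
     + 3 * (ennreal lg * emeasure lborel (annulus :: (real^'n) set) * ennreal m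
        + ennreal (Ksh * P) * (\<integral>\<^sup>+r\<in>{0..\<sigma>}. decr_inverse (\<lambda>t. hausdorff_outer (CARD('n) - 1) {y \<in> frontier \<Omega>. t < norm (u y)}) r \<partial>lborel))"
    (is "?L \<le> ?R")
proof -
  interpret ball_growth \<nu> "CARD('n) - 1" \<alpha> M by (rule \<nu>)
  let ?d = "CARD('n) - 1" and ?Cp = "ennreal (pointwise_const CARD('n))"
  let ?A = "annulus :: (real^'n) set" and ?\<omega> = "ennreal (unit_ball_vol CARD('n))"
  let ?a = "emeasure lborel (annulus :: (real^'n) set)"
  have [measurable]: "E \<in> sets \<nu>" using E by (simp add: sets_borel)
  have em: "emeasure \<nu> E = ennreal m" using E by (simp add: m_def emeasure_eq_ennreal_measure)
  have [measurable]: "?A \<in> sets borel"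
    by (intro borel_closed closed_Collect_conj closed_Collect_le continuous_intros)
  define hg where "hg = (\<lambda>t. hausdorff_outer ?d {y \<in> frontier \<Omega>. t < norm (u y)})"
  have hg_anti: "antimono hg" unfolding hg_def by (rule hausdorff_superlevel_antimono)
  define If where "If = (\<integral>\<^sup>+r\<in>{0..S}. decr_inverse (distribution_fun f) r \<partial>lborel)"
  define Jf where "Jf = ennreal (lf * S powr (1 / CARD('n)))
           + (\<integral>\<^sup>+r\<in>{S..}. ennreal (r powr (- (real CARD('n) - 1) / CARD('n))) * decr_inverse (distribution_fun f) r \<partial>lborel)"
  define Ig where "Ig = (\<integral>\<^sup>+r\<in>{0..\<sigma>}. decr_inverse hg r \<partial>lborel)"
  define U where "U = (\<lambda>x. \<integral>\<^sup>+z. upper_part lf f z * riesz ?d (z - x) \<partial>lborel)"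
  have [measurable]: "U \<in> borel_measurable borel" unfolding U_def by measurable
  let ?Kl = "ennreal (lborel_riesz_const CARD('n))"
  have potential: "(\<integral>\<^sup>+z. f z * riesz ?d (z - x) \<partial>lborel) \<le> ?Kl * Jf + U x" for x
  proof -
    have "(\<integral>\<^sup>+z. f z * riesz ?d (z - x) \<partial>lborel)
        \<le> (\<integral>\<^sup>+z. lower_part lf f z * riesz ?d (z - x) + upper_part lf f z * riesz ?d (z - x) \<partial>lborel)"
      unfolding distrib_right[symmetric] by (intro nn_integral_mono mult_right_mono le_lower_plus_upper lf) simp
    also have "\<dots> = (\<integral>\<^sup>+z. lower_part lf f z * riesz ?d (z - x) \<partial>lborel) + U x"
      unfolding U_def by (intro nn_integral_add) measurable
    also have "(\<integral>\<^sup>+z. lower_part lf f z * riesz ?d (z - x) \<partial>lborel) \<le> ?Kl * Jf"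
      using riesz_lower_part_le[of f lf S x] n lf S by (simp add: Jf_def)
    finally show ?thesis by (simp add: add_right_mono)
  qed
  have U_int: "(\<integral>\<^sup>+x\<in>E. U x \<partial>\<nu>) \<le> ennreal (K * P) * If"
  proof -
    have "(\<integral>\<^sup>+x\<in>E. U x \<partial>\<nu>) \<le> ennreal (K * P) * (\<integral>\<^sup>+z. upper_part lf f z \<partial>lborel)"
      unfolding U_def K_def P_def using E by (intro riesz_potential_set_integral_le) auto
    also have "\<dots> \<le> ennreal (K * P) * If"
      unfolding If_def by (intro mult_left_mono nn_integral_upper_part_le f lf hf) auto
    finally show ?thesis .
  qed
  have main: "?L \<le> ?Cp * (ennreal (K * P) * If + ?Kl * Jf * ennreal m)
      + 3 * (ennreal lg * ?a * ennreal m + ennreal (Ksh * P) * Ig)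
      + 3 * ennreal \<delta> * ?a * ennreal m" if \<delta>: "0 < \<delta>" for \<delta>
  proof -
    let ?l = "ennreal lg + ennreal \<delta>"
    \<comment> \<open>The levels start at lg + \<delta>, strictly above lg, so each of these sets
      has Hausdorff outer measure at most \<sigma>. This is the finiteness that the covering
      argument needs.\<close>
    define Gs where "Gs = (\<lambda>j::nat. {y \<in> frontier \<Omega>. lg + real (Suc j) * \<delta> < norm (u y)})"
    let ?H = "\<lambda>j. hausdorff_outer ?d (Gs j)"
    define shadows where "shadows = (\<lambda>j Q. Q \<in> sets (borel :: ((real^'n) \<times> (real^'n)) measure) \<and>
      (\<forall>x v s. 0 < s \<longrightarrow> x + s *\<^sub>R v \<in> Gs j \<longrightarrow> (x, v) \<in> Q) \<and>
      (\<integral>\<^sup>+x\<in>E. emeasure lborel {v \<in> ?A. (x, v) \<in> Q} \<partial>\<nu>) \<le> ennreal (Ksh * P) * ?H j)"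
    have "\<exists>Q. shadows j Q" for j
    proof -
      have "0 < real (Suc j) * \<delta>" using \<delta> by simp
      then have "?H j \<le> ennreal \<sigma>" unfolding Gs_def by (intro hg) linarith
      then have fin: "?H j < top" by (rule le_less_trans) simp
      show ?thesis
      proof (rule shadow_cover[OF _ _ fin])
        fix Q :: "((real^'n) \<times> (real^'n)) set"
        assume "Q \<in> sets borel" "\<And>x v s. 0 < s \<Longrightarrow> x + s *\<^sub>R v \<in> Gs j \<Longrightarrow> (x, v) \<in> Q"
          and *: "\<And>E. E \<in> sets borel \<Longrightarrow> 0 < emeasure \<nu> E \<Longrightarrow> emeasure \<nu> E < top \<Longrightarrow>
            (\<integral>\<^sup>+x\<in>E. emeasure lborel {v \<in> annulus. (x, v) \<in> Q} \<partial>\<nu>)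
              \<le> ennreal (shadow_growth_const * measure \<nu> E powr (1 - real ?d / \<alpha>)) * ?H j"
        then show ?thesis
          using *[OF E(1,3,4)] unfolding shadows_def Ksh_def P_def by blast
      qed (use n in simp_all)
    qed
    then obtain Q where "\<And>j. shadows j (Q j)" by metis
    then have Q[measurable]: "\<And>j. Q j \<in> sets borel"
      and Qs: "\<And>j x v s. 0 < s \<Longrightarrow> x + s *\<^sub>R v \<in> Gs j \<Longrightarrow> (x, v) \<in> Q j"
      and Qi: "\<And>j. (\<integral>\<^sup>+x\<in>E. emeasure lborel {v \<in> ?A. (x, v) \<in> Q j} \<partial>\<nu>) \<le> ennreal (Ksh * P) * ?H j"
      unfolding shadows_def by blast+
    \<comment> \<open>A step function in place of the boundary value hit by the ray: it counts the
      levels whose shadows contain (x, v). Unlike that value it is clearly measurable in v, and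
      \<open>layer_count\<close> shows that it dominates.\<close>
    define b where "b = (\<lambda>x v. ennreal lg + ennreal \<delta> + (\<Sum>j. ennreal \<delta> * indicator (Q j) (x, v)))"
    define q where "q = (\<lambda>j x. emeasure lborel {v \<in> ?A. (x, v) \<in> Q j})"
    have q[measurable]: "q j \<in> borel_measurable borel" for j
      unfolding q_def by (rule annulus_section_measurable[OF Q])
    have Qind[measurable]: "(\<lambda>v. indicator (Q j) (x, v) :: ennreal) \<in> borel_measurable borel" for j x
    proof -
      have "Q j \<in> sets (borel \<Otimes>\<^sub>M borel)" using Q[of j] by (simp only: borel_prod)
      then have "Pair x -` Q j \<in> sets borel" by (rule sets_Pair1)
      then have "(indicator (Pair x -` Q j) :: _ \<Rightarrow> ennreal) \<in> borel_measurable borel" by measurable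
      then show ?thesis by (simp add: indicator_def)
    qed
    have b_meas: "b x \<in> borel_measurable borel" for x unfolding b_def by measurable
    let ?Y = "\<lambda>j x. \<integral>\<^sup>+v. ennreal \<delta> * (indicator (Q j) (x, v) * indicator ?A v) \<partial>lborel"
    have b_int: "(\<integral>\<^sup>+v\<in>?A. b x v \<partial>lborel) = ?l * ?a + (\<Sum>j. ennreal \<delta> * q j x)" for x
    proof -
      have "(\<integral>\<^sup>+v\<in>?A. b x v \<partial>lborel)
          = (\<integral>\<^sup>+v. ?l * indicator ?A v + (\<Sum>j. ennreal \<delta> * (indicator (Q j) (x, v) * indicator ?A v)) \<partial>lborel)"
        by (intro nn_integral_cong) (auto simp: b_def indicator_def)
      also have "\<dots> = (\<integral>\<^sup>+v. ?l * indicator ?A v \<partial>lborel)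
          + (\<Sum>j. ?Y j x)"
        by (subst nn_integral_add, measurable, subst nn_integral_suminf, measurable)
      also have "(\<integral>\<^sup>+v. ?l * indicator ?A v \<partial>lborel) = ?l * ?a"
        by (intro nn_integral_cmult_indicator) simp
      also have "(\<Sum>j. ?Y j x) = (\<Sum>j. ennreal \<delta> * q j x)"
      proof (rule suminf_cong)
        fix j
        have "?Y j x
            = (\<integral>\<^sup>+v. ennreal \<delta> * indicator {v \<in> ?A. (x, v) \<in> Q j} v \<partial>lborel)"
          by (intro nn_integral_cong) (auto simp: indicator_def)
        also have "\<dots> = ennreal \<delta> * q j x"
          unfolding q_def using annulus_section_measurable(1)[OF Q[of j], of x] by (intro nn_integral_cmult_indicator) simp
        finally show "?Y j x = ennreal \<delta> * q j x" .
      qed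
      finally show ?thesis .
    qed
    let ?q = "\<lambda>j. \<integral>\<^sup>+x\<in>E. q j x \<partial>\<nu>"
    have pw: "?\<omega> * ennreal t \<le> ?Cp * (?Kl * Jf + U x) + 3 * (?l * ?a + (\<Sum>j. ennreal \<delta> * q j x))"
      if x: "x \<in> E" for x
    proof -
      have "?\<omega> * ennreal t \<le> ?\<omega> * ennreal (norm (u x))"
        using t[OF x] by (intro mult_left_mono ennreal_leI) auto
      also have "\<dots> \<le> ?Cp * (\<integral>\<^sup>+z. f z * riesz ?d (z - x) \<partial>lborel) + 3 * (\<integral>\<^sup>+v\<in>?A. b x v \<partial>lborel)"
      proof (rule pointwise_estimate[OF n \<Omega> u G f Gf _ b_meas])
        show "x \<in> \<Omega>" using x E by auto
        fix s v assume s: "0 < s" "x + s *\<^sub>R v \<in> frontier \<Omega>"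
        have "ennreal (norm (u (x + s *\<^sub>R v))) \<le> ennreal lg + ennreal \<delta> + (\<Sum>j. ennreal \<delta> * indicator {j. (x, v) \<in> Q j} j)"
          using s by (intro layer_count \<delta> lg) (auto intro!: Qs simp: Gs_def)
        then show "ennreal (norm (u (x + s *\<^sub>R v))) \<le> b x v" by (simp add: b_def indicator_def)
      qed
      also have "\<dots> \<le> ?Cp * (?Kl * Jf + U x) + 3 * (?l * ?a + (\<Sum>j. ennreal \<delta> * q j x))"
        unfolding b_int by (intro add_right_mono mult_left_mono potential) simp
      finally show ?thesis .
    qed
    have "?L = (\<integral>\<^sup>+x. ?\<omega> * ennreal t * indicator E x \<partial>\<nu>)"
      by (simp add: nn_integral_cmult_indicator em)
    also have "\<dots> \<le> (\<integral>\<^sup>+x. ?Cp * (U x * indicator E x)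
        + (?Cp * (?Kl * Jf) + 3 * (?l * ?a)) * indicator E x
        + 3 * (\<Sum>j. ennreal \<delta> * (q j x * indicator E x)) \<partial>\<nu>)"
    proof (rule nn_integral_mono)
      fix x
      show "?\<omega> * ennreal t * indicator E x \<le> ?Cp * (U x * indicator E x)
        + (?Cp * (?Kl * Jf) + 3 * (?l * ?a)) * indicator E x
        + 3 * (\<Sum>j. ennreal \<delta> * (q j x * indicator E x))"
      proof (cases "x \<in> E")
        case True
        show ?thesis using pw[OF True] True by (simp add: distrib_left add_ac)
      qed simp
    qed
    also have "\<dots> = ?Cp * (\<integral>\<^sup>+x\<in>E. U x \<partial>\<nu>)
        + (?Cp * (?Kl * Jf) + 3 * (?l * ?a)) * ennreal m
        + 3 * (\<Sum>j. ennreal \<delta> * ?q j)"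
    proof -
      have 1: "(\<integral>\<^sup>+x. ?Cp * (U x * indicator E x) \<partial>\<nu>) = ?Cp * (\<integral>\<^sup>+x\<in>E. U x \<partial>\<nu>)"
        by (intro nn_integral_cmult) measurable
      have 2: "(\<integral>\<^sup>+x. c * indicator E x \<partial>\<nu>) = c * ennreal m" for c
        by (simp add: nn_integral_cmult_indicator em)
      have 3: "(\<integral>\<^sup>+x. 3 * (\<Sum>j. ennreal \<delta> * (q j x * indicator E x)) \<partial>\<nu>) = 3 * (\<Sum>j. ennreal \<delta> * ?q j)"
        by (subst nn_integral_cmult, measurable, subst nn_integral_suminf, measurable, subst nn_integral_cmult, measurable)
      show ?thesis
        by (subst nn_integral_add, measurable, subst nn_integral_add, measurable) (simp only: 1 2 3)
    qed
    also have "\<dots> \<le> ?Cp * (ennreal (K * P) * If)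
        + (?Cp * (?Kl * Jf) + 3 * (?l * ?a)) * ennreal m
        + 3 * (ennreal (Ksh * P) * Ig)"
    proof (intro add_mono mult_left_mono U_int order_refl)
      have "(\<Sum>j. ennreal \<delta> * ?q j) \<le> (\<Sum>j. ennreal (Ksh * P) * (ennreal \<delta> * hg (lg + real (Suc j) * \<delta>)))"
      proof (intro suminf_le)
        fix j
        have "ennreal \<delta> * ?q j \<le> ennreal \<delta> * (ennreal (Ksh * P) * ?H j)"
          unfolding q_def by (intro mult_left_mono Qi) simp
        then show "ennreal \<delta> * ?q j \<le> ennreal (Ksh * P) * (ennreal \<delta> * hg (lg + real (Suc j) * \<delta>))"
          unfolding hg_def Gs_def by (simp only: mult.left_commute)
      qed auto
      also have "\<dots> = ennreal (Ksh * P) * (\<Sum>j. ennreal \<delta> * hg (lg + real (Suc j) * \<delta>))"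
        by (rule ennreal_suminf_cmult)
      also have "\<dots> \<le> ennreal (Ksh * P) * Ig"
      proof (intro mult_left_mono)
        have "(\<Sum>j. ennreal \<delta> * hg (lg + real (Suc j) * \<delta>)) \<le> (\<integral>\<^sup>+t\<in>{lg<..}. hg t \<partial>lborel)"
          by (rule suminf_layers_le[OF hg_anti \<delta>])
        also have "\<dots> \<le> Ig"
          unfolding Ig_def using hg by (intro nn_integral_distribution_le hg_anti lg) (simp add: hg_def)
        finally show "(\<Sum>j. ennreal \<delta> * hg (lg + real (Suc j) * \<delta>)) \<le> Ig" .
      qed simp
      finally show "(\<Sum>j. ennreal \<delta> * ?q j) \<le> ennreal (Ksh * P) * Ig" .
    qed simp_all
    also have "\<dots> = ?Cp * (ennreal (K * P) * If + ?Kl * Jf * ennreal m)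
      + 3 * (ennreal lg * ?a * ennreal m + ennreal (Ksh * P) * Ig)
      + 3 * ennreal \<delta> * ?a * ennreal m"
      by (simp only: distrib_left distrib_right mult.assoc add_ac)
    finally show ?thesis .
  qed
  \<comment> \<open>The mesh \<delta> survives only in a term proportional to the finite measures of
    the annulus and of \<open>E\<close>, and can be sent to 0.\<close>
  have "?L \<le> ?Cp * (ennreal (K * P) * If + ?Kl * Jf * ennreal m)
      + 3 * (ennreal lg * ?a * ennreal m + ennreal (Ksh * P) * Ig)"
  proof (rule ennreal_le_epsilon)
    fix e :: real assume e: "0 < e"
    define a where "a = enn2real (?a)"
    have a: "?a = ennreal a" "0 \<le> a"
      using emeasure_annulus_finite[where 'a = "real^'n"] by (auto simp: a_def)
    have m: "0 \<le> m" by (simp add: m_def)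
    define \<delta> where "\<delta> = e / (3 * (a * m + 1))"
    have am: "0 < a * m + 1" using a m by (simp add: add_nonneg_pos)
    have \<delta>: "0 < \<delta>" using e am by (simp add: \<delta>_def)
    have "3 * ennreal \<delta> * ?a * ennreal m = ennreal 3 * ennreal \<delta> * ennreal a * ennreal m"
      by (simp add: a)
    also have "\<dots> = ennreal (3 * \<delta> * a * m)"
      using \<delta> a m by (simp only: ennreal_mult'' ennreal_mult' mult_nonneg_nonneg less_imp_le zero_le_numeral)
    also have "\<dots> \<le> ennreal e"
    proof (rule ennreal_leI)
      have "3 * \<delta> * a * m = e * ((a * m) / (a * m + 1))" using am by (simp add: \<delta>_def field_simps)
      also have "\<dots> \<le> e * 1" using e am by (intro mult_left_mono) auto
      finally show "3 * \<delta> * a * m \<le> e" by simp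
    qed
    finally have "3 * ennreal \<delta> * ?a * ennreal m \<le> ennreal e" .
    with main[OF \<delta>] show "?L \<le> ?Cp * (ennreal (K * P) * If + ?Kl * Jf * ennreal m)
      + 3 * (ennreal lg * ?a * ennreal m + ennreal (Ksh * P) * Ig) + ennreal e"
      by (meson add_left_mono order_trans)
  qed
  then show ?thesis unfolding If_def Jf_def Ig_def hg_def .
qed

section \<open>From the averaged estimate to rearrangements\<close>

lemma decr_inverse_cong:
  assumes "\<And>t. 0 \<le> t \<Longrightarrow> h t = h' t"
  shows "decr_inverse h = decr_inverse h'"
  using assms by (auto simp: decr_inverse_def fun_eq_iff intro!: arg_cong[where f = Inf] image_cong)

lemma superlevel_borel:
  fixes g :: "'a::topological_space \<Rightarrow> real"
  assumes F: "F \<in> sets borel" and g: "continuous_on F g"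
  shows "{x \<in> F. t < g x} \<in> sets borel"
proof -
  obtain A where "open A" "A \<inter> F = g -` {t<..} \<inter> F"
    using g open_greaterThan[of t] unfolding continuous_on_open_invariant by blast
  moreover have "{x \<in> F. t < g x} = g -` {t<..} \<inter> F" by auto
  ultimately show ?thesis using F by (metis borel_open sets.Int)
qed

text \<open>Local integrability gives measurability on compact subsets only; a countable exhaustion
  of \<Omega> by compact sets yields it globally.\<close>

lemma L1_loc_norm_measurable:
  fixes G :: "real^'n \<Rightarrow> 'b::euclidean_space"
  assumes \<Omega>: "open \<Omega>" and G: "G \<in> L1_loc \<Omega>"
  shows "(\<lambda>x. ennreal (norm (G x)) * indicator \<Omega> x) \<in> borel_measurable lebesgue"
proof -
  obtain C :: "nat \<Rightarrow> (real^'n) set" where C: "\<And>m. compact (C m)" "\<And>m. C m \<subseteq> \<Omega>" "\<Union>(range C) = \<Omega>"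
    using open_Union_compact_subsets[OF \<Omega>] by metis
  have "(\<lambda>x. ennreal (norm (G x)) * indicator (C m) x) \<in> borel_measurable lebesgue" for m
  proof -
    have s: "C m \<inter> space lebesgue \<in> sets lebesgue" using C(1)[of m] by (auto intro: lmeasurable_compact fmeasurableD)
    have "integrable (lebesgue_on (C m)) G" using G C(1,2)[of m] by (simp add: L1_loc_def)
    then have "G \<in> borel_measurable (lebesgue_on (C m))" by (rule borel_measurable_integrable)
    then have "(\<lambda>x. ennreal (norm (G x))) \<in> borel_measurable (lebesgue_on (C m))" by measurable
    then show ?thesis using s by (subst (asm) borel_measurable_restrict_space_iff_ennreal)
  qed
  then have "(\<lambda>x. SUP m. ennreal (norm (G x)) * indicator (C m) x) \<in> borel_measurable lebesgue"
    by (intro borel_measurable_SUP) auto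
  moreover have "(SUP m. ennreal (norm (G x)) * indicator (C m) x) = ennreal (norm (G x)) * indicator \<Omega> x" for x
  proof (cases "x \<in> \<Omega>")
    case True
    then obtain m where m: "x \<in> C m" using C by blast
    have "ennreal (norm (G x)) \<le> (SUP m. ennreal (norm (G x)) * indicator (C m) x)"
      using m by (intro SUP_upper2[of m]) auto
    moreover have "(SUP m. ennreal (norm (G x)) * indicator (C m) x) \<le> ennreal (norm (G x))"
      by (intro SUP_least) (simp add: indicator_def)
    ultimately show ?thesis using True by simp
  next
    case False
    then have "x \<notin> C m" for m using C by blast
    then show ?thesis using False by simp
  qed
  ultimately show ?thesis by simp
qed

lemma emeasure_distr_restrict:
  fixes \<mu> :: "'a::topological_space measure"
  assumes \<mu>: "sets \<mu> = sets (restrict_space borel \<Omega>)" and A: "A \<in> sets borel"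
  shows "emeasure (distr \<mu> borel (\<lambda>x. x)) A = emeasure \<mu> (A \<inter> \<Omega>)"
proof -
  have sp: "space \<mu> = \<Omega>" using sets_eq_imp_space_eq[OF \<mu>] by (simp add: space_restrict_space)
  have "(\<lambda>x. x) \<in> measurable (restrict_space borel \<Omega>) borel" by (intro measurable_restrict_space1) simp
  then have id: "(\<lambda>x. x) \<in> measurable \<mu> borel" using \<mu> by (simp cong: measurable_cong_sets)
  show ?thesis using emeasure_distr[OF id A] by (simp add: sp)
qed

text \<open>The hypothesis speaks of centres in \<Omega>. A ball about any y that meets \<Omega> in
  a point x lies in the ball of twice the radius about x, whence the factor 2^\<alpha>. Pushing
  \<mu> forward by the identity extends it by zero to the Borel sets of the whole space.\<close>

lemma ball_growth_distr:
  fixes \<mu> :: "'a::euclidean_space measure"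
  assumes \<Omega>: "open \<Omega>" and \<mu>: "sets \<mu> = sets (restrict_space borel \<Omega>)"
    and growth: "\<And>x r. x \<in> \<Omega> \<Longrightarrow> 0 < r \<Longrightarrow> emeasure \<mu> (ball x r \<inter> \<Omega>) \<le> ennreal (C * r powr \<alpha>)"
    and d: "1 \<le> d" "real d < \<alpha>" and C: "0 < C"
  shows "ball_growth (distr \<mu> borel (\<lambda>x. x)) d \<alpha> (C * 2 powr \<alpha>)"
proof -
  note em = emeasure_distr_restrict[OF \<mu>]
  show "ball_growth (distr \<mu> borel (\<lambda>x. x)) d \<alpha> (C * 2 powr \<alpha>)"
  proof
    fix y :: 'a and r :: real assume r: "0 < r"
    show "emeasure (distr \<mu> borel (\<lambda>x. x)) (ball y r) \<le> ennreal (C * 2 powr \<alpha> * r powr \<alpha>)"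
    proof (cases "ball y r \<inter> \<Omega> = {}")
      case False
      then obtain x where x: "x \<in> ball y r" "x \<in> \<Omega>" by blast
      have "ball y r \<inter> \<Omega> \<subseteq> ball x (2 * r) \<inter> \<Omega>"
      proof
        fix z assume z: "z \<in> ball y r \<inter> \<Omega>"
        then have "dist x z < 2 * r" using x dist_triangle_less_add[of x y r z r] by (simp add: dist_commute)
        with z show "z \<in> ball x (2 * r) \<inter> \<Omega>" by simp
      qed
      then have "emeasure \<mu> (ball y r \<inter> \<Omega>) \<le> emeasure \<mu> (ball x (2 * r) \<inter> \<Omega>)"
        by (rule emeasure_mono) (auto simp: \<mu> sets_restrict_space)
      also have "\<dots> \<le> ennreal (C * (2 * r) powr \<alpha>)" using growth[OF x(2), of "2 * r"] r by simp
      finally show ?thesis using r by (simp add: em powr_mult mult.assoc)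
    qed (simp add: em)
  qed (use d C in auto)
qed

text \<open>By contradiction: a level t strictly between the two sides has a superlevel set of
  \<mu>-measure above s, while the averaged estimate on a piece of it forces t below the right side.
  Division by the volume of the unit ball in \<open>c\<^sub>0\<close> undoes the factor on the left
  of that estimate.\<close>

lemma rearrangement_estimate:
  fixes u :: "real^'n \<Rightarrow> real^'n" and \<mu> :: "(real^'n) measure"
  assumes n: "2 \<le> CARD('n)" and \<alpha>: "real CARD('n) - 1 < \<alpha>" and C: "0 < C"
    and \<Omega>: "open \<Omega>" and \<mu>: "sets \<mu> = sets (restrict_space borel \<Omega>)"
    and growth: "\<And>x r. x \<in> \<Omega> \<Longrightarrow> 0 < r \<Longrightarrow> emeasure \<mu> (ball x r \<inter> \<Omega>) \<le> ennreal (C * r powr \<alpha>)"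
    and u: "u \<in> L1_loc \<Omega>" "u \<in> Cb_closure \<Omega>" and G: "has_sym_grad \<Omega> u G" and s: "0 < s"
  defines "M \<equiv> C * 2 powr \<alpha>"
  defines "c\<^sub>0 \<equiv> (pointwise_const CARD('n) * (ball_growth.riesz_const (CARD('n) - 1) \<alpha> M + lborel_riesz_const CARD('n))
      + 3 * (measure lborel (annulus :: (real^'n) set) + ball_growth.shadow_growth_const TYPE(real^'n) (CARD('n) - 1) \<alpha> M))
      / unit_ball_vol CARD('n)"
  assumes C': "c\<^sub>0 \<le> C'" "0 < C'"
  shows "decr_rearr \<mu> u s \<le> ennreal C' *
     (ennreal (s powr (- (real CARD('n) - 1) / \<alpha>)) *
        (\<integral>\<^sup>+r\<in>{0..s powr (real CARD('n) / \<alpha>)}. decr_rearr (lebesgue_on \<Omega>) G r \<partial>lborel)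
      + (\<integral>\<^sup>+r\<in>{s powr (real CARD('n) / \<alpha>)..}.
          ennreal (r powr (- (real CARD('n) - 1) / real CARD('n))) * decr_rearr (lebesgue_on \<Omega>) G r \<partial>lborel)
      + ennreal (s powr (- (real CARD('n) - 1) / \<alpha>)) *
        (\<integral>\<^sup>+r\<in>{0..s powr ((real CARD('n) - 1) / \<alpha>)}.
          decr_rearr (restrict_space (hausdorff_measure (CARD('n) - 1)) (frontier \<Omega>)) u r \<partial>lborel))"
proof -
  let ?n = "real CARD('n)" and ?d = "CARD('n) - 1"
  have d: "real ?d = ?n - 1" using n by simp
  have \<alpha>pos: "0 < \<alpha>" using \<alpha> n by linarith
  define \<nu> where "\<nu> = distr \<mu> borel (\<lambda>x. x)"
  have dax: "1 \<le> ?d" "real ?d < \<alpha>" using n \<alpha> d by auto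
  have \<nu>_eq: "emeasure \<nu> A = emeasure \<mu> (A \<inter> \<Omega>)" if "A \<in> sets borel" for A
    unfolding \<nu>_def by (rule emeasure_distr_restrict[OF \<mu> that])
  have bg: "ball_growth \<nu> ?d \<alpha> M"
    unfolding \<nu>_def M_def by (rule ball_growth_distr[OF \<Omega> \<mu> growth dax C])
  interpret ball_growth \<nu> ?d \<alpha> M by (rule bg)
  have sp: "space \<mu> = \<Omega>" using sets_eq_imp_space_eq[OF \<mu>] by (simp add: space_restrict_space)
  have ucl: "continuous_on (closure \<Omega>) u" using u by (simp add: Cb_closure_def)

  have GL: "G \<in> L1_loc \<Omega>" using G by (simp add: has_sym_grad_def)
  \<comment> \<open>The norm of \<open>G\<close>, extended by zero outside \<Omega>, is only
    Lebesgue measurable; a Borel representative has the same rearrangement and is suited to product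
    measures.\<close>
  obtain f :: "real^'n \<Rightarrow> ennreal" where f[measurable]: "f \<in> borel_measurable borel"
    and fG: "AE z in lborel. ennreal (norm (G z)) * indicator \<Omega> z = f z"
    using completion_ex_borel_measurable[OF L1_loc_norm_measurable[OF \<Omega> GL]] by auto
  have Gf: "AE z in lborel. z \<in> \<Omega> \<longrightarrow> ennreal (norm (G z)) \<le> f z"
    using fG by eventually_elim (auto simp: indicator_def split: if_splits)
  have rf: "decr_rearr (lebesgue_on \<Omega>) G = decr_inverse (distribution_fun f)"
    unfolding decr_rearr_eq
  proof (rule decr_inverse_cong)
    fix t :: real assume t: "0 \<le> t"
    have \<Omega>s: "\<Omega> \<in> sets lebesgue" using \<Omega> by (simp add: borel_open)
    have "Measurable.pred lebesgue (\<lambda>z. ennreal t < ennreal (norm (G z)) * indicator \<Omega> z)"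
      using L1_loc_norm_measurable[OF \<Omega> GL] by measurable
    moreover have level: "{z. ennreal t < ennreal (norm (G z)) * indicator \<Omega> z} = {z \<in> \<Omega>. t < norm (G z)}"
      using t by (auto simp: indicator_def ennreal_less_iff split: if_splits)
    ultimately have s: "{z \<in> \<Omega>. t < norm (G z)} \<in> sets lebesgue" by (simp add: pred_def)
    have "emeasure (lebesgue_on \<Omega>) {z \<in> space (lebesgue_on \<Omega>). t < norm (G z)} = emeasure lebesgue {z \<in> \<Omega>. t < norm (G z)}"
      using \<Omega>s by (subst emeasure_restrict_space) (auto simp: space_restrict_space)
    also have "\<dots> = emeasure lebesgue {z. ennreal t < f z}"
    proof (rule emeasure_eq_AE)
      show "AE z in lebesgue. z \<in> {z \<in> \<Omega>. t < norm (G z)} \<longleftrightarrow> z \<in> {z. ennreal t < f z}"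
        using AE_completion[OF fG]
        unfolding level[symmetric] by eventually_elim simp
    qed (use s superlevel_sets[OF f] in auto)
    also have "\<dots> = distribution_fun f t" using superlevel_sets[OF f] by simp
    finally show "emeasure (lebesgue_on \<Omega>) {z \<in> space (lebesgue_on \<Omega>). t < norm (G z)} = distribution_fun f t" .
  qed
  define hf where "hf = distribution_fun f"
  have hf_anti: "antimono hf" unfolding hf_def by (rule distribution_fun_antimono[OF f])

  define hg where "hg = (\<lambda>t. hausdorff_outer ?d {y \<in> frontier \<Omega>. t < norm (u y)})"
  have hg_anti: "antimono hg" unfolding hg_def by (rule hausdorff_superlevel_antimono)
  \<comment> \<open>Continuity of u on the closure makes the superlevel sets on the boundary Borel,
    so that the measure agrees there with the outer measure used for covering.\<close>
  have rg: "decr_rearr (restrict_space (hausdorff_measure ?d) (frontier \<Omega>)) u = decr_inverse hg"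
    unfolding decr_rearr_eq
  proof (rule decr_inverse_cong)
    fix t :: real
    have "continuous_on (frontier \<Omega>) (\<lambda>y. norm (u y))"
      using ucl by (intro continuous_on_norm) (auto intro: continuous_on_subset simp: frontier_def)
    then have "{y \<in> frontier \<Omega>. t < norm (u y)} \<in> sets borel"
      by (intro superlevel_borel) auto
    moreover have "emeasure (restrict_space (hausdorff_measure ?d) (frontier \<Omega>)) {y \<in> frontier \<Omega>. t < norm (u y)}
        = emeasure (hausdorff_measure ?d) {y \<in> frontier \<Omega>. t < norm (u y)}"
      by (rule emeasure_restrict_space) auto
    ultimately show "emeasure (restrict_space (hausdorff_measure ?d) (frontier \<Omega>))
        {x \<in> space (restrict_space (hausdorff_measure ?d) (frontier \<Omega>)). t < norm (u x)} = hg t"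
      by (simp add: space_restrict_space emeasure_hausdorff_measure hg_def)
  qed

  define a where "a = s powr (- (?n - 1) / \<alpha>)"
  define S where "S = s powr (?n / \<alpha>)"
  define \<sigma> where "\<sigma> = s powr ((?n - 1) / \<alpha>)"
  define If where "If = (\<integral>\<^sup>+r\<in>{0..S}. decr_inverse hf r \<partial>lborel)"
  define Jf where "Jf = (\<integral>\<^sup>+r\<in>{S..}. ennreal (r powr (- (?n - 1) / ?n)) * decr_inverse hf r \<partial>lborel)"
  define Ig where "Ig = (\<integral>\<^sup>+r\<in>{0..\<sigma>}. decr_inverse hg r \<partial>lborel)"
  have pos: "0 < a" "0 < S" "0 < \<sigma>" using s by (simp_all add: a_def S_def \<sigma>_def)
  have "decr_rearr \<mu> u s \<le> ennreal C' * (ennreal a * If + Jf + ennreal a * Ig)" (is "_ \<le> ?R")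
  proof (rule ccontr)
    assume "\<not> ?thesis"
    then obtain t where t: "?R < ennreal t" "ennreal t < decr_rearr \<mu> u s"
      using ennreal_rat_dense[of ?R "decr_rearr \<mu> u s"] by (auto simp: not_le)
    have tpos: "0 < t" using t(1) by (metis ennreal_less_zero_iff gr_zeroI not_less_zero)
    define B where "B = {x \<in> \<Omega>. t < norm (u x)}"
    have uB: "B \<in> sets borel" unfolding B_def
      using \<Omega> ucl closure_subset by (intro superlevel_borel continuous_on_norm) (auto intro: borel_open continuous_on_subset)
    have "\<not> emeasure \<mu> B \<le> ennreal s"
    proof
      assume "emeasure \<mu> B \<le> ennreal s"
      then have "decr_rearr \<mu> u s \<le> ennreal t"
        unfolding decr_rearr_def using tpos by (intro INF_lower) (simp add: B_def sp)
      with t(2) show False by simp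
    qed
    moreover have "B \<inter> \<Omega> = B" by (auto simp: B_def)
    ultimately have "ennreal s < emeasure \<nu> B" using \<nu>_eq[OF uB] by (simp add: not_le)
    \<comment> \<open>Cutting with a large ball makes the measure finite while keeping it above
      s.\<close>
    also have "B = (\<Union>k::nat. B \<inter> ball 0 (real k))" using reals_Archimedean2 by auto
    also have "emeasure \<nu> \<dots> = (SUP k::nat. emeasure \<nu> (B \<inter> ball 0 (real k)))"
      using uB by (intro SUP_emeasure_incseq[symmetric]) (auto simp: incseq_def sets_borel)
    finally obtain k :: nat where k: "ennreal s < emeasure \<nu> (B \<inter> ball 0 (real k))"
      unfolding less_SUP_iff by blast
    define E where "E = B \<inter> ball 0 (real k)"
    have E: "E \<in> sets borel" "E \<subseteq> \<Omega>" "0 < emeasure \<nu> E" "emeasure \<nu> E < top"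
    proof -
      show "E \<in> sets borel" using uB by (simp add: E_def)
      show "E \<subseteq> \<Omega>" by (auto simp: E_def B_def)
      show "0 < emeasure \<nu> E" using k unfolding E_def by (rule le_less_trans[rotated]) simp
      have "emeasure \<nu> E \<le> emeasure \<nu> (ball 0 (real (Suc k)))"
        by (intro emeasure_mono) (auto simp: E_def sets_borel)
      also have "\<dots> \<le> ennreal (M * real (Suc k) powr \<alpha>)" by (rule ball_le) simp
      finally show "emeasure \<nu> E < top" by (rule le_less_trans) simp
    qed
    define m where "m = measure \<nu> E"
    have ms: "s < m"
      using k E(4) s unfolding E_def[symmetric] m_def by (simp add: emeasure_eq_ennreal_measure ennreal_less_iff)
    then have mpos: "0 < m" using s by simp

    \<comment> \<open>The right side lies below the finite number t, so all three integrals are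
      finite. Hence the truncation levels are finite as well, and the argument may continue in the
      reals.\<close>
    have Rtop: "?R < top" using t(1) by (rule less_trans) simp
    then have fin: "If < top" "Jf < top" "Ig < top"
      using C'(2) pos(1) by (auto simp: ennreal_mult_less_top)
    obtain i j g where ijg: "If = ennreal i" "0 \<le> i" "Jf = ennreal j" "0 \<le> j" "Ig = ennreal g" "0 \<le> g"
      using fin by (metis ennreal_cases less_irrefl top_neq_ennreal infinity_ennreal_def)
    have Sl: "ennreal S * decr_inverse hf S \<le> If" unfolding If_def using pos by (intro mult_decr_inverse_le) simp
    have \<sigma>l: "ennreal \<sigma> * decr_inverse hg \<sigma> \<le> Ig" unfolding Ig_def using pos by (intro mult_decr_inverse_le) simp
    obtain lf where lf: "decr_inverse hf S = ennreal lf" "0 \<le> lf"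
      using Sl fin(1) pos(2) by (cases "decr_inverse hf S") (auto simp: ennreal_mult_top)
    obtain lg where lg: "decr_inverse hg \<sigma> = ennreal lg" "0 \<le> lg"
      using \<sigma>l fin(3) pos(3) by (cases "decr_inverse hg \<sigma>") (auto simp: ennreal_mult_top)
    have Slf: "S * lf \<le> i" using Sl pos lf ijg by (simp add: ennreal_mult[symmetric])
    have \<sigma>lg: "\<sigma> * lg \<le> g" using \<sigma>l pos lg ijg by (simp add: ennreal_mult[symmetric])

    let ?K = "riesz_const" and ?Kl = "lborel_riesz_const CARD('n)" and ?Ksh = "shadow_growth_const"
    let ?Cp = "pointwise_const CARD('n)" and ?\<omega> = "unit_ball_vol ?n" and ?A = "measure lborel (annulus :: (real^'n) set)"
    have Kpos: "0 < ?K" "0 < ?Kl" "0 < ?Ksh" "0 < ?Cp" "0 < ?\<omega>" "0 \<le> ?A"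
      using riesz_const_pos lborel_riesz_const_pos[where 'a = "real^'n"] shadow_growth_const_pos
        moll_const_pos[of "CARD('n)"] riesz_mean_const_pos[where 'a = "real^'n"] n
      by (auto simp: pointwise_const_def)
    define P where "P = m powr (1 - real ?d / \<alpha>)"
    have Ppos: "0 < P" using mpos by (simp add: P_def)
    have Aeq: "emeasure lborel (annulus :: (real^'n) set) = ennreal ?A"
      using emeasure_annulus_finite[where 'a = "real^'n"] by (simp add: emeasure_eq_ennreal_measure)
    have est: "ennreal ?\<omega> * ennreal t * ennreal m \<le>
        ennreal ?Cp * (ennreal (?K * P) * If + ennreal ?Kl * (ennreal (lf * S powr (1 / ?n)) + Jf) * ennreal m)
        + 3 * (ennreal lg * emeasure lborel (annulus :: (real^'n) set) * ennreal m + ennreal (?Ksh * P) * Ig)"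
      unfolding If_def Jf_def Ig_def hf_def hg_def P_def m_def
    proof (rule set_averaged_estimate[OF n bg \<Omega> u G f Gf E _ lf(2) pos(2) _ lg(2)])
      show "t \<le> norm (u x)" if "x \<in> E" for x using that by (simp add: E_def B_def)
      show "distribution_fun f t' \<le> ennreal S" if "lf < t'" for t'
        using le_of_decr_inverse_less[OF hf_anti, of S t'] that lf by (simp add: hf_def ennreal_less_iff)
      show "hausdorff_outer ?d {y \<in> frontier \<Omega>. t' < norm (u y)} \<le> ennreal \<sigma>" if "lg < t'" for t'
        using le_of_decr_inverse_less[OF hg_anti, of \<sigma> t'] that lg by (simp add: hg_def ennreal_less_iff)
    qed
    \<comment> \<open>With every quantity finite the estimate passes to real numbers, where m can be
      cancelled at the end.\<close>
    have real_est: "?\<omega> * t * m \<le> ?Cp * (?K * P * i + ?Kl * (lf * S powr (1 / ?n) + j) * m) + 3 * (lg * ?A * m + ?Ksh * P * g)"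
    proof -
      have nonneg: "0 \<le> lf * S powr (1 / ?n)" "0 \<le> m" "0 \<le> t" "0 \<le> P" using lf mpos tpos Ppos by auto
      have three: "(3::ennreal) = ennreal 3" by simp
      have "ennreal (?\<omega> * t * m) \<le> ennreal (?Cp * (?K * P * i + ?Kl * (lf * S powr (1 / ?n) + j) * m) + 3 * (lg * ?A * m + ?Ksh * P * g))"
        using est nonneg Kpos ijg lg unfolding Aeq ijg three
        by (simp only: ennreal_mult[symmetric] ennreal_plus[symmetric] mult_nonneg_nonneg add_nonneg_nonneg less_imp_le zero_le_numeral)
      moreover have "0 \<le> ?Cp * (?K * P * i + ?Kl * (lf * S powr (1 / ?n) + j) * m) + 3 * (lg * ?A * m + ?Ksh * P * g)"
        using nonneg Kpos ijg lg lf by (intro add_nonneg_nonneg mult_nonneg_nonneg) auto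
      ultimately show ?thesis by (simp add: ennreal_le_iff)
    qed

    \<comment> \<open>P is m times m^(-(n-1)/\<alpha>), and this negative power only grows when m is
      replaced by the smaller s.\<close>
    have Pa: "P \<le> a * m"
    proof -
      have "1 - real ?d / \<alpha> = 1 + - (?n - 1) / \<alpha>" by (simp only: d minus_divide_left diff_conv_add_uminus)
      then have "P = m * m powr (- (?n - 1) / \<alpha>)"
        using mpos by (simp only: P_def powr_add) simp
      also have "m powr (- (?n - 1) / \<alpha>) \<le> a"
        unfolding a_def using ms s \<alpha>pos n by (intro powr_mono2') (auto simp: divide_nonpos_pos)
      finally show ?thesis using mpos by (simp add: mult.commute mult_left_mono)
    qed
    \<comment> \<open>Both sides are s^(1/\<alpha>). This is what fixes the truncation at S =
      s^(n/\<alpha>): the term lf S^(1/n) becomes a S lf, which is at most a times the integral of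
      the rearrangement over [0, S].\<close>
    have "S powr (1 / ?n) = a * S"
    proof -
      have "- (?n - 1) / \<alpha> + ?n / \<alpha> = 1 / \<alpha>" by (simp add: add_divide_distrib[symmetric])
      then have "a * S = s powr (1 / \<alpha>)" using s by (simp add: a_def S_def powr_add[symmetric])
      then show ?thesis using n by (simp add: S_def powr_powr)
    qed
    then have lfa: "lf * S powr (1 / ?n) \<le> a * i"
      using mult_left_mono[OF Slf, of a] pos by (simp add: mult_ac)
    \<comment> \<open>In the same way lg = a \<sigma> lg is at most a times the boundary integral,
      so the constant part of the boundary data needs no term of its own.\<close>
    have "a * \<sigma> = 1"
    proof -
      have "- (?n - 1) / \<alpha> + (?n - 1) / \<alpha> = 0" by (simp add: add_divide_distrib[symmetric])
      then show ?thesis using s by (simp add: a_def \<sigma>_def powr_add[symmetric])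
    qed
    then have lga: "lg \<le> a * g"
      using mult_left_mono[OF \<sigma>lg, of a] pos by (simp add: mult.assoc[symmetric])
    \<comment> \<open>The bracket of the theorem; each of the four contributions is now at most a
      constant times X m.\<close>
    define X where "X = a * i + j + a * g"
    have X: "a * i \<le> X" "a * i + j \<le> X" "a * g \<le> X" "0 \<le> X" using pos ijg by (auto simp: X_def)
    have PX: "P * y \<le> X * m" if "0 \<le> y" "a * y \<le> X" for y
    proof -
      have "P * y \<le> a * m * y" using Pa that(1) by (rule mult_right_mono)
      also have "\<dots> = a * y * m" by (simp only: mult_ac)
      also have "\<dots> \<le> X * m" using that(2) mpos by (intro mult_right_mono) auto
      finally show ?thesis .
    qed
    have "P * i \<le> X * m" by (rule PX[OF ijg(2) X(1)])
    then have 1: "?K * P * i \<le> ?K * (X * m)" using Kpos by (simp add: mult.assoc mult_left_mono)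
    have "lf * S powr (1 / ?n) + j \<le> X" using lfa X by linarith
    then have 2: "?Kl * (lf * S powr (1 / ?n) + j) * m \<le> ?Kl * (X * m)"
      using Kpos mpos by (simp add: mult.assoc mult_left_mono mult_right_mono)
    have "lg \<le> X" using lga X by linarith
    then have "lg * m * ?A \<le> X * m * ?A" using Kpos mpos by (intro mult_right_mono) auto
    then have 3: "lg * ?A * m \<le> ?A * (X * m)" by (simp only: mult_ac)
    have "P * g \<le> X * m" by (rule PX[OF ijg(6) X(3)])
    then have 4: "?Ksh * P * g \<le> ?Ksh * (X * m)" using Kpos by (simp add: mult.assoc mult_left_mono)
    have "?\<omega> * t * m \<le> ?Cp * (?K * (X * m) + ?Kl * (X * m)) + 3 * (?A * (X * m) + ?Ksh * (X * m))"
      using Kpos by (intro order_trans[OF real_est] add_mono[OF mult_left_mono mult_left_mono] add_mono 1 2 3 4) auto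
    also have "\<dots> = (?Cp * (?K + ?Kl) + 3 * (?A + ?Ksh)) * X * m" by (simp add: algebra_simps)
    finally have "?\<omega> * t \<le> (?Cp * (?K + ?Kl) + 3 * (?A + ?Ksh)) * X" using mpos by simp
    then have "t \<le> c\<^sub>0 * X" using Kpos(5) unfolding c\<^sub>0_def by (simp add: pos_le_divide_eq mult.commute)
    also have "\<dots> \<le> C' * X" using C' X by (intro mult_right_mono)
    finally have "ennreal t \<le> ennreal (C' * X)" by (rule ennreal_leI)
    also have "\<dots> = ?R" using C' pos ijg by (simp add: X_def ennreal_mult)
    finally show False using t(1) by simp
  qed
  then show ?thesis unfolding a_def S_def \<sigma>_def If_def Jf_def Ig_def hf_def rf rg .
qed

theorem theorem3p1:
  assumes "CARD('n::finite) \<ge> 2"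
  shows "let n = real CARD('n) in
    \<exists>c::real. c > 0 \<and>
     (\<forall>\<alpha> C\<mu> :: real. n - 1 < \<alpha> \<and> \<alpha> \<le> n \<and> C\<mu> > 0 \<longrightarrow>
      (\<exists>C::real. C > 0 \<and>
       (\<forall>(\<Omega> :: (real^'n) set) (\<mu> :: (real^'n) measure).
          open \<Omega> \<and> sets \<mu> = sets (restrict_space borel \<Omega>) \<and>
          (\<forall>x\<in>\<Omega>. \<forall>r>0. emeasure \<mu> (ball x r \<inter> \<Omega>) \<le> ennreal (C\<mu> * r powr \<alpha>)) \<longrightarrow>
          (\<forall>u \<in> E11 \<Omega> \<inter> Cb_closure \<Omega>. \<forall>Eu. has_sym_grad \<Omega> u Eu \<longrightarrow>
            (\<forall>s>0.
               decr_rearr \<mu> u (c * s) \<le> ennreal C *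
                 (ennreal (s powr (- (n - 1) / \<alpha>)) *
                    (\<integral>\<^sup>+r\<in>{0..s powr (n / \<alpha>)}. decr_rearr (lebesgue_on \<Omega>) Eu r \<partial>lborel)
                + (\<integral>\<^sup>+r\<in>{s powr (n / \<alpha>)..}.
                      ennreal (r powr (- (n - 1) / n)) * decr_rearr (lebesgue_on \<Omega>) Eu r \<partial>lborel)
                + ennreal (s powr (- (n - 1) / \<alpha>)) *
                    (\<integral>\<^sup>+r\<in>{0..s powr ((n - 1) / \<alpha>)}.
                      decr_rearr (restrict_space (hausdorff_measure (CARD('n) - 1)) (frontier \<Omega>)) u r
                      \<partial>lborel)))))))"
  unfolding Let_def
proof (rule exI[of _ "1::real"], intro conjI allI impI, goal_cases)
  case (2 \<alpha> C)
  \<comment> \<open>Only n, \<alpha> and the growth constant enter; 2^\<alpha> comes from extending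
    \<mu> to arbitrary centres, and the maximum with 1 makes positivity immediate.\<close>
  define C' where "C' = max 1 ((pointwise_const CARD('n) *
        (ball_growth.riesz_const (CARD('n) - 1) \<alpha> (C * 2 powr \<alpha>) + lborel_riesz_const CARD('n))
      + 3 * (measure lborel (annulus :: (real^'n) set)
        + ball_growth.shadow_growth_const TYPE(real^'n) (CARD('n) - 1) \<alpha> (C * 2 powr \<alpha>)))
      / unit_ball_vol CARD('n))"
  show ?case
  proof (rule exI[of _ C'], intro conjI allI impI ballI, goal_cases)
    case (2 \<Omega> \<mu> u Eu s)
    then have "u \<in> L1_loc \<Omega>" "u \<in> Cb_closure \<Omega>" by (auto simp: E11_def)
    then show ?case
      unfolding mult_1 using assms \<open>real CARD('n) - 1 < \<alpha> \<and> _\<close> 2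
      by (intro rearrangement_estimate[where C = C]) (auto simp: C'_def)
  qed (simp add: C'_def)
qed simp

end
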